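(* Let $n\ge 1$ and let $G$ be a simple connected graph which contains the complete graph $K_n$ as a subgraph. If $|V(G)|\le n+3$, then $G$ is linearly free.
   Context: Graphs are regarded as topological 1-complexes. An embedding $f:G\to\mathbb{R}^3$ is linear if every edge is mapped onto a straight line segment, and free if $\pi_1(\mathbb{R}^3-f(G))$ is a free group. A simple connected graph is linearly free if every linear embedding of it into $\mathbb{R}^3$ is free. *)

theory Defs
  imports "HOL-Analysis.Analysis" "HOL-Algebra.Group"
begin

section \<open>Finite simple graphs\<close>

text \<open>A simple graph: finite vertex set V, edges are 2-element subsets of V.\<close>
definition simple_graph :: "'a set \<Rightarrow> 'a set set \<Rightarrow> bool" where
  "simple_graph V E \<longleftrightarrow> finite V \<and>
     (\<forall>e\<in>E. \<exists>u v. u \<in> V \<and> v \<in> V \<and> u \<noteq> v \<and> e = {u, v})"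

definition graph_connected :: "'a set \<Rightarrow> 'a set set \<Rightarrow> bool" where
  "graph_connected V E \<longleftrightarrow> V \<noteq> {} \<and>
     (\<forall>u\<in>V. \<forall>v\<in>V. (u, v) \<in> {(x, y). {x, y} \<in> E}\<^sup>*)"

text \<open>G contains the complete graph K_n as a subgraph.\<close>
definition contains_complete :: "'a set \<Rightarrow> 'a set set \<Rightarrow> nat \<Rightarrow> bool" where
  "contains_complete V E n \<longleftrightarrow>
     (\<exists>W \<subseteq> V. card W = n \<and> (\<forall>u\<in>W. \<forall>v\<in>W. u \<noteq> v \<longrightarrow> {u, v} \<in> E))"

section \<open>Linear embeddings into R^3\<close>

definition edge_seg :: "('a \<Rightarrow> real^3) \<Rightarrow> 'a set \<Rightarrow> (real^3) set" where
  "edge_seg f e = convex hull (f ` e)"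

text \<open>The image of the 1-complex G under the linear map determined by the vertex positions.\<close>
definition graph_image :: "'a set \<Rightarrow> 'a set set \<Rightarrow> ('a \<Rightarrow> real^3) \<Rightarrow> (real^3) set" where
  "graph_image V E f = f ` V \<union> (\<Union>e\<in>E. edge_seg f e)"

text \<open>The linear map is an embedding (injective on the realization): distinct vertices go to
  distinct points, no vertex lies on a non-incident edge segment, and two distinct edge
  segments meet exactly in the images of their common endpoints.\<close>
definition linear_embedding :: "'a set \<Rightarrow> 'a set set \<Rightarrow> ('a \<Rightarrow> real^3) \<Rightarrow> bool" where
  "linear_embedding V E f \<longleftrightarrow> inj_on f V \<and>
     (\<forall>e\<in>E. \<forall>w\<in>V. w \<notin> e \<longrightarrow> f w \<notin> edge_seg f e) \<and>
     (\<forall>e\<in>E. \<forall>e'\<in>E. e \<noteq> e' \<longrightarrow> edge_seg f e \<inter> edge_seg f e' = f ` (e \<inter> e'))"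

section \<open>Fundamental group\<close>

definition fundamental_group :: "'b::real_normed_vector set \<Rightarrow> 'b \<Rightarrow> (real \<Rightarrow> 'b) set monoid" where
  "fundamental_group S b =
    \<lparr> carrier = {{q. homotopic_paths S p q} | p.
                    path p \<and> path_image p \<subseteq> S \<and> pathstart p = b \<and> pathfinish p = b},
      mult = (\<lambda>A B. {r. \<exists>p\<in>A. \<exists>q\<in>B. homotopic_paths S (p +++ q) r}),
      one = {q. homotopic_paths S (linepath b b) q} \<rparr>"

section \<open>Free groups\<close>

text \<open>Words over generators (x, True) = x and (x, False) = x^-1; stack-based free reduction.\<close>
fun free_reduce :: "('x \<times> bool) list \<Rightarrow> ('x \<times> bool) list" where
  "free_reduce [] = []"
| "free_reduce (a # w) =
     (case free_reduce w of
        [] \<Rightarrow> [a]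
      | b # w' \<Rightarrow> (if fst a = fst b \<and> snd a \<noteq> snd b then w' else a # b # w'))"

definition free_group_on :: "'x set \<Rightarrow> ('x \<times> bool) list monoid" where
  "free_group_on X =
    \<lparr> carrier = {w. fst ` set w \<subseteq> X \<and> free_reduce w = w},
      mult = (\<lambda>u v. free_reduce (u @ v)),
      one = [] \<rparr>"

text \<open>A group is free if it is isomorphic to a free group on some set of generators
  (countably many generators suffice for the groups considered here).\<close>
definition is_free_group :: "('g, 'm) monoid_scheme \<Rightarrow> bool" where
  "is_free_group G \<longleftrightarrow> (\<exists>X :: nat set. G \<cong> free_group_on X)"

definition linearly_free :: "'a set \<Rightarrow> 'a set set \<Rightarrow> bool" where
  "linearly_free V E \<longleftrightarrow>
     (\<forall>f. linear_embedding V E f \<longrightarrow>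
        (\<forall>b \<in> - graph_image V E f. is_free_group (fundamental_group (- graph_image V E f) b)))"

end

theory Submission
  imports Defs
begin

text \<open>
  Fix a linear embedding of the graph. Every vertex outside the complete subgraph gets a parent, one step
  closer to the complete subgraph. There are at most three of them, so some direction h is
  non-decreasing along all the edges from a parent to its child; a small perturbation, realised by a
  homeomorphism of space, makes h strictly increasing along these edges and non-constant on every edge.
  Since any two vertices of the complete subgraph are joined, h then has a unique local minimum on the graph.

  Now sweep a horizontal plane downwards and look at the complement of the graph above the plane. Nothing
  changes between vertices, and passing a vertex with a > 0 edges going down multiplies the fundamental
  group by a free group of rank a - 1: no relation is ever created. At the unique local minimum, the
  complement above it already has the fundamental group of the whole complement, because the rest is the
  complement of a convex cone.

  The required instances of van Kampen's theorem are handled by means of multiplicative, homotopy invariant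
  functions on paths with values in a free group: such functions can be glued, and they detect that the
  loops at hand generate freely.
\<close>

section \<open>The free group on reduced words\<close>

text \<open>A vertex without an edge going down is the danger: when the plane passes below it, the
  loop that encircles its edges is filled in, and a relation may arise. Parents, common direction
  and perturbation serve to exclude such vertices except the global minimum, and there the loop is
  already null, since scaling from the minimum lifts it above the whole graph. No isotopy of the
  whole graph is built. In a thin slab around a level, projection along a suitable horizontal
  direction is injective on the graph, so a shear flattens that part of the graph into a plane,
  where only finitely many fans of strands are left. The admissible thickness depends on the level;
  therefore the sweep is an induction over the reals, with a step below each level and a passage to
  limits that rests on the compactness of loops and homotopies. Generation and freeness are carried
  along by explicit loops and one homomorphism to the free group on countably many letters, so no
  pushout of groups is formed.\<close>

definition cons_reduce :: "'x \<times> bool \<Rightarrow> ('x \<times> bool) list \<Rightarrow> ('x \<times> bool) list" where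
  "cons_reduce a w = (case w of [] \<Rightarrow> [a]
     | b # w' \<Rightarrow> if fst a = fst b \<and> snd a \<noteq> snd b then w' else a # b # w')"

lemma free_reduce_Cons: "free_reduce (a # w) = cons_reduce a (free_reduce w)"
  by (simp add: cons_reduce_def)

declare free_reduce.simps(2) [simp del]

fun reduced :: "('x \<times> bool) list \<Rightarrow> bool" where
  "reduced (a # b # w) \<longleftrightarrow> \<not> (fst a = fst b \<and> snd a \<noteq> snd b) \<and> reduced (b # w)"
| "reduced _ \<longleftrightarrow> True"

lemma reduced_tl: "reduced (a # w) \<Longrightarrow> reduced w"
  by (cases w) auto

lemma reduced_cons_reduce: "reduced w \<Longrightarrow> reduced (cons_reduce a w)"
  by (cases w) (auto simp: cons_reduce_def dest: reduced_tl)

lemma reduced_free_reduce: "reduced (free_reduce w)"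
  by (induction w) (auto simp: free_reduce_Cons reduced_cons_reduce)

lemma free_reduce_reduced: "reduced w \<Longrightarrow> free_reduce w = w"
  by (induction w rule: reduced.induct) (auto simp: free_reduce_Cons cons_reduce_def)

lemma free_reduce_idem [simp]: "free_reduce (free_reduce w) = free_reduce w"
  by (simp add: free_reduce_reduced reduced_free_reduce)

text \<open>Letters act on reduced words, and opposite letters act as mutually inverse maps. This is
  van der Waerden's action; the group laws of \<open>free_group_on\<close> are read off from it,
  without a confluence argument for cancellation.\<close>

lemma cons_reduce_cancel:
  assumes "reduced w" "fst a = fst b" "snd a \<noteq> snd b"
  shows "cons_reduce a (cons_reduce b w) = w"
proof (cases w)
  case Nil
  then show ?thesis using assms by (auto simp: cons_reduce_def)
next
  case (Cons d w')
  show ?thesis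
  proof (cases "fst b = fst d \<and> snd b \<noteq> snd d")
    case True
    then have "a = d" using assms by (auto simp: prod_eq_iff)
    then show ?thesis using True Cons assms by (cases w') (auto simp: cons_reduce_def)
  next
    case False
    then show ?thesis using Cons assms by (auto simp: cons_reduce_def)
  qed
qed

lemma free_reduce_append: "free_reduce (u @ v) = foldr cons_reduce u (free_reduce v)"
  by (induction u) (auto simp: free_reduce_Cons)

lemma reduced_foldr_cons_reduce: "reduced w \<Longrightarrow> reduced (foldr cons_reduce u w)"
  by (induction u) (auto simp: reduced_cons_reduce)

text \<open>A word and its reduction act alike on reduced words, because a cancelled pair of letters
  acts trivially. Associativity of the product of reduced words follows.\<close>

lemma foldr_cons_reduce_free_reduce:
  "reduced w \<Longrightarrow> foldr cons_reduce (free_reduce u) w = foldr cons_reduce u w"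
proof (induction u)
  case (Cons a u)
  have "foldr cons_reduce (cons_reduce a (free_reduce u)) w
      = cons_reduce a (foldr cons_reduce (free_reduce u) w)"
    using Cons.prems
    by (cases "free_reduce u")
      (auto simp: cons_reduce_def[of a "_ # _"] cons_reduce_def[of a "[]"]
         cons_reduce_cancel reduced_foldr_cons_reduce)
  then show ?case using Cons by (simp add: free_reduce_Cons)
qed simp

lemma free_reduce_append_left: "free_reduce (free_reduce u @ v) = free_reduce (u @ v)"
  by (simp add: free_reduce_append foldr_cons_reduce_free_reduce reduced_free_reduce)

lemma free_reduce_append_right: "free_reduce (u @ free_reduce v) = free_reduce (u @ v)"
  by (simp add: free_reduce_append)

lemma set_free_reduce: "set (free_reduce w) \<subseteq> set w"
proof (induction w)
  case (Cons a w)
  then show ?case by (auto simp: free_reduce_Cons cons_reduce_def split: list.splits if_splits)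
qed simp

definition word_inv :: "('x \<times> bool) list \<Rightarrow> ('x \<times> bool) list" where
  "word_inv w = rev (map (\<lambda>(x, s). (x, \<not> s)) w)"

lemma free_reduce_word_inv: "free_reduce (word_inv w @ w) = []"
proof -
  have "reduced v \<Longrightarrow> foldr cons_reduce (word_inv w) (foldr cons_reduce w v) = v" for v
    by (induction w arbitrary: v)
      (auto simp: word_inv_def cons_reduce_cancel reduced_foldr_cons_reduce split: prod.splits)
  then show ?thesis by (simp add: free_reduce_append)
     (metis append_Nil2 free_reduce.simps(1) free_reduce_append reduced.simps(2))
qed

lemma set_word_inv: "fst ` set (word_inv w) = fst ` set w"
  by (force simp: word_inv_def image_iff)

lemma group_free_group_on: "group (free_group_on X)"
proof (rule groupI)
  fix x assume x: "x \<in> carrier (free_group_on X)"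
  then have "free_reduce (word_inv x) \<in> carrier (free_group_on X)"
    using set_word_inv[of x] set_free_reduce[of "word_inv x"]
    by (auto simp: free_group_on_def)
  moreover have "free_reduce (free_reduce (word_inv x) @ x) = []"
    by (simp add: free_reduce_append_left free_reduce_word_inv)
  ultimately show "\<exists>y\<in>carrier (free_group_on X). y \<otimes>\<^bsub>free_group_on X\<^esub> x = \<one>\<^bsub>free_group_on X\<^esub>"
    by (intro bexI[of _ "free_reduce (word_inv x)"]) (simp_all add: free_group_on_def)
next
  fix x y assume "x \<in> carrier (free_group_on X)" "y \<in> carrier (free_group_on X)"
  then show "x \<otimes>\<^bsub>free_group_on X\<^esub> y \<in> carrier (free_group_on X)"
    using set_free_reduce[of "x @ y"] by (fastforce simp: free_group_on_def)
qed (auto simp: free_group_on_def free_reduce_append_left free_reduce_append_right)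

section \<open>Cocycles on paths and van Kampen gluing\<close>

lemma (in group) inv_mult_cancel:
  assumes "x \<in> carrier G" "y \<in> carrier G" "z \<in> carrier G"
  shows "(inv x \<otimes> y) \<otimes> (inv y \<otimes> z) = inv x \<otimes> z"
  using assms by (simp add: m_assoc) (simp flip: m_assoc)

lemma (in group) inv_mult_eq_one:
  assumes "x \<in> carrier G" "y \<in> carrier G" "inv x \<otimes> y = \<one>"
  shows "y = x"
  using assms by (metis inv_closed inv_equality inv_inv)

locale path_cocycle = group H for H (structure) +
  fixes A :: "'a::real_normed_vector set" and c :: "(real \<Rightarrow> 'a) \<Rightarrow> 'h"
  assumes cocycle_closed: "path p \<Longrightarrow> path_image p \<subseteq> A \<Longrightarrow> c p \<in> carrier H"
    and cocycle_homotopic: "homotopic_paths A p q \<Longrightarrow> c p = c q"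
    and cocycle_join: "path p \<Longrightarrow> path q \<Longrightarrow> path_image p \<subseteq> A \<Longrightarrow> path_image q \<subseteq> A \<Longrightarrow>
       pathfinish p = pathstart q \<Longrightarrow> c (p +++ q) = c p \<otimes> c q"
begin

lemma cocycle_const: "x \<in> A \<Longrightarrow> c (linepath x x) = \<one>"
proof -
  assume x: "x \<in> A"
  have "c (linepath x x) = c (linepath x x +++ linepath x x)"
    using x by (intro cocycle_homotopic homotopic_paths_sym[OF homotopic_paths_lid']) auto
  also have "\<dots> = c (linepath x x) \<otimes> c (linepath x x)"
    using x by (intro cocycle_join) auto
  finally show ?thesis
    using x cocycle_closed[of "linepath x x"] by simp
qed

lemma cocycle_reversepath:
  assumes "path p" "path_image p \<subseteq> A"
  shows "c (reversepath p) = inv (c p)"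
proof -
  have "c (reversepath p) \<otimes> c p = c (reversepath p +++ p)"
    using assms by (subst cocycle_join) auto
  also have "\<dots> = c (linepath (pathfinish p) (pathfinish p))"
    using assms by (intro cocycle_homotopic homotopic_paths_linv) auto
  also have "\<dots> = \<one>"
    using assms by (intro cocycle_const) (auto simp: pathfinish_in_path_image subset_eq)
  finally show ?thesis
    using assms cocycle_closed by (metis inv_equality path_image_reversepath path_reversepath)
qed

end

lemma homotopic_triangle:
  fixes a b e :: "'k::real_normed_vector"
  assumes T: "convex T" "a \<in> T" "b \<in> T" "e \<in> T" and g: "continuous_on T g" "g ` T \<subseteq> S"
  shows "homotopic_paths S ((g \<circ> linepath a b) +++ (g \<circ> linepath b e)) (g \<circ> linepath a e)"
proof -
  have sub: "path_image (linepath x y) \<subseteq> T" if "x \<in> T" "y \<in> T" for x y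
    using that T(1) by (simp add: closed_segment_subset)
  have "homotopic_paths T (linepath a b +++ linepath b e) (linepath a e)"
  proof (rule homotopic_paths_linear)
    fix t :: real assume t: "t \<in> {0..1}"
    have "path_image (linepath a b +++ linepath b e) \<subseteq> T"
      using sub T path_image_join_subset[of "linepath a b" "linepath b e"] by blast
    then have "(linepath a b +++ linepath b e) t \<in> T" "linepath a e t \<in> T"
      using sub[of a e] T t unfolding path_image_def by blast+
    then show "closed_segment ((linepath a b +++ linepath b e) t) (linepath a e t) \<subseteq> T"
      using T(1) by (simp add: closed_segment_subset)
  qed auto
  then show ?thesis
    using homotopic_paths_continuous_image[of T _ _ g S] g
    by (force simp: image_subset_iff_funcset simp flip: path_compose_join)
qed

text \<open>A convex set is simply connected: a multiplicative function defined on pairs of nearby points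
  has a primitive, obtained by multiplying along a fine subdivision of the segment from a base point.\<close>

lemma (in group) convex_local_cocycle_potential:
  fixes K :: "'k::real_normed_vector set"
  assumes K: "convex K" "bounded K" and z: "z \<in> K" and e: "e > 0"
    and cl: "\<And>a b. a \<in> K \<Longrightarrow> b \<in> K \<Longrightarrow> dist a b < e \<Longrightarrow> d a b \<in> carrier G"
    and tri: "\<And>a b x. a \<in> K \<Longrightarrow> b \<in> K \<Longrightarrow> x \<in> K \<Longrightarrow> dist a b < e \<Longrightarrow> dist a x < e \<Longrightarrow> dist b x < e
        \<Longrightarrow> d a b \<otimes> d b x = d a x"
  shows "\<exists>g. (\<forall>a\<in>K. g a \<in> carrier G) \<and> (\<forall>a\<in>K. \<forall>b\<in>K. dist a b < e/2 \<longrightarrow> g b = g a \<otimes> d a b)"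
proof -
  obtain M where M: "\<And>x. x \<in> K \<Longrightarrow> norm (x - z) \<le> M" "M > 0"
  proof -
    obtain B where "B > 0" "\<And>x. x \<in> K \<Longrightarrow> norm x \<le> B" using K(2) bounded_pos by metis
    then show ?thesis using that[of "B + norm z"]
      by (smt (verit) norm_ge_zero norm_triangle_ineq4)
  qed
  \<comment> \<open>Steps along a segment from \<open>z\<close> are at most \<open>M / N\<close>
    long. The bound \<open>e/2\<close> instead of \<open>e\<close> leaves room for the diagonals
    used below.\<close>
  obtain N :: nat where N: "N > 0" "M / N < e/2"
  proof -
    obtain N :: nat where "M / (e/2) < N" using reals_Archimedean2 by blast
    moreover have "M / (e/2) > 0" using M(2) e by simp
    ultimately have "N > 0" by (intro gr0I) auto
    with \<open>M / (e/2) < N\<close> show ?thesis using that[of N] e by (simp add: field_simps)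
  qed
  define r where "r a i = z + (real i / N) *\<^sub>R (a - z)" for a i
  have rK: "r a i \<in> K" if "a \<in> K" "i \<le> N" for a i
  proof -
    have "r a i = (1 - real i / N) *\<^sub>R z + (real i / N) *\<^sub>R a"
      by (simp add: r_def algebra_simps)
    then show ?thesis using convexD[OF K(1) z that(1), of "1 - real i / N" "real i / N"] that N by auto
  qed
  have r1: "dist (r a i) (r a (Suc i)) < e/2" if "a \<in> K" for a i
  proof -
    have "r a (Suc i) = r a i + (1 / N) *\<^sub>R (a - z)"
      by (simp add: r_def add_divide_distrib scaleR_left_distrib)
    then have "dist (r a i) (r a (Suc i)) = norm ((1 / N) *\<^sub>R (a - z))"
      by (simp only: dist_norm) (simp add: norm_minus_commute)
    also have "\<dots> \<le> M / N" using M(1)[OF that] N by (simp add: divide_right_mono)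
    finally show ?thesis using N(2) by linarith
  qed
  have r2: "dist (r a i) (r b i) \<le> dist a b" if "i \<le> N" for a b i
  proof -
    have "r a i - r b i = (real i / N) *\<^sub>R (a - b)"
      by (simp add: r_def scaleR_diff_right)
    then have "dist (r a i) (r b i) = (real i / N) * dist a b"
      by (simp add: dist_norm)
    also have "\<dots> \<le> 1 * dist a b" using that N(1) by (intro mult_right_mono) (auto simp: divide_simps)
    finally show ?thesis by simp
  qed
  define P where "P a = (\<lambda>i. rec_nat \<one> (\<lambda>i x. x \<otimes> d (r a i) (r a (Suc i))) i)" for a
  have P0: "P a 0 = \<one>" and PS: "P a (Suc i) = P a i \<otimes> d (r a i) (r a (Suc i))" for a i
    by (simp_all add: P_def)
  have dst: "dist (r a i) (r a (Suc i)) < e" if "a \<in> K" for a i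
    using r1[OF that] e by (smt (verit) field_sum_of_halves)
  have Pc: "P a i \<in> carrier G" if "a \<in> K" "i \<le> N" for a i
    using that(2)
  proof (induction i)
    case (Suc i)
    then show ?case unfolding PS using that(1) rK[of a] dst[of a i] by (intro m_closed cl) auto
  qed (simp add: P0)
  \<comment> \<open>The segments from \<open>z\<close> to \<open>a\<close> and to \<open>b\<close>
    form a ladder. Each quadrilateral between consecutive rungs is cut by a diagonal, which is
    shorter than \<open>e/2 + e/2\<close>, into two triangles, and the triangle law moves the rung
    one step on.\<close>
  have main: "P b i \<otimes> \<one> = P a i \<otimes> d (r a i) (r b i)"
    if ab: "a \<in> K" "b \<in> K" "dist a b < e/2" and "i \<le> N" for a b i
    using that(4)
  proof (induction i)
    case 0
    have "r a 0 = z" "r b 0 = z" by (auto simp: r_def)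
    moreover have "d z z \<otimes> d z z = d z z" using tri[OF z z z] e by simp
    then have "d z z = \<one>" using cl[OF z z] e by simp
    ultimately show ?case by (simp add: P0)
  next
    case (Suc i)
    let ?a = "r a i" and ?b = "r b i" and ?a' = "r a (Suc i)" and ?b' = "r b (Suc i)"
    have K': "?a \<in> K" "?b \<in> K" "?a' \<in> K" "?b' \<in> K" using rK ab Suc.prems by auto
    have D: "dist ?a ?b < e/2" "dist ?a' ?b' < e/2" "dist ?a ?a' < e/2" "dist ?b ?b' < e/2"
      using r1 ab r2[of i a b] r2[of "Suc i" a b] Suc.prems by (force intro: le_less_trans)+
    have D': "dist ?a ?b < e" "dist ?a' ?b' < e" "dist ?a ?a' < e" "dist ?b ?b' < e" "dist ?a ?b' < e"
      using D e dist_triangle[of ?a ?b' ?b] by linarith+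
    have car: "P a i \<in> carrier G" "P b i \<in> carrier G" "d ?a ?b \<in> carrier G" "d ?b ?b' \<in> carrier G"
       "d ?a ?a' \<in> carrier G" "d ?a' ?b' \<in> carrier G"
      using Pc ab Suc.prems K' D' cl by auto
    have "P b (Suc i) = (P a i \<otimes> d ?a ?b) \<otimes> d ?b ?b'"
      using Suc car by (simp add: PS)
    also have "\<dots> = P a i \<otimes> (d ?a ?b \<otimes> d ?b ?b')" using car by (simp add: m_assoc)
    also have "d ?a ?b \<otimes> d ?b ?b' = d ?a ?a' \<otimes> d ?a' ?b'"
      using tri[of ?a ?b ?b'] tri[of ?a ?a' ?b'] K' D' by simp
    also have "P a i \<otimes> (d ?a ?a' \<otimes> d ?a' ?b') = P a (Suc i) \<otimes> d ?a' ?b'"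
      using car by (simp add: PS m_assoc)
    finally show ?case using Pc[of b "Suc i"] ab Suc.prems by simp
  qed
  show ?thesis
  proof (intro exI[of _ "\<lambda>a. P a N"] conjI ballI impI)
    show "P a N \<in> carrier G" if "a \<in> K" for a using Pc that by simp
    fix a b assume ab: "a \<in> K" "b \<in> K" "dist a b < e/2"
    have "r a N = a" "r b N = b" using N by (auto simp: r_def)
    then show "P b N = P a N \<otimes> d a b" using main[OF ab, of N] Pc ab by simp
  qed
qed

text \<open>Extension of a cocycle from \<open>A\<close> to \<open>A \<union> U\<close> by the value
  one on \<open>U\<close>. This form of van Kampen's theorem fits simply connected \<open>U\<close>:
  there the cocycle can be normalised beforehand so as to be trivial on the overlap.\<close>

locale cocycle_gluing = path_cocycle H A c for H (structure) and A :: "'a::real_normed_vector set" and c +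
  fixes U :: "'a set"
  assumes open_A: "open A" and open_U: "open U"
    and cocycle_trivial: "path p \<Longrightarrow> path_image p \<subseteq> A \<inter> U \<Longrightarrow> c p = \<one>"
begin

text \<open>The increment that the extended cocycle should have along a segment so short that
  \<open>g\<close> maps it into \<open>A\<close> or into \<open>U\<close>. The default value one
  covers the second case; for a segment mapped into both sets, \<open>cocycle_trivial\<close> makes
  the two readings agree.\<close>

definition transition :: "('k::real_normed_vector \<Rightarrow> 'a) \<Rightarrow> 'k \<Rightarrow> 'k \<Rightarrow> 'b" where
  "transition g a b = (if g ` closed_segment a b \<subseteq> A then c (g \<circ> linepath a b) else \<one>)"

text \<open>A primitive of the increments between nearby points. On the unit interval it computes
  the value of a path; on the unit square it proves homotopy invariance.\<close>

definition potential :: "'k::real_normed_vector set \<Rightarrow> ('k \<Rightarrow> 'a) \<Rightarrow> ('k \<Rightarrow> 'b) \<Rightarrow> bool" where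
  "potential K g G \<longleftrightarrow> G ` K \<subseteq> carrier H \<and>
     (\<exists>e>0. \<forall>a\<in>K. \<forall>b\<in>K. dist a b < e \<longrightarrow> G b = G a \<otimes> transition g a b)"

lemma potential_closed: "potential K g G \<Longrightarrow> a \<in> K \<Longrightarrow> G a \<in> carrier H"
  unfolding potential_def by blast

lemma potential_eq:
  assumes "potential K g G"
  obtains e where "e > 0" "\<And>a b. a \<in> K \<Longrightarrow> b \<in> K \<Longrightarrow> dist a b < e \<Longrightarrow> G b = G a \<otimes> transition g a b"
  using assms unfolding potential_def by blast

lemma path_comp_linepath:
  fixes a b :: "'k::real_normed_vector"
  assumes "continuous_on T g" "convex T" "a \<in> T" "b \<in> T"
  shows "path (g \<circ> linepath a b)" "path_image (g \<circ> linepath a b) \<subseteq> g ` T"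
proof -
  have "closed_segment a b \<subseteq> T" using assms by (simp add: closed_segment_subset)
  then show "path (g \<circ> linepath a b)" "path_image (g \<circ> linepath a b) \<subseteq> g ` T"
    using assms(1) by (auto simp: path_image_compose intro!: path_continuous_image continuous_on_subset[of T g])
qed

lemma transition_closed:
  fixes a b :: "'k::real_normed_vector"
  assumes "continuous_on T g" "convex T" "a \<in> T" "b \<in> T"
  shows "transition g a b \<in> carrier H"
  using path_comp_linepath[of "closed_segment a b" g a b] assms
    continuous_on_subset[OF assms(1) closed_segment_subset[OF assms(3,4,2)]]
  by (auto simp: transition_def intro!: cocycle_closed)

lemma transition_triangle:
  fixes a b x :: "'k::real_normed_vector"
  assumes g: "continuous_on T g" and T: "convex T" "a \<in> T" "b \<in> T" "x \<in> T"
    and gT: "g ` T \<subseteq> A \<or> g ` T \<subseteq> U"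
  shows "transition g a b \<otimes> transition g b x = transition g a x"
proof -
  have seg: "g ` closed_segment u v \<subseteq> g ` T" if "u \<in> T" "v \<in> T" for u v
    using that T by (simp add: closed_segment_subset image_mono)
  show ?thesis using gT
  proof
    assume A: "g ` T \<subseteq> A"
    then have eq: "transition g u v = c (g \<circ> linepath u v)" if "u \<in> T" "v \<in> T" for u v
      using subset_trans[OF seg[OF that] A] by (simp add: transition_def)
    have "c (g \<circ> linepath a b) \<otimes> c (g \<circ> linepath b x) = c ((g \<circ> linepath a b) +++ (g \<circ> linepath b x))"
      using path_comp_linepath[OF g T(1)] T A
      by (subst cocycle_join) (auto simp: pathstart_compose pathfinish_compose, blast+)
    also have "\<dots> = c (g \<circ> linepath a x)"
      using homotopic_triangle[OF T g A] by (rule cocycle_homotopic)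
    finally show ?thesis using eq T by simp
  next
    assume U: "g ` T \<subseteq> U"
    have "transition g u v = \<one>" if "u \<in> T" "v \<in> T" for u v
    proof (cases "g ` closed_segment u v \<subseteq> A")
      case True
      have "path (g \<circ> linepath u v)" using path_comp_linepath[OF g T(1)] that by blast
      moreover have "path_image (g \<circ> linepath u v) \<subseteq> A \<inter> U"
        using True seg[OF that] U by (auto simp: path_image_compose)
      ultimately show ?thesis using cocycle_trivial True by (simp add: transition_def)
    qed (simp add: transition_def)
    then show ?thesis using T by simp
  qed
qed

text \<open>A Lebesgue number for the preimages of \<open>A\<close> and \<open>U\<close> puts every
  small triangle on one side of the cover, so the increments obey the triangle law and
  \<open>convex_local_cocycle_potential\<close> integrates them.\<close>

lemma potential_exists:
  fixes K :: "'k::real_normed_vector set"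
  assumes K: "compact K" "convex K" "K \<noteq> {}" and g: "continuous_on K g" "g ` K \<subseteq> A \<union> U"
  obtains G where "potential K g G"
proof -
  obtain OA where OA: "open OA" "OA \<inter> K = g -` A \<inter> K"
    using continuous_on_open_invariant[THEN iffD1, OF g(1)] open_A by metis
  obtain OU where OU: "open OU" "OU \<inter> K = g -` U \<inter> K"
    using continuous_on_open_invariant[THEN iffD1, OF g(1)] open_U by metis
  obtain e where e: "e > 0" "\<And>x. x \<in> K \<Longrightarrow> \<exists>W\<in>{OA, OU}. ball x e \<subseteq> W"
  proof (rule Heine_Borel_lemma[OF K(1), of "{OA, OU}"])
    show "K \<subseteq> \<Union>{OA, OU}"
    proof
      fix x assume "x \<in> K"
      then have "x \<in> g -` A \<inter> K \<or> x \<in> g -` U \<inter> K" using g(2) by auto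
      then show "x \<in> \<Union>{OA, OU}" unfolding OA(2)[symmetric] OU(2)[symmetric] by auto
    qed
  qed (use OA(1) OU(1) in auto)
  have loc: "g ` (K \<inter> ball x e) \<subseteq> A \<or> g ` (K \<inter> ball x e) \<subseteq> U" if "x \<in> K" for x
  proof -
    have "K \<inter> ball x e \<subseteq> OA \<inter> K \<or> K \<inter> ball x e \<subseteq> OU \<inter> K" using e(2)[OF that] by auto
    then show ?thesis unfolding OA(2) OU(2) by auto
  qed
  obtain z where z: "z \<in> K" using K by auto
  have cl: "transition g a b \<in> carrier H" if "a \<in> K" "b \<in> K" "dist a b < e" for a b
    using transition_closed[OF g(1) K(2) that(1,2)] .
  have tri: "transition g a b \<otimes> transition g b x = transition g a x"
    if "a \<in> K" "b \<in> K" "x \<in> K" "dist a b < e" "dist a x < e" "dist b x < e" for a b x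
  proof (rule transition_triangle)
    show "continuous_on (K \<inter> ball a e) g" using g(1) by (rule continuous_on_subset) auto
    show "convex (K \<inter> ball a e)" using K(2) by (simp add: convex_Int)
    show "g ` (K \<inter> ball a e) \<subseteq> A \<or> g ` (K \<inter> ball a e) \<subseteq> U" using loc that by blast
  qed (use that e in auto)
  have "\<exists>G. (\<forall>a\<in>K. G a \<in> carrier H) \<and> (\<forall>a\<in>K. \<forall>b\<in>K. dist a b < e/2 \<longrightarrow> G b = G a \<otimes> transition g a b)"
    by (rule convex_local_cocycle_potential[OF K(2) compact_imp_bounded[OF K(1)] z e(1)])
       (fact cl, fact tri)
  then obtain G where G: "\<And>a. a \<in> K \<Longrightarrow> G a \<in> carrier H"
     "\<And>a b. a \<in> K \<Longrightarrow> b \<in> K \<Longrightarrow> dist a b < e/2 \<Longrightarrow> G b = G a \<otimes> transition g a b"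
    by auto
  have "potential K g G"
    unfolding potential_def
  proof (intro conjI exI[of _ "e/2"] ballI impI)
    show "G ` K \<subseteq> carrier H" using G(1) by blast
    show "e/2 > 0" using e(1) by simp
    show "G b = G a \<otimes> transition g a b" if "a \<in> K" "b \<in> K" "dist a b < e/2" for a b
      using that by (rule G(2))
  qed
  then show ?thesis by (rule that)
qed

lemma potential_segment:
  fixes K :: "'k::real_normed_vector set" and u v :: 'k
  assumes "potential K g G" "convex K" "u \<in> K" "v \<in> K"
  shows "potential {0..1} (g \<circ> linepath u v) (G \<circ> linepath u v)"
proof -
  obtain e where e: "e > 0" "\<And>a b. a \<in> K \<Longrightarrow> b \<in> K \<Longrightarrow> dist a b < e \<Longrightarrow> G b = G a \<otimes> transition g a b"
    by (rule potential_eq[OF assms(1)]) blast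
  have lK: "linepath u v t \<in> K" if "t \<in> {0..1}" for t
    using that assms linepath_in_convex_hull[of u K v t] by (simp add: hull_same hull_inc)
  have ll: "linepath u v \<circ> linepath a b = linepath (linepath u v a) (linepath u v b)" for a b :: real
    by (rule ext) (simp add: linepath_def algebra_simps)
  have seg: "linepath u v ` closed_segment a b = closed_segment (linepath u v a) (linepath u v b)" for a b :: real
    using ll[of a b] by (metis path_image_compose path_image_linepath)
  have tr: "transition (g \<circ> linepath u v) a b = transition g (linepath u v a) (linepath u v b)" for a b :: real
    unfolding transition_def image_comp[symmetric] seg by (simp add: comp_assoc ll)
  have dist: "dist (linepath u v a) (linepath u v b) \<le> dist a b * (norm (v - u) + 1)" for a b :: real
  proof -
    have "linepath u v a - linepath u v b = (a - b) *\<^sub>R (v - u)" by (simp add: linepath_def algebra_simps)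
    then have "dist (linepath u v a) (linepath u v b) = dist a b * norm (v - u)"
      by (simp only: dist_norm norm_scaleR) simp
    then show ?thesis by (simp add: distrib_left)
  qed
  show ?thesis unfolding potential_def
  \<comment> \<open>The summand 1 keeps the denominator positive when \<open>u = v\<close>.\<close>
  proof (intro conjI exI[of _ "e / (norm (v - u) + 1)"] ballI impI)
    show "(G \<circ> linepath u v) ` {0..1} \<subseteq> carrier H"
      using potential_closed[OF assms(1)] lK by auto
    show "e / (norm (v - u) + 1) > 0" using e(1) by (simp add: add_nonneg_pos)
    fix a b :: real assume ab: "a \<in> {0..1}" "b \<in> {0..1}" "dist a b < e / (norm (v - u) + 1)"
    have "dist (linepath u v a) (linepath u v b) < e"
      using dist[of a b] ab(3) by (smt (verit) norm_ge_zero pos_less_divide_eq)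
    then show "(G \<circ> linepath u v) b = (G \<circ> linepath u v) a \<otimes> transition (g \<circ> linepath u v) a b"
      unfolding tr using e(2)[OF lK lK, of a b] ab by (simp only: o_apply)
  qed
qed

text \<open>Two primitives differ by a left factor that is locally constant, hence constant on the
  interval; it cancels in \<open>inv (G 0) \<otimes> G 1\<close>.\<close>

lemma potential_unique:
  assumes "potential {0..1::real} g G" "potential {0..1} g G'" "continuous_on {0..1} g"
  shows "inv (G 0) \<otimes> G 1 = inv (G' 0) \<otimes> G' 1"
proof -
  obtain e where e: "e > 0" "\<And>a b. a \<in> {0..1} \<Longrightarrow> b \<in> {0..1} \<Longrightarrow> dist a b < e \<Longrightarrow> G b = G a \<otimes> transition g a b"
    by (rule potential_eq[OF assms(1)]) blast
  obtain e' where e': "e' > 0" "\<And>a b. a \<in> {0..1} \<Longrightarrow> b \<in> {0..1} \<Longrightarrow> dist a b < e' \<Longrightarrow> G' b = G' a \<otimes> transition g a b"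
    by (rule potential_eq[OF assms(2)]) blast
  have car: "G a \<in> carrier H" "G' a \<in> carrier H" if "a \<in> {0..1}" for a
    using potential_closed[OF assms(1) that] potential_closed[OF assms(2) that] by auto
  define k where "k a = G a \<otimes> inv (G' a)" for a
  have "k b = k a" if "a \<in> {0..1}" "b \<in> {0..1}" "dist a b < min e e'" for a b
  proof -
    have t: "transition g a b \<in> carrier H" using transition_closed[OF assms(3)] that by auto
    have "k b = (G a \<otimes> transition g a b) \<otimes> inv (G' a \<otimes> transition g a b)"
      unfolding k_def using e(2)[of a b] e'(2)[of a b] that by (simp only: min_less_iff_conj)
    also have "\<dots> = G a \<otimes> (transition g a b \<otimes> inv (transition g a b)) \<otimes> inv (G' a)"
      using t car[OF that(1)] by (simp only: inv_mult_group m_assoc m_closed inv_closed)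
    also have "\<dots> = k a"
      using t car[OF that(1)] by (simp add: k_def)
    finally show ?thesis .
  qed
  then have "\<And>a. a \<in> {0..1} \<Longrightarrow> \<exists>d>0. \<forall>b\<in>{0..1}. dist a b < d \<longrightarrow> k b = k a"
    using e(1) e'(1) by (metis min_less_iff_conj)
  then have "\<forall>a\<in>{0..1}. eventually (\<lambda>b. k a = k b) (at a within {0..1})"
    unfolding eventually_at by (metis dist_commute)
  then have "k 0 = k 1"
    by (intro connected_local_const[of "{0..1::real}"]) auto
  then have *: "G 0 \<otimes> inv (G' 0) = G 1 \<otimes> inv (G' 1)" by (simp add: k_def)
  have c: "G 0 \<in> carrier H" "G 1 \<in> carrier H" "G' 0 \<in> carrier H" "G' 1 \<in> carrier H"
    using car by auto
  have "inv (G 0) \<otimes> G 1 = inv (G 0) \<otimes> (G 1 \<otimes> inv (G' 1)) \<otimes> G' 1"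
    using c by (simp add: m_assoc)
  also have "\<dots> = inv (G 0) \<otimes> (G 0 \<otimes> inv (G' 0)) \<otimes> G' 1"
    using * by simp
  also have "\<dots> = inv (G' 0) \<otimes> G' 1"
    using c by (simp flip: m_assoc)
  finally show ?thesis .
qed

definition glue :: "(real \<Rightarrow> 'a) \<Rightarrow> 'b" where
  "glue p = (let G = SOME G. potential {0..1} p G in inv (G 0) \<otimes> G 1)"

lemma glue_eq: "path p \<Longrightarrow> potential {0..1} p G \<Longrightarrow> glue p = inv (G 0) \<otimes> G 1"
  unfolding glue_def Let_def
  by (intro potential_unique[of p _ G] someI[of "potential {0..1} p" G]) (auto simp: path_def)

lemma path_potential:
  assumes "path p" "path_image p \<subseteq> A \<union> U"
  obtains G where "potential {0..1} p G"
  using potential_exists[of "{0..1}" p] assms by (auto simp: path_def path_image_def)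

lemma potential_subinterval:
  assumes "potential {0..1::real} g G" "u \<in> {0..1}" "v \<in> {0..1}" "path (g \<circ> linepath u v)"
  shows "glue (g \<circ> linepath u v) = inv (G u) \<otimes> G v"
  using glue_eq[OF assms(4) potential_segment[OF assms(1) _ assms(2,3)]]
  by (simp add: linepath_def)

lemma transition_subpath:
  assumes "path p" "path_image p \<subseteq> A" "a \<in> {0..1}" "b \<in> {0..1}"
  shows "transition p a b = c (p \<circ> linepath a b)"
proof -
  have "closed_segment a b \<subseteq> {0..1}" using assms by (simp add: closed_segment_subset)
  then show ?thesis using assms by (auto simp: transition_def path_image_def)
qed

section \<open>Values and homotopy invariance of the glued cocycle\<close>

lemma glue_left:
  assumes "path p" "path_image p \<subseteq> A"
  shows "glue p = c p"
proof -
  have cont: "continuous_on {0..1} p" using assms by (simp add: path_def)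
  have tr: "transition p a b \<in> carrier H" if "a \<in> {0..1}" "b \<in> {0..1}" for a b
    using transition_closed[OF cont] that by simp
  have "potential {0..1} p (transition p 0)"
    unfolding potential_def
  proof (intro conjI exI[of _ 1] ballI impI)
    fix a b :: real assume ab: "a \<in> {0..1}" "b \<in> {0..1}"
    show "transition p 0 b = transition p 0 a \<otimes> transition p a b"
      using transition_triangle[OF cont, of 0 a b] ab assms by (simp add: path_image_def)
  qed (use tr in auto)
  moreover have "transition p 0 0 = \<one>"
    using transition_triangle[OF cont, of 0 0 0] assms tr[of 0 0] by (simp add: path_image_def)
  moreover have "p \<circ> linepath 0 1 = p" by (rule ext) (simp add: linepath_def)
  ultimately show ?thesis
    using glue_eq[OF assms(1)] transition_subpath[OF assms, of 0 1] cocycle_closed[OF assms] by simp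
qed

lemma glue_right:
  assumes "path p" "path_image p \<subseteq> U"
  shows "glue p = \<one>"
proof -
  have "transition p a b = \<one>" if ab: "a \<in> {0..1}" "b \<in> {0..1}" for a b
  proof (cases "p ` closed_segment a b \<subseteq> A")
    case True
    have "closed_segment a b \<subseteq> {0..1}" using ab by (simp add: closed_segment_subset)
    then have "p ` closed_segment a b \<subseteq> U" using assms(2) by (auto simp: path_image_def)
    then have "path_image (p \<circ> linepath a b) \<subseteq> A \<inter> U" using True by (simp add: path_image_compose)
    moreover have "path (p \<circ> linepath a b)"
      using assms(1) path_comp_linepath(1)[of "{0..1}" p a b] ab by (simp add: path_def)
    ultimately show ?thesis using True cocycle_trivial by (simp add: transition_def)
  qed (simp add: transition_def)
  then have "potential {0..1} p (\<lambda>_. \<one>)"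
    by (auto simp: potential_def intro!: exI[of _ 1])
  then show ?thesis using glue_eq[OF assms(1)] by simp
qed

text \<open>Paths are functions on all reals; the pieces of a join and the sides of a homotopy agree
  with the given paths on the unit interval only.\<close>

lemma glue_cong:
  assumes "path f" "\<And>t. t \<in> {0..1} \<Longrightarrow> f t = g t" "path_image f \<subseteq> A \<union> U"
  shows "glue f = glue g"
proof -
    obtain F where F: "potential {0..1} f F" using path_potential[of f] assms by metis
    have "transition g a b = transition f a b" if ab: "a \<in> {0..1}" "b \<in> {0..1}" for a b
    proof -
      have sub: "closed_segment a b \<subseteq> {0..1}" using ab by (simp add: closed_segment_subset)
      then have im: "g ` closed_segment a b = f ` closed_segment a b"
        using assms(2) by (metis image_cong subsetD)
      have "c (f \<circ> linepath a b) = c (g \<circ> linepath a b)" if A: "f ` closed_segment a b \<subseteq> A"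
      proof (rule cocycle_homotopic, rule homotopic_paths_eq)
        show "path (f \<circ> linepath a b)"
          using path_comp_linepath(1)[of "{0..1}" f a b] ab assms(1) by (simp add: path_def)
        show "path_image (f \<circ> linepath a b) \<subseteq> A" using A by (simp add: path_image_compose)
        show "(f \<circ> linepath a b) t = (g \<circ> linepath a b) t" if "t \<in> {0..1}" for t
          using sub linepath_in_path[OF that, of a b] assms(2) by auto
      qed
      then show ?thesis using im by (simp add: transition_def)
    qed
    then have "potential {0..1} g F" using F unfolding potential_def by metis
    moreover have "path g" using assms(1,2) unfolding path_def by (metis continuous_on_cong)
    ultimately show ?thesis using glue_eq[OF assms(1) F] glue_eq[of g F] by simp
  qed

text \<open>For a join, one primitive along the whole path is restricted to the two halves. For a
  homotopy, a primitive on the square is restricted to its four sides: the two sides on which the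
  ends stay fixed contribute one, and the other two give the values to be compared.\<close>

theorem path_cocycle_glue: "path_cocycle H (A \<union> U) glue"
proof unfold_locales
  fix p assume p: "path p" "path_image p \<subseteq> A \<union> U"
  obtain G where G: "potential {0..1} p G" using path_potential[OF p] .
  then show "glue p \<in> carrier H" using glue_eq[OF p(1) G] potential_closed[OF G] by simp
next
  fix p q assume pq: "path p" "path q" "path_image p \<subseteq> A \<union> U" "path_image q \<subseteq> A \<union> U"
    "pathfinish p = pathstart q"
  have join: "path (p +++ q)" "path_image (p +++ q) \<subseteq> A \<union> U"
    using pq by (auto simp: path_image_join)
  obtain G where G: "potential {0..1} (p +++ q) G" using path_potential[OF join] .
  have l: "((p +++ q) \<circ> linepath 0 (1/2)) t = p t" if "t \<in> {0..1}" for t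
    using that by (simp add: joinpaths_def linepath_def)
  have r: "((p +++ q) \<circ> linepath (1/2) 1) t = q t" if "t \<in> {0..1}" for t
  proof (cases "t = 0")
    case True
    then show ?thesis using pq(5) by (simp add: joinpaths_def linepath_def pathstart_def pathfinish_def)
  next
    case False
    then have "(1 - t) * (1/2) + t > 1/2" using that by (simp add: field_simps)
    then show ?thesis by (simp add: joinpaths_def linepath_def field_simps)
  qed
  have pl: "path ((p +++ q) \<circ> linepath u v)" if "u \<in> {0..1}" "v \<in> {0..1}" for u v
    using path_comp_linepath(1)[of "{0..1}" "p +++ q" u v] join that by (simp add: path_def)
  have "glue p = inv (G 0) \<otimes> G (1/2)"
    using glue_cong[OF pq(1), of "(p +++ q) \<circ> linepath 0 (1/2)"] l pq(3) potential_subinterval[OF G, of 0 "1/2"] pl[of 0 "1/2"]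
    by simp
  moreover have "glue q = inv (G (1/2)) \<otimes> G 1"
    using glue_cong[OF pq(2), of "(p +++ q) \<circ> linepath (1/2) 1"] r pq(4) potential_subinterval[OF G, of "1/2" 1] pl[of "1/2" 1]
    by simp
  moreover have "glue (p +++ q) = inv (G 0) \<otimes> G 1"
    using glue_eq[OF join(1) G] .
  moreover have "G t \<in> carrier H" if "t \<in> {0..1}" for t using potential_closed[OF G that] .
  ultimately show "glue (p +++ q) = glue p \<otimes> glue q"
    by (simp add: inv_mult_cancel)
next
  fix p q assume pq: "homotopic_paths (A \<union> U) p q"
  then obtain h where h: "continuous_on ({0..1} \<times> {0..1}) h" "h ` ({0..1} \<times> {0..1}) \<subseteq> A \<union> U"
    "\<And>x. x \<in> {0..1} \<Longrightarrow> h (0, x) = p x" "\<And>x. x \<in> {0..1} \<Longrightarrow> h (1, x) = q x"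
    "\<And>t. t \<in> {0..1::real} \<Longrightarrow> pathstart (h \<circ> Pair t) = pathstart p"
    "\<And>t. t \<in> {0..1::real} \<Longrightarrow> pathfinish (h \<circ> Pair t) = pathfinish p"
    unfolding homotopic_paths image_subset_iff_funcset by blast
  let ?K = "{0..1::real} \<times> {0..1::real}"
  have K: "compact ?K" "convex ?K" "?K \<noteq> {}" by (auto intro: compact_Times convex_Times)
  obtain G where G: "potential ?K h G" using potential_exists[OF K h(1,2)] .
  have Gc: "G x \<in> carrier H" if "x \<in> ?K" for x using potential_closed[OF G that] .
  have pl: "path (h \<circ> linepath u v)" if "u \<in> ?K" "v \<in> ?K" for u v
    using path_comp_linepath(1)[OF h(1) K(2) that] .
  have val: "glue g = inv (G u) \<otimes> G v"
    if uv: "u \<in> ?K" "v \<in> ?K" and g: "path g" "path_image g \<subseteq> A \<union> U" "\<And>t. t \<in> {0..1} \<Longrightarrow> g t = h (linepath u v t)" for u v g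
    using glue_cong[of g "h \<circ> linepath u v"] g glue_eq[OF pl[OF uv] potential_segment[OF G K(2) uv]]
    by (simp add: linepath_def)
  have ends: "p 0 \<in> A \<union> U" "p 1 \<in> A \<union> U"
    using homotopic_paths_imp_subset[OF pq] pathstart_in_path_image[of p] pathfinish_in_path_image[of p]
    unfolding pathstart_def pathfinish_def by blast+
  have const: "glue (linepath x x) = \<one>" if "x \<in> A \<union> U" for x
    using that glue_left[of "linepath x x"] glue_right[of "linepath x x"] cocycle_const[of x] by (cases "x \<in> A") auto
  have pq': "path p" "path q" "path_image p \<subseteq> A \<union> U" "path_image q \<subseteq> A \<union> U"
    using homotopic_paths_imp_path[OF pq] homotopic_paths_imp_subset[OF pq] by auto
  have "glue p = inv (G (0,0)) \<otimes> G (0,1)"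
    using val[of "(0,0)" "(0,1)" p] pq' h(3) by (simp add: linepath_def)
  moreover have "glue q = inv (G (1,0)) \<otimes> G (1,1)"
    using val[of "(1,0)" "(1,1)" q] pq' h(4) by (simp add: linepath_def)
  moreover have "inv (G (0,0)) \<otimes> G (1,0) = \<one>"
    using val[of "(0,0)" "(1,0)" "linepath (p 0) (p 0)"] const[of "p 0"] ends h(5) path_linepath[of "p 0" "p 0"]
    by (simp add: linepath_def pathstart_def)
  moreover have "inv (G (0,1)) \<otimes> G (1,1) = \<one>"
    using val[of "(0,1)" "(1,1)" "linepath (p 1) (p 1)"] const[of "p 1"] ends h(6) path_linepath[of "p 1" "p 1"]
    by (simp add: linepath_def pathfinish_def)
  ultimately show "glue p = glue q"
    using Gc[of "(0,0)"] Gc[of "(0,1)"] Gc[of "(1,0)"] Gc[of "(1,1)"] inv_mult_eq_one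
    by (metis atLeastAtMost_iff mem_Sigma_iff order_refl zero_le_one)
qed

end

section \<open>The fundamental groupoid\<close>

definition paths :: "'a::real_normed_vector set \<Rightarrow> 'a \<Rightarrow> 'a \<Rightarrow> (real \<Rightarrow> 'a) set" where
  "paths S a b = {p. path p \<and> path_image p \<subseteq> S \<and> pathstart p = a \<and> pathfinish p = b}"

lemma paths_join: "p \<in> paths S a b \<Longrightarrow> q \<in> paths S b d \<Longrightarrow> p +++ q \<in> paths S a d"
  by (auto simp: paths_def path_image_join)

lemma paths_reversepath: "p \<in> paths S a b \<Longrightarrow> reversepath p \<in> paths S b a"
  by (auto simp: paths_def)

lemma paths_const: "a \<in> S \<Longrightarrow> linepath a a \<in> paths S a a"
  by (auto simp: paths_def)

lemma paths_mono: "p \<in> paths S a b \<Longrightarrow> S \<subseteq> T \<Longrightarrow> p \<in> paths T a b"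
  by (auto simp: paths_def)

lemma paths_ends: "p \<in> paths S a b \<Longrightarrow> a \<in> S \<and> b \<in> S"
  unfolding paths_def using pathstart_in_path_image pathfinish_in_path_image by blast

lemma paths_homotopic: "homotopic_paths S p q \<Longrightarrow> p \<in> paths S a b \<Longrightarrow> q \<in> paths S a b"
  using homotopic_paths_imp_path[of S p q] homotopic_paths_imp_subset[of S p q]
    homotopic_paths_imp_pathstart[of S p q] homotopic_paths_imp_pathfinish[of S p q]
  by (simp add: paths_def)

lemma path_connected_paths: "path_connected S \<Longrightarrow> a \<in> S \<Longrightarrow> b \<in> S \<Longrightarrow> \<exists>p. p \<in> paths S a b"
  unfolding path_connected_def paths_def by blast

section \<open>Homotopy classes of paths and their partial multiplication\<close>

definition pclass :: "'a::real_normed_vector set \<Rightarrow> (real \<Rightarrow> 'a) \<Rightarrow> (real \<Rightarrow> 'a) set" where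
  "pclass S p = {q. homotopic_paths S p q}"

text \<open>A class is a bare set of paths, so its ends, products and inverse are read off a chosen
  representative. The groupoid operations become total functions, with side conditions on
  \<open>psrc\<close> and \<open>ptgt\<close> that simplification can discharge.\<close>

definition prep :: "(real \<Rightarrow> 'a::real_normed_vector) set \<Rightarrow> real \<Rightarrow> 'a" where
  "prep X = (SOME p. p \<in> X)"

definition psrc :: "(real \<Rightarrow> 'a::real_normed_vector) set \<Rightarrow> 'a" where
  "psrc X = pathstart (prep X)"

definition ptgt :: "(real \<Rightarrow> 'a::real_normed_vector) set \<Rightarrow> 'a" where
  "ptgt X = pathfinish (prep X)"

definition groupoid :: "'a::real_normed_vector set \<Rightarrow> (real \<Rightarrow> 'a) set set" where
  "groupoid S = pclass S ` {p. path p \<and> path_image p \<subseteq> S}"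

definition pmult :: "'a::real_normed_vector set \<Rightarrow> (real \<Rightarrow> 'a) set \<Rightarrow> (real \<Rightarrow> 'a) set \<Rightarrow> (real \<Rightarrow> 'a) set" where
  "pmult S X Y = pclass S (prep X +++ prep Y)"

definition pinv :: "'a::real_normed_vector set \<Rightarrow> (real \<Rightarrow> 'a) set \<Rightarrow> (real \<Rightarrow> 'a) set" where
  "pinv S X = pclass S (reversepath (prep X))"

definition pone :: "'a::real_normed_vector set \<Rightarrow> 'a \<Rightarrow> (real \<Rightarrow> 'a) set" where
  "pone S x = pclass S (linepath x x)"

lemma pclass_eqI: "homotopic_paths S p q \<Longrightarrow> pclass S p = pclass S q"
  unfolding pclass_def using homotopic_paths_trans homotopic_paths_sym by blast

lemma pclass_eq_iff:
  assumes "path q" "path_image q \<subseteq> S"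
  shows "pclass S p = pclass S q \<longleftrightarrow> homotopic_paths S p q"
proof
  assume "pclass S p = pclass S q"
  moreover have "q \<in> pclass S q" using assms by (simp add: pclass_def)
  ultimately show "homotopic_paths S p q" by (auto simp: pclass_def)
qed (rule pclass_eqI)

lemma prep_pclass:
  assumes "path p" "path_image p \<subseteq> S"
  shows "homotopic_paths S p (prep (pclass S p))"
proof -
  have "p \<in> pclass S p" using assms by (simp add: pclass_def)
  then have "prep (pclass S p) \<in> pclass S p"
    unfolding prep_def by (rule someI[of "\<lambda>q. q \<in> pclass S p"])
  then show ?thesis by (simp add: pclass_def)
qed

lemma pclass_groupoid [simp]: "path p \<Longrightarrow> path_image p \<subseteq> S \<Longrightarrow> pclass S p \<in> groupoid S"
  by (auto simp: groupoid_def)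

lemma psrc_pclass [simp]: "path p \<Longrightarrow> path_image p \<subseteq> S \<Longrightarrow> psrc (pclass S p) = pathstart p"
  unfolding psrc_def using prep_pclass homotopic_paths_imp_pathstart by metis

lemma ptgt_pclass [simp]: "path p \<Longrightarrow> path_image p \<subseteq> S \<Longrightarrow> ptgt (pclass S p) = pathfinish p"
  unfolding ptgt_def using prep_pclass homotopic_paths_imp_pathfinish by metis

lemma pclass_join:
  "path p \<Longrightarrow> path_image p \<subseteq> S \<Longrightarrow> path q \<Longrightarrow> path_image q \<subseteq> S \<Longrightarrow> pathfinish p = pathstart q \<Longrightarrow>
   pclass S (p +++ q) = pmult S (pclass S p) (pclass S q)"
  unfolding pmult_def by (intro pclass_eqI homotopic_paths_join prep_pclass)

lemma pclass_reversepath: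
  "path p \<Longrightarrow> path_image p \<subseteq> S \<Longrightarrow> pclass S (reversepath p) = pinv S (pclass S p)"
  unfolding pinv_def by (intro pclass_eqI homotopic_paths_reversepath_D prep_pclass)

lemma pclass_const: "pclass S (linepath x x) = pone S x"
  by (simp add: pone_def)

lemma groupoidE:
  assumes "X \<in> groupoid S"
  obtains p where "path p" "path_image p \<subseteq> S" "X = pclass S p"
  using assms by (auto simp: groupoid_def)

lemma pmult_groupoid [simp]:
  assumes "X \<in> groupoid S" "Y \<in> groupoid S" "ptgt X = psrc Y"
  shows "pmult S X Y \<in> groupoid S" "psrc (pmult S X Y) = psrc X" "ptgt (pmult S X Y) = ptgt Y"
proof -
  obtain p where p: "path p" "path_image p \<subseteq> S" "X = pclass S p" using assms by (auto elim: groupoidE)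
  obtain q where q: "path q" "path_image q \<subseteq> S" "Y = pclass S q" using assms by (auto elim: groupoidE)
  have e: "pathfinish p = pathstart q" using assms p q by simp
  have j: "path (p +++ q)" "path_image (p +++ q) \<subseteq> S" using p q e by (auto simp: path_image_join)
  have m: "pmult S X Y = pclass S (p +++ q)" using p q e by (simp add: pclass_join)
  show "pmult S X Y \<in> groupoid S" "psrc (pmult S X Y) = psrc X" "ptgt (pmult S X Y) = ptgt Y"
    unfolding m using j p q by simp_all
qed

lemma pinv_groupoid [simp]:
  assumes "X \<in> groupoid S"
  shows "pinv S X \<in> groupoid S" "psrc (pinv S X) = ptgt X" "ptgt (pinv S X) = psrc X"
proof -
  obtain p where p: "path p" "path_image p \<subseteq> S" "X = pclass S p" using assms by (auto elim: groupoidE)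
  have m: "pinv S X = pclass S (reversepath p)" using p by (simp add: pclass_reversepath)
  show "pinv S X \<in> groupoid S" "psrc (pinv S X) = ptgt X" "ptgt (pinv S X) = psrc X"
    unfolding m using p by simp_all
qed

lemma pone_groupoid [simp]:
  assumes "x \<in> S"
  shows "pone S x \<in> groupoid S" "psrc (pone S x) = x" "ptgt (pone S x) = x"
  unfolding pone_def using assms by simp_all

lemma groupoid_ends [simp]:
  assumes "X \<in> groupoid S"
  shows "psrc X \<in> S" "ptgt X \<in> S"
proof -
  obtain p where p: "path p" "path_image p \<subseteq> S" "X = pclass S p" using assms by (auto elim: groupoidE)
  then show "psrc X \<in> S" "ptgt X \<in> S"
    using pathstart_in_path_image[of p] pathfinish_in_path_image[of p] by auto
qed

text \<open>As rewrite rules, associativity to the right, units, inverses and cancellation bring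
  products of classes into a normal form; path identities are proved later by passing to classes
  with \<open>pclass_simps\<close>.\<close>

lemma pmult_assoc [simp]:
  assumes "X \<in> groupoid S" "Y \<in> groupoid S" "Z \<in> groupoid S" "ptgt X = psrc Y" "ptgt Y = psrc Z"
  shows "pmult S (pmult S X Y) Z = pmult S X (pmult S Y Z)"
proof -
  obtain p where p: "path p" "path_image p \<subseteq> S" "X = pclass S p" using assms by (auto elim: groupoidE)
  obtain q where q: "path q" "path_image q \<subseteq> S" "Y = pclass S q" using assms by (auto elim: groupoidE)
  obtain r where r: "path r" "path_image r \<subseteq> S" "Z = pclass S r" using assms by (auto elim: groupoidE)
  have e: "pathfinish p = pathstart q" "pathfinish q = pathstart r" using assms p q r by simp_all
  have "pclass S ((p +++ q) +++ r) = pclass S (p +++ (q +++ r))"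
    using p q r e by (intro pclass_eqI homotopic_paths_sym[OF homotopic_paths_assoc])
  then show ?thesis using p q r e by (simp add: pclass_join path_image_join)
qed

lemma pmult_pone [simp]:
  assumes "X \<in> groupoid S"
  shows "psrc X = x \<Longrightarrow> pmult S (pone S x) X = X" "ptgt X = x \<Longrightarrow> pmult S X (pone S x) = X"
proof -
  obtain p where p: "path p" "path_image p \<subseteq> S" "X = pclass S p" using assms by (auto elim: groupoidE)
  have e: "pathstart p \<in> S" "pathfinish p \<in> S"
    using p pathstart_in_path_image[of p] pathfinish_in_path_image[of p] by auto
  have 1: "pclass S (linepath (pathstart p) (pathstart p) +++ p) = pclass S p"
    using p by (intro pclass_eqI homotopic_paths_lid)
  have 2: "pclass S (p +++ linepath (pathfinish p) (pathfinish p)) = pclass S p"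
    using p by (intro pclass_eqI homotopic_paths_rid)
  show "psrc X = x \<Longrightarrow> pmult S (pone S x) X = X"
    using 1 p e by (auto simp: pclass_join pclass_const)
  show "ptgt X = x \<Longrightarrow> pmult S X (pone S x) = X"
    using 2 p e by (auto simp: pclass_join pclass_const)
qed

lemma pmult_pinv [simp]:
  assumes "X \<in> groupoid S"
  shows "pmult S X (pinv S X) = pone S (psrc X)" "pmult S (pinv S X) X = pone S (ptgt X)"
proof -
  obtain p where p: "path p" "path_image p \<subseteq> S" "X = pclass S p" using assms by (auto elim: groupoidE)
  have 1: "pclass S (p +++ reversepath p) = pone S (pathstart p)"
    unfolding pone_def using p by (intro pclass_eqI homotopic_paths_rinv)
  have 2: "pclass S (reversepath p +++ p) = pone S (pathfinish p)"
    unfolding pone_def using p by (intro pclass_eqI homotopic_paths_linv)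
  show "pmult S X (pinv S X) = pone S (psrc X)" "pmult S (pinv S X) X = pone S (ptgt X)"
    using 1 2 p by (auto simp: pclass_join pclass_reversepath)
qed

lemma pmult_pinv_cancel [simp]:
  assumes "X \<in> groupoid S" "Y \<in> groupoid S"
  shows "psrc X = psrc Y \<Longrightarrow> pmult S X (pmult S (pinv S X) Y) = Y"
    "ptgt X = psrc Y \<Longrightarrow> pmult S (pinv S X) (pmult S X Y) = Y"
  using assms by (simp_all flip: pmult_assoc)

lemma pinv_eqI:
  assumes "X \<in> groupoid S" "Y \<in> groupoid S" "ptgt X = psrc Y" "pmult S X Y = pone S (psrc X)"
  shows "Y = pinv S X"
proof -
  have "Y = pmult S (pinv S X) (pmult S X Y)" using assms(1-3) by simp
  also have "\<dots> = pinv S X" unfolding assms(4) using assms(1) by simp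
  finally show ?thesis .
qed

lemma pinv_pinv [simp]: "X \<in> groupoid S \<Longrightarrow> pinv S (pinv S X) = X"
  by (rule pinv_eqI[symmetric]) auto

lemma pinv_pone [simp]: "x \<in> S \<Longrightarrow> pinv S (pone S x) = pone S x"
  by (rule pinv_eqI[symmetric]) auto

lemma pinv_pmult [simp]:
  assumes "X \<in> groupoid S" "Y \<in> groupoid S" "ptgt X = psrc Y"
  shows "pinv S (pmult S X Y) = pmult S (pinv S Y) (pinv S X)"
  using assms by (intro pinv_eqI[symmetric]) auto

lemmas pclass_simps = pclass_join pclass_reversepath pclass_const path_image_join

lemma pathsD:
  assumes "p \<in> paths S a b"
  shows "path p" "path_image p \<subseteq> S" "pathstart p = a" "pathfinish p = b"
  using assms by (auto simp: paths_def)

lemma homotopic_pathsI: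
  "pclass S p = pclass S q \<Longrightarrow> q \<in> paths S a b \<Longrightarrow> homotopic_paths S p q"
  using pclass_eq_iff[of q S p] by (auto simp: paths_def)

lemma simply_connected_pclass:
  assumes "simply_connected U" "U \<subseteq> S" "p \<in> paths U a b" "q \<in> paths U a b"
  shows "pclass S p = pclass S q"
proof -
  have "homotopic_paths U p q"
    using assms(1)[unfolded simply_connected_eq_homotopic_paths, THEN conjunct2, rule_format, of p q]
      pathsD[OF assms(3)] pathsD[OF assms(4)] by simp
  then show ?thesis by (rule pclass_eqI[OF homotopic_paths_subset[OF _ assms(2)]])
qed

text \<open>Every parameter has a neighbourhood that the path sends into \<open>A\<close> or into
  \<open>U\<close>, and adjoining subpaths join, up to homotopy, to the subpath over the union;
  Bolzano's bisection principle then reaches the whole path. This is the generation half of van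
  Kampen's theorem as an induction rule.\<close>

lemma path_open_cover_induct [consumes 4, case_names left right join homotopic]:
  fixes p :: "real \<Rightarrow> 'a::real_normed_vector"
  assumes "open A" "open U" "path p" "path_image p \<subseteq> A \<union> U"
    and left: "\<And>p. path p \<Longrightarrow> path_image p \<subseteq> A \<Longrightarrow> Q p"
    and right: "\<And>p. path p \<Longrightarrow> path_image p \<subseteq> U \<Longrightarrow> Q p"
    and join: "\<And>p q. path p \<Longrightarrow> path q \<Longrightarrow> path_image p \<subseteq> A \<union> U \<Longrightarrow> path_image q \<subseteq> A \<union> U \<Longrightarrow>
       pathfinish p = pathstart q \<Longrightarrow> Q p \<Longrightarrow> Q q \<Longrightarrow> Q (p +++ q)"
    and homotopic: "\<And>p q. homotopic_paths (A \<union> U) p q \<Longrightarrow> Q p \<Longrightarrow> Q q"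
  shows "Q p"
proof -
  have cont: "continuous_on {0..1} p" using assms by (simp add: path_def)
  have sp: "path (subpath u v p)" "path_image (subpath u v p) \<subseteq> A \<union> U"
    if "u \<in> {0..1}" "v \<in> {0..1}" for u v
    using that assms(3,4) path_image_subpath_subset[of u v p] by auto
  have "0 \<le> (0::real) \<longrightarrow> (1::real) \<le> 1 \<longrightarrow> Q (subpath 0 1 p)"
  proof (rule Bolzano[of 0 1 "\<lambda>u v. 0 \<le> u \<longrightarrow> v \<le> 1 \<longrightarrow> Q (subpath u v p)"])
    fix u v w :: real
    assume 1: "0 \<le> u \<longrightarrow> v \<le> 1 \<longrightarrow> Q (subpath u v p)"
      and 2: "0 \<le> v \<longrightarrow> w \<le> 1 \<longrightarrow> Q (subpath v w p)" and le: "u \<le> v" "v \<le> w"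
    show "0 \<le> u \<longrightarrow> w \<le> 1 \<longrightarrow> Q (subpath u w p)"
    proof (intro impI)
      assume uw: "0 \<le> u" "w \<le> 1"
      have "homotopic_paths (A \<union> U) (subpath u v p +++ subpath v w p) (subpath u w p)"
        using assms(3,4) uw le by (intro homotopic_join_subpaths) auto
      moreover have "Q (subpath u v p +++ subpath v w p)"
        using 1 2 uw le sp[of u v] sp[of v w] by (intro join) auto
      ultimately show "Q (subpath u w p)" by (rule homotopic)
    qed
  next
    fix x :: real assume x: "0 \<le> x" "x \<le> 1"
    have "p x \<in> path_image p" using x by (auto simp: path_image_def)
    then have "p x \<in> A \<union> U" using assms(4) by blast
    then obtain W where W: "W = A \<or> W = U" "p x \<in> W" "open W" using assms(1,2) by blast
    obtain d where d: "d > 0" "\<And>y. y \<in> {0..1} \<Longrightarrow> dist y x < d \<Longrightarrow> p y \<in> W"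
    proof -
      obtain e where "e > 0" "ball (p x) e \<subseteq> W" using W openE by blast
      moreover have "\<exists>d>0. \<forall>y\<in>{0..1}. dist y x < d \<longrightarrow> dist (p y) (p x) < e"
        using continuous_on_iff[THEN iffD1, OF cont, rule_format, of x e] x \<open>e > 0\<close> by auto
      then obtain d where "d > 0" "\<And>y. y \<in> {0..1} \<Longrightarrow> dist y x < d \<Longrightarrow> dist (p y) (p x) < e"
        by auto
      ultimately show ?thesis using that[of d] by (auto simp: dist_commute subset_eq)
    qed
    show "\<exists>d>0. \<forall>a b. a \<le> x \<and> x \<le> b \<and> b - a < d \<longrightarrow> 0 \<le> a \<longrightarrow> b \<le> 1 \<longrightarrow> Q (subpath a b p)"
    proof (intro exI[of _ d] conjI allI impI)
      fix a b :: real assume ab: "a \<le> x \<and> x \<le> b \<and> b - a < d" "0 \<le> a" "b \<le> 1"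
      have "path_image (subpath a b p) = p ` {a..b}" using ab by (simp add: path_image_subpath)
      also have "\<dots> \<subseteq> W" using d(2) ab by (auto simp: dist_real_def)
      finally have "path_image (subpath a b p) \<subseteq> W" .
      moreover have "path (subpath a b p)" using sp[of a b] ab by simp
      ultimately show "Q (subpath a b p)" using W left right by blast
    qed (use d in auto)
  qed simp
  then show ?thesis by simp
qed

section \<open>Loops with values in a group\<close>

text \<open>A homomorphism from the fundamental group at \<open>b\<close> to \<open>H\<close>, kept
  as a function on loops so that it can be evaluated on explicit paths.\<close>

definition loop_hom :: "('h, 'm) monoid_scheme \<Rightarrow> 'a::real_normed_vector set \<Rightarrow> 'a \<Rightarrow> ((real \<Rightarrow> 'a) \<Rightarrow> 'h) \<Rightarrow> bool" where
  "loop_hom H S b c \<longleftrightarrow>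
     (\<forall>p\<in>paths S b b. c p \<in> carrier H) \<and>
     (\<forall>p\<in>paths S b b. \<forall>q\<in>paths S b b. c (p +++ q) = c p \<otimes>\<^bsub>H\<^esub> c q) \<and>
     (\<forall>p\<in>paths S b b. \<forall>q\<in>paths S b b. pclass S p = pclass S q \<longrightarrow> c p = c q)"

lemma loop_homD:
  assumes "loop_hom H S b c" "p \<in> paths S b b"
  shows "c p \<in> carrier H"
    and "q \<in> paths S b b \<Longrightarrow> c (p +++ q) = c p \<otimes>\<^bsub>H\<^esub> c q"
    and "q \<in> paths S b b \<Longrightarrow> pclass S p = pclass S q \<Longrightarrow> c p = c q"
  using assms unfolding loop_hom_def by blast+

lemma (in group) loop_hom_const:
  assumes "loop_hom G S b c" "b \<in> S"
  shows "c (linepath b b) = \<one>"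
proof -
  let ?l = "linepath b b"
  have l: "?l \<in> paths S b b" using assms(2) by (rule paths_const)
  have "pclass S (?l +++ ?l) = pclass S ?l" using assms(2) by (simp add: pclass_simps)
  then have "c (?l +++ ?l) = c ?l" by (rule loop_homD(3)[OF assms(1) paths_join[OF l l] l])
  then have "c ?l \<otimes> c ?l = c ?l"
    unfolding loop_homD(2)[OF assms(1) l l] .
  then show ?thesis using loop_homD(1)[OF assms(1) l] by simp
qed

lemma (in group) loop_hom_reversepath:
  assumes "loop_hom G S b c" "p \<in> paths S b b"
  shows "c (reversepath p) = inv (c p)"
proof -
  note p = pathsD[OF assms(2)]
  have b: "b \<in> S" using paths_ends[OF assms(2)] by simp
  have r: "reversepath p \<in> paths S b b" using assms(2) by (rule paths_reversepath)
  have "pclass S (reversepath p +++ p) = pclass S (linepath b b)" using p by (simp add: pclass_simps)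
  then have "c (reversepath p +++ p) = c (linepath b b)"
    by (rule loop_homD(3)[OF assms(1) paths_join[OF r assms(2)] paths_const[OF b]])
  then have "c (reversepath p) \<otimes> c p = \<one>"
    unfolding loop_homD(2)[OF assms(1) r assms(2)] loop_hom_const[OF assms(1) b] .
  then show ?thesis
    using loop_homD(1)[OF assms(1) r] loop_homD(1)[OF assms] by (metis inv_equality)
qed

text \<open>The family \<open>t\<close> of paths from the base point to all points closes any path
  up to a loop.\<close>

definition conj_path :: "('a \<Rightarrow> real \<Rightarrow> 'a::real_normed_vector) \<Rightarrow> (real \<Rightarrow> 'a) \<Rightarrow> real \<Rightarrow> 'a" where
  "conj_path t p = t (pathstart p) +++ (p +++ reversepath (t (pathfinish p)))"

lemma conj_path_paths:
  assumes "\<forall>x\<in>S. t x \<in> paths S b x" "path p" "path_image p \<subseteq> S"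
  shows "conj_path t p \<in> paths S b b"
proof -
  have e: "pathstart p \<in> S" "pathfinish p \<in> S"
    using assms(3) pathstart_in_path_image[of p] pathfinish_in_path_image[of p] by auto
  have "p \<in> paths S (pathstart p) (pathfinish p)" using assms by (simp add: paths_def)
  then show ?thesis unfolding conj_path_def
    using assms(1) e by (blast intro: paths_join paths_reversepath)
qed

lemma pclass_conj_path:
  assumes "\<forall>x\<in>S. t x \<in> paths S b x" "path p" "path_image p \<subseteq> S"
  shows "pclass S (conj_path t p) = pmult S (pclass S (t (pathstart p)))
     (pmult S (pclass S p) (pinv S (pclass S (t (pathfinish p)))))"
proof -
  have e: "pathstart p \<in> S" "pathfinish p \<in> S"
    using assms(3) pathstart_in_path_image[of p] pathfinish_in_path_image[of p] by auto
  note t = pathsD[OF bspec[OF assms(1) e(1)]] pathsD[OF bspec[OF assms(1) e(2)]]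
  show ?thesis unfolding conj_path_def using t assms(2,3) by (simp add: pclass_simps)
qed

lemma pclass_conj_path_join:
  assumes t: "\<forall>x\<in>S. t x \<in> paths S b x" and p: "path p" "path_image p \<subseteq> S"
    and q: "path q" "path_image q \<subseteq> S" and pq: "pathfinish p = pathstart q"
  shows "pclass S (conj_path t (p +++ q)) = pclass S (conj_path t p +++ conj_path t q)"
proof -
  have e: "pathstart p \<in> S" "pathfinish p \<in> S" "pathfinish q \<in> S" "pathstart q \<in> S"
    using p q pathstart_in_path_image pathfinish_in_path_image by blast+
  note te = pathsD[OF bspec[OF t e(1)]] pathsD[OF bspec[OF t e(2)]] pathsD[OF bspec[OF t e(3)]] pathsD[OF bspec[OF t e(4)]]
  note c = pathsD[OF conj_path_paths[OF t p]]
    pathsD[OF conj_path_paths[OF t q]]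
  have j: "path (p +++ q)" "path_image (p +++ q) \<subseteq> S" using p q pq by (auto simp: path_image_join)
  have 1: "pclass S (conj_path t p +++ conj_path t q) = pmult S (pclass S (conj_path t p)) (pclass S (conj_path t q))"
    using c by (simp add: pclass_join)
  show ?thesis
    unfolding 1 pclass_conj_path[OF t p]
      pclass_conj_path[OF t q]
      pclass_conj_path[OF t j]
    using te p q pq by (simp add: pclass_simps)
qed

text \<open>Closing paths up along \<open>t\<close> turns a homomorphism on loops into a cocycle on
  all paths. The function \<open>k\<close> on points is a change of gauge; in
  \<open>free_loops_attach\<close> it carries the new generator.\<close>

lemma (in group) loop_hom_path_cocycle:
  assumes c: "loop_hom G S b c" and t: "\<forall>x\<in>S. t x \<in> paths S b x"
    and k: "\<And>x. x \<in> S \<Longrightarrow> k x \<in> carrier G"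
  shows "path_cocycle G S (\<lambda>p. inv (k (pathstart p)) \<otimes> c (conj_path t p) \<otimes> k (pathfinish p))"
proof unfold_locales
  fix p assume p: "path p" "path_image p \<subseteq> S"
  have e: "pathstart p \<in> S" "pathfinish p \<in> S"
    using p pathstart_in_path_image[of p] pathfinish_in_path_image[of p] by auto
  show "inv (k (pathstart p)) \<otimes> c (conj_path t p) \<otimes> k (pathfinish p) \<in> carrier G"
    using k e loop_homD(1)[OF c conj_path_paths[OF t p]] by simp
next
  fix p q assume h: "homotopic_paths S p q"
  have p: "path p" "path_image p \<subseteq> S" and q: "path q" "path_image q \<subseteq> S"
    using homotopic_paths_imp_path[OF h] homotopic_paths_imp_subset[OF h] by auto
  have e: "pathstart p = pathstart q" "pathfinish p = pathfinish q"
    using homotopic_paths_imp_pathstart[OF h] homotopic_paths_imp_pathfinish[OF h] by auto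
  have "pclass S (conj_path t p) = pclass S (conj_path t q)"
    using pclass_conj_path[OF t p]
      pclass_conj_path[OF t q] pclass_eqI[OF h] e by simp
  then have "c (conj_path t p) = c (conj_path t q)"
    using loop_homD(3)[OF c conj_path_paths[OF t p]
      conj_path_paths[OF t q]] by simp
  then show "inv (k (pathstart p)) \<otimes> c (conj_path t p) \<otimes> k (pathfinish p)
    = inv (k (pathstart q)) \<otimes> c (conj_path t q) \<otimes> k (pathfinish q)" using e by simp
next
  fix p q assume p: "path p" and q: "path q" and p': "path_image p \<subseteq> S" and q': "path_image q \<subseteq> S"
    and pq: "pathfinish p = pathstart q"
  have e: "pathstart p \<in> S" "pathstart q \<in> S" "pathfinish q \<in> S"
    using p' q' pathstart_in_path_image pathfinish_in_path_image by blast+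
  have j: "path (p +++ q)" "path_image (p +++ q) \<subseteq> S" using p q p' q' pq by (auto simp: path_image_join)
  note cp = conj_path_paths[OF t p p']
  note cq = conj_path_paths[OF t q q']
  note cj = conj_path_paths[OF t j]
  have "c (conj_path t (p +++ q)) = c (conj_path t p +++ conj_path t q)"
    by (rule loop_homD(3)[OF c cj paths_join[OF cp cq]])
      (rule pclass_conj_path_join[OF t p p' q q' pq])
  then have *: "c (conj_path t (p +++ q)) = c (conj_path t p) \<otimes> c (conj_path t q)"
    using loop_homD(2)[OF c cp cq] by simp
  have car: "c (conj_path t p) \<in> carrier G" "c (conj_path t q) \<in> carrier G"
    "k (pathstart p) \<in> carrier G" "k (pathstart q) \<in> carrier G" "k (pathfinish q) \<in> carrier G"
    using loop_homD(1)[OF c] cp cq k e by auto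
  have "k (pathstart q) \<otimes> (inv (k (pathstart q)) \<otimes> x) = x" if "x \<in> carrier G" for x
    using car that by (simp flip: m_assoc)
  then show "inv (k (pathstart (p +++ q))) \<otimes> c (conj_path t (p +++ q)) \<otimes> k (pathfinish (p +++ q))
    = inv (k (pathstart p)) \<otimes> c (conj_path t p) \<otimes> k (pathfinish p)
    \<otimes> (inv (k (pathstart q)) \<otimes> c (conj_path t q) \<otimes> k (pathfinish q))"
    using car pq * by (simp add: m_assoc)
qed

section \<open>Spaces with finitely generated free fundamental group\<close>

declare linepath_trivial [simp del]

text \<open>One target with countably many letters for all spaces: attaching a piece adds the next
  letter while the group stays the same.\<close>

abbreviation FN :: "(nat \<times> bool) list monoid" where
  "FN \<equiv> free_group_on UNIV"

interpretation FN: group FN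
  by (rule group_free_group_on)

lemma FN_simps:
  "carrier FN = {w. free_reduce w = w}" "u \<otimes>\<^bsub>FN\<^esub> v = free_reduce (u @ v)" "\<one>\<^bsub>FN\<^esub> = []"
  by (auto simp: free_group_on_def)

lemma FN_gen: "[(j, s)] \<in> carrier FN" "inv\<^bsub>FN\<^esub> [(j, True)] = [(j, False)]"
proof -
  show car: "[(j, s)] \<in> carrier FN" for j s
    by (simp add: FN_simps free_reduce_Cons cons_reduce_def)
  show "inv\<^bsub>FN\<^esub> [(j, True)] = [(j, False)]"
    using car by (intro FN.inv_equality) (simp_all add: FN_simps free_reduce_Cons cons_reduce_def)
qed

section \<open>Loops spelled by words\<close>

primrec word_path :: "(nat \<Rightarrow> real \<Rightarrow> 'a::real_normed_vector) \<Rightarrow> 'a \<Rightarrow> (nat \<times> bool) list \<Rightarrow> real \<Rightarrow> 'a" where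
  "word_path g b [] = linepath b b"
| "word_path g b (x # w) = (if snd x then g (fst x) else reversepath (g (fst x))) +++ word_path g b w"

lemma word_path_paths:
  assumes "b \<in> S" "\<forall>j\<in>fst ` set w. g j \<in> paths S b b"
  shows "word_path g b w \<in> paths S b b"
  using assms(2)
proof (induction w)
  case (Cons a w)
  then have "g (fst a) \<in> paths S b b" "word_path g b w \<in> paths S b b" by auto
  then show ?case by (auto intro: paths_join paths_reversepath)
qed (simp add: assms(1) paths_const)

lemma pclass_word_path_Cons:
  assumes "b \<in> S" "\<forall>j\<in>fst ` set (a # w). g j \<in> paths S b b"
  shows "pclass S (word_path g b (a # w)) =
    pmult S (if snd a then pclass S (g (fst a)) else pinv S (pclass S (g (fst a)))) (pclass S (word_path g b w))"
proof -
  have g: "g (fst a) \<in> paths S b b" and w: "word_path g b w \<in> paths S b b"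
    using assms word_path_paths[of b S w g] by auto
  show ?thesis using pathsD[OF g] pathsD[OF w] by (simp add: pclass_join pclass_reversepath)
qed

lemma pclass_word_path_append:
  assumes "b \<in> S" "\<forall>j\<in>fst ` set (u @ v). g j \<in> paths S b b"
  shows "pclass S (word_path g b (u @ v)) = pmult S (pclass S (word_path g b u)) (pclass S (word_path g b v))"
  using assms(2)
proof (induction u)
  case Nil
  then have "word_path g b v \<in> paths S b b" using word_path_paths[OF assms(1)] by auto
  from pathsD[OF this] show ?case using assms(1) by (simp add: pclass_const)
next
  case (Cons a u)
  have g: "g (fst a) \<in> paths S b b" and u: "word_path g b u \<in> paths S b b" and v: "word_path g b v \<in> paths S b b"
    using Cons.prems word_path_paths[OF assms(1)] by auto
  have IH: "pclass S (word_path g b (u @ v)) = pmult S (pclass S (word_path g b u)) (pclass S (word_path g b v))"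
    using Cons by auto
  have 1: "pclass S (word_path g b (a # (u @ v))) =
    pmult S (if snd a then pclass S (g (fst a)) else pinv S (pclass S (g (fst a)))) (pclass S (word_path g b (u @ v)))"
    using Cons.prems by (intro pclass_word_path_Cons assms(1)) auto
  have 2: "pclass S (word_path g b (a # u)) =
    pmult S (if snd a then pclass S (g (fst a)) else pinv S (pclass S (g (fst a)))) (pclass S (word_path g b u))"
    using Cons.prems by (intro pclass_word_path_Cons assms(1)) auto
  show ?case
    unfolding append_Cons 1 2 IH using pathsD[OF g] pathsD[OF u] pathsD[OF v] by simp
qed

lemma pclass_word_path_cons_reduce:
  assumes "b \<in> S" "\<forall>j\<in>fst ` set (a # w). g j \<in> paths S b b"
  shows "pclass S (word_path g b (cons_reduce a w)) = pclass S (word_path g b (a # w))"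
proof (cases "\<exists>d v. w = d # v \<and> fst a = fst d \<and> snd a \<noteq> snd d")
  case True
  then obtain d v where w: "w = d # v" "fst a = fst d" "snd a \<noteq> snd d" by blast
  have g: "g (fst a) \<in> paths S b b" and v: "word_path g b v \<in> paths S b b"
    using assms(2) w word_path_paths[OF assms(1)] by auto
  have 1: "pclass S (word_path g b (a # w)) =
    pmult S (if snd a then pclass S (g (fst a)) else pinv S (pclass S (g (fst a)))) (pclass S (word_path g b w))"
    using assms by (intro pclass_word_path_Cons) auto
  have 2: "pclass S (word_path g b (d # v)) =
    pmult S (if snd d then pclass S (g (fst d)) else pinv S (pclass S (g (fst d)))) (pclass S (word_path g b v))"
    using assms w by (intro pclass_word_path_Cons) auto
  show ?thesis
    unfolding 1 unfolding w(1) 2 using w(2,3) pathsD[OF g] pathsD[OF v]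
    by (cases "snd a") (simp_all add: cons_reduce_def)
next
  case False
  then have "cons_reduce a w = a # w" by (cases w) (auto simp: cons_reduce_def)
  then show ?thesis by simp
qed

lemma pclass_word_path_free_reduce:
  assumes "b \<in> S" "\<forall>j\<in>fst ` set w. g j \<in> paths S b b"
  shows "pclass S (word_path g b (free_reduce w)) = pclass S (word_path g b w)"
  using assms(2)
proof (induction w)
  case (Cons a w)
  have *: "\<forall>j\<in>fst ` set (a # free_reduce w). g j \<in> paths S b b"
    using Cons.prems set_free_reduce[of w] by auto
  have "pclass S (word_path g b (free_reduce (a # w))) = pclass S (word_path g b (a # free_reduce w))"
    unfolding free_reduce_Cons using assms(1) * by (rule pclass_word_path_cons_reduce)
  also have "\<dots> = pclass S (word_path g b (a # w))"
    using Cons * by (simp only: pclass_word_path_Cons[OF assms(1)]) auto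
  finally show ?case .
qed simp

lemma pclass_word_path_word_inv:
  assumes "b \<in> S" "\<forall>j\<in>fst ` set w. g j \<in> paths S b b"
  shows "pclass S (word_path g b (word_inv w)) = pinv S (pclass S (word_path g b w))"
proof -
  have w: "word_path g b w \<in> paths S b b" and wi: "word_path g b (word_inv w) \<in> paths S b b"
    using word_path_paths[OF assms] word_path_paths[OF assms(1), of "word_inv w" g] assms(2)
    unfolding set_word_inv by blast+
  have *: "\<forall>j\<in>fst ` set (word_inv w @ w). g j \<in> paths S b b"
    using assms(2) by (auto simp: set_word_inv image_Un)
  have "pmult S (pclass S (word_path g b (word_inv w))) (pclass S (word_path g b w)) = pone S b"
    using pclass_word_path_append[OF assms(1) *] pclass_word_path_free_reduce[OF assms(1) *]
    by (simp add: free_reduce_word_inv pclass_const)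
  then have "pclass S (word_path g b w) = pinv S (pclass S (word_path g b (word_inv w)))"
    using pathsD[OF w] pathsD[OF wi] by (intro pinv_eqI) auto
  then show ?thesis using pathsD[OF wi] by simp
qed

lemma loop_hom_word_path:
  assumes c: "loop_hom FN S b c" and b: "b \<in> S"
    and g: "\<forall>j\<in>fst ` set w. g j \<in> paths S b b \<and> c (g j) = [(j, True)]"
  shows "c (word_path g b w) = free_reduce w"
  using g
proof (induction w)
  case Nil
  then show ?case using FN.loop_hom_const[OF c b] by (simp add: FN_simps)
next
  case (Cons a w)
  have a: "g (fst a) \<in> paths S b b" "c (g (fst a)) = [(fst a, True)]" using Cons.prems by auto
  have w: "word_path g b w \<in> paths S b b" using Cons.prems by (intro word_path_paths b) auto
  let ?x = "if snd a then g (fst a) else reversepath (g (fst a))"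
  have x: "?x \<in> paths S b b" using a paths_reversepath by auto
  have "c ?x = [a]"
    using a FN.loop_hom_reversepath[OF c a(1)] FN_gen(2)[of "fst a"] by (cases a) auto
  then have "c (word_path g b (a # w)) = [a] \<otimes>\<^bsub>FN\<^esub> free_reduce w"
    using loop_homD(2)[OF c x w] Cons by simp
  then show ?case using free_reduce_append_right[of "[a]" w] by (simp add: FN_simps)
qed

text \<open>The map \<open>c\<close> is the certificate of freeness: it sends the generating loops
  to distinct letters, and so recovers the reduced word from any loop spelled by them.\<close>

definition free_basis :: "'a::real_normed_vector set \<Rightarrow> 'a \<Rightarrow> nat \<Rightarrow> (nat \<Rightarrow> real \<Rightarrow> 'a) \<Rightarrow> ((real \<Rightarrow> 'a) \<Rightarrow> (nat \<times> bool) list) \<Rightarrow> bool" where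
  "free_basis S b k g c \<longleftrightarrow> loop_hom FN S b c \<and>
     (\<forall>j<k. g j \<in> paths S b b \<and> c (g j) = [(j, True)]) \<and>
     (\<forall>p\<in>paths S b b. \<exists>w. fst ` set w \<subseteq> {..<k} \<and> pclass S p = pclass S (word_path g b w))"

definition free_loops :: "'a::real_normed_vector set \<Rightarrow> 'a \<Rightarrow> bool" where
  "free_loops S b \<longleftrightarrow> path_connected S \<and> b \<in> S \<and> (\<exists>k g c. free_basis S b k g c)"

lemma free_loops_simply_connected:
  assumes "simply_connected S" "b \<in> S"
  shows "free_loops S b"
proof -
  have "pclass S p = pclass S (linepath b b)" if "p \<in> paths S b b" for p
    using simply_connected_pclass[OF assms(1) order_refl that paths_const[OF assms(2)]] .
  then have "free_basis S b 0 (\<lambda>_. linepath b b) (\<lambda>_. [])"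
    by (auto simp: free_basis_def loop_hom_def FN_simps intro!: exI[of _ "[]"])
  then show ?thesis using assms simply_connected_imp_path_connected by (auto simp: free_loops_def)
qed

section \<open>From a free basis to an isomorphism with a free group\<close>

lemma fundamental_group_carrier:
  "carrier (fundamental_group S b) = pclass S ` paths S b b"
  by (auto simp: fundamental_group_def pclass_def paths_def)

lemma fundamental_group_mult:
  assumes "p \<in> paths S b b" "q \<in> paths S b b"
  shows "pclass S p \<otimes>\<^bsub>fundamental_group S b\<^esub> pclass S q = pclass S (p +++ q)"
proof -
  note p = pathsD[OF assms(1)] note q = pathsD[OF assms(2)]
  have "homotopic_paths S (p +++ q) r"
    if "homotopic_paths S p p'" "homotopic_paths S q q'" "homotopic_paths S (p' +++ q') r" for p' q' r
    using homotopic_paths_join[OF that(1,2)] that(3) homotopic_paths_trans p q by metis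
  moreover have "homotopic_paths S p p" "homotopic_paths S q q" using p q by auto
  ultimately show ?thesis unfolding fundamental_group_def pclass_def by (simp, blast)
qed

text \<open>The word \<open>c p\<close> spells the loop \<open>p\<close> itself, because
  \<open>p\<close> is spelled by some \<open>w\<close> and then \<open>c p = free_reduce w\<close>.
  Hence \<open>c\<close> and the spelling of reduced words are inverse to each other on
  classes.\<close>

theorem free_loops_imp_is_free_group:
  assumes "free_loops S b"
  shows "is_free_group (fundamental_group S b)"
proof -
  obtain k g c where fb: "free_basis S b k g c" and b: "b \<in> S"
    using assms by (auto simp: free_loops_def)
  have c: "loop_hom FN S b c" and g: "\<And>j. j < k \<Longrightarrow> g j \<in> paths S b b \<and> c (g j) = [(j, True)]"
    and gen: "\<And>p. p \<in> paths S b b \<Longrightarrow> \<exists>w. fst ` set w \<subseteq> {..<k} \<and> pclass S p = pclass S (word_path g b w)"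
    using fb by (auto simp: free_basis_def)
  define f where "f X = c (prep X)" for X
  have carr: "c p \<in> carrier (free_group_on {..<k})" if p: "p \<in> paths S b b"
      and "pclass S p = pclass S (word_path g b (c p)) \<and> fst ` set (c p) \<subseteq> {..<k} \<and> free_reduce (c p) = c p" for p
    using that unfolding free_group_on_def by simp
  have f: "f (pclass S p) = c p" if p: "p \<in> paths S b b" for p
  proof -
    have h: "homotopic_paths S p (prep (pclass S p))" using pathsD[OF p] by (intro prep_pclass)
    then show ?thesis unfolding f_def
      using loop_homD(3)[OF c p paths_homotopic[OF h p] pclass_eqI[OF h]] by simp
  qed
  have wp: "word_path g b w \<in> paths S b b" "c (word_path g b w) = free_reduce w" if "fst ` set w \<subseteq> {..<k}" for w
    using that g by (auto intro!: word_path_paths b loop_hom_word_path[OF c b])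
  have gen': "pclass S p = pclass S (word_path g b (c p)) \<and> fst ` set (c p) \<subseteq> {..<k} \<and> free_reduce (c p) = c p"
    if p: "p \<in> paths S b b" for p
  proof -
    obtain w where w: "fst ` set w \<subseteq> {..<k}" "pclass S p = pclass S (word_path g b w)" using gen[OF p] by blast
    have cp: "c p = free_reduce w" using loop_homD(3)[OF c p wp(1)[OF w(1)] w(2)] wp(2)[OF w(1)] by simp
    have "\<forall>j\<in>fst ` set w. g j \<in> paths S b b" using w(1) g by auto
    moreover have "fst ` set (free_reduce w) \<subseteq> {..<k}" using w(1) set_free_reduce[of w] by blast
    ultimately show ?thesis using pclass_word_path_free_reduce[OF b] w(2) unfolding cp by simp
  qed
  have "f \<in> iso (fundamental_group S b) (free_group_on {..<k})"
    unfolding iso_def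
  proof (intro CollectI conjI)
    show "f \<in> hom (fundamental_group S b) (free_group_on {..<k})"
    proof (rule homI)
      fix X assume "X \<in> carrier (fundamental_group S b)"
      then show "f X \<in> carrier (free_group_on {..<k})"
        using carr[OF _ gen'] f by (auto simp: fundamental_group_carrier)
    next
      fix X Y assume "X \<in> carrier (fundamental_group S b)" "Y \<in> carrier (fundamental_group S b)"
      then obtain p q where pq: "p \<in> paths S b b" "q \<in> paths S b b" "X = pclass S p" "Y = pclass S q"
        by (auto simp: fundamental_group_carrier)
      show "f (X \<otimes>\<^bsub>fundamental_group S b\<^esub> Y) = f X \<otimes>\<^bsub>free_group_on {..<k}\<^esub> f Y"
        using f[OF pq(1)] f[OF pq(2)] f[OF paths_join[OF pq(1,2)]] loop_homD(2)[OF c pq(1,2)]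
        unfolding pq(3,4) fundamental_group_mult[OF pq(1,2)] by (simp add: free_group_on_def)
    qed
    show "bij_betw f (carrier (fundamental_group S b)) (carrier (free_group_on {..<k}))"
      unfolding bij_betw_def
    proof
      show "inj_on f (carrier (fundamental_group S b))"
      proof (rule inj_onI)
        fix X Y assume "X \<in> carrier (fundamental_group S b)" "Y \<in> carrier (fundamental_group S b)" and e: "f X = f Y"
        then obtain p q where pq: "p \<in> paths S b b" "q \<in> paths S b b" "X = pclass S p" "Y = pclass S q"
          by (auto simp: fundamental_group_carrier)
        then have "c p = c q" using f e by simp
        then show "X = Y" using gen' pq by metis
      qed
      show "f ` carrier (fundamental_group S b) = carrier (free_group_on {..<k})"
      proof
        show "f ` carrier (fundamental_group S b) \<subseteq> carrier (free_group_on {..<k})"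
          using carr[OF _ gen'] f by (auto simp: fundamental_group_carrier)
        show "carrier (free_group_on {..<k}) \<subseteq> f ` carrier (fundamental_group S b)"
        proof
          fix w assume "w \<in> carrier (free_group_on {..<k})"
          then have w: "fst ` set w \<subseteq> {..<k}" "free_reduce w = w" by (auto simp: free_group_on_def)
          have "f (pclass S (word_path g b w)) = w" using f wp[OF w(1)] w(2) by simp
          then show "w \<in> f ` carrier (fundamental_group S b)"
            using wp(1)[OF w(1)] unfolding fundamental_group_carrier by (metis imageI)
        qed
      qed
    qed
  qed
  then show ?thesis unfolding is_free_group_def is_iso_def by blast
qed

section \<open>Transport of free bases to other base points and homeomorphic spaces\<close>

lemma loop_hom_comp:
  assumes "loop_hom H T d c" and F: "\<And>p. p \<in> paths S b b \<Longrightarrow> F p \<in> paths T d d"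
    and FJ: "\<And>p q. p \<in> paths S b b \<Longrightarrow> q \<in> paths S b b \<Longrightarrow> pclass T (F (p +++ q)) = pclass T (F p +++ F q)"
    and FC: "\<And>p q. p \<in> paths S b b \<Longrightarrow> q \<in> paths S b b \<Longrightarrow> pclass S p = pclass S q \<Longrightarrow> pclass T (F p) = pclass T (F q)"
  shows "loop_hom H S b (c \<circ> F)"
  unfolding loop_hom_def o_def
proof (intro conjI ballI impI)
  fix p assume p: "p \<in> paths S b b"
  show "c (F p) \<in> carrier H" using loop_homD(1)[OF assms(1) F[OF p]] .
  fix q assume q: "q \<in> paths S b b"
  show "c (F (p +++ q)) = c (F p) \<otimes>\<^bsub>H\<^esub> c (F q)"
    using loop_homD(3)[OF assms(1) F[OF paths_join[OF p q]] paths_join[OF F[OF p] F[OF q]] FJ[OF p q]]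
      loop_homD(2)[OF assms(1) F[OF p] F[OF q]] by simp
  show "c (F p) = c (F q)" if "pclass S p = pclass S q"
    using loop_homD(3)[OF assms(1) F[OF p] F[OF q] FC[OF p q that]] .
qed

lemma free_basis_change_base:
  assumes fb: "free_basis S b k g c" and b: "b \<in> S" and d: "d \<in> paths S a b"
  shows "free_basis S a k (\<lambda>j. d +++ (g j +++ reversepath d)) (\<lambda>p. c (reversepath d +++ (p +++ d)))"
proof -
  have c: "loop_hom FN S b c" and g: "\<And>j. j < k \<Longrightarrow> g j \<in> paths S b b \<and> c (g j) = [(j, True)]"
    and gen: "\<And>p. p \<in> paths S b b \<Longrightarrow> \<exists>w. fst ` set w \<subseteq> {..<k} \<and> pclass S p = pclass S (word_path g b w)"
    using fb by (auto simp: free_basis_def)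
  have a: "a \<in> S" using paths_ends[OF d] by simp
  let ?F = "\<lambda>p. reversepath d +++ (p +++ d)" and ?g = "\<lambda>j. d +++ (g j +++ reversepath d)"
  note dd = pathsD[OF d]
  have F: "?F p \<in> paths S b b" if "p \<in> paths S a a" for p
    using that d by (intro paths_join[OF paths_reversepath[OF d]] paths_join[OF _ d])
  have G: "?g j \<in> paths S a a" if "g j \<in> paths S b b" for j
    by (intro paths_join[OF d] paths_join[OF that] paths_reversepath d)
  have cF: "pclass S (?F p) = pmult S (pinv S (pclass S d)) (pmult S (pclass S p) (pclass S d))"
    if "p \<in> paths S a a" for p
    using pathsD[OF that] dd by (simp add: pclass_simps)
  have lh: "loop_hom FN S a (c \<circ> ?F)"
  proof (rule loop_hom_comp[OF c])
    fix p q assume p: "p \<in> paths S a a" and q: "q \<in> paths S a a"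
    have "pclass S (?F p +++ ?F q) = pmult S (pclass S (?F p)) (pclass S (?F q))"
      using pathsD[OF F[OF p]] pathsD[OF F[OF q]] by (simp add: pclass_join)
    then show "pclass S (?F (p +++ q)) = pclass S (?F p +++ ?F q)"
      unfolding cF[OF p] cF[OF q] cF[OF paths_join[OF p q]]
      using pathsD[OF p] pathsD[OF q] dd by (simp add: pclass_simps)
    show "pclass S (?F p) = pclass S (?F q)" if "pclass S p = pclass S q"
      unfolding cF[OF p] cF[OF q] that ..
  qed (rule F)
  have gj: "pclass S (?g j) = pmult S (pclass S d) (pmult S (pclass S (g j)) (pinv S (pclass S d)))"
    if "j < k" for j
    using pathsD[OF conjunct1[OF g[OF that]]] dd by (simp add: pclass_simps)
  have gen_g: "pclass S (word_path ?g a w) =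
      pmult S (pclass S d) (pmult S (pclass S (word_path g b w)) (pinv S (pclass S d)))"
    if "fst ` set w \<subseteq> {..<k}" for w
    using that
  proof (induction w)
    case Nil
    then show ?case using dd a b by (simp add: pclass_const)
  next
    case (Cons x w)
    have x: "fst x < k" using Cons.prems by auto
    have w: "word_path g b w \<in> paths S b b" using Cons.prems g by (intro word_path_paths b) auto
    have 1: "pclass S (word_path ?g a (x # w)) = pmult S
      (if snd x then pclass S (?g (fst x)) else pinv S (pclass S (?g (fst x)))) (pclass S (word_path ?g a w))"
      using Cons.prems G g by (intro pclass_word_path_Cons a) auto
    have 2: "pclass S (word_path g b (x # w)) = pmult S
      (if snd x then pclass S (g (fst x)) else pinv S (pclass S (g (fst x)))) (pclass S (word_path g b w))"
      using Cons.prems g by (intro pclass_word_path_Cons b) auto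
    have IH: "pclass S (word_path ?g a w) =
      pmult S (pclass S d) (pmult S (pclass S (word_path g b w)) (pinv S (pclass S d)))"
      using Cons by auto
    show ?case unfolding 1 2 IH gj[OF x]
      using pathsD[OF conjunct1[OF g[OF x]]] pathsD[OF w] dd by simp
  qed
  show ?thesis
    unfolding free_basis_def
  proof (intro conjI ballI allI impI)
    show "loop_hom FN S a (\<lambda>p. c (?F p))" using lh by (simp add: o_def)
    fix j assume j: "j < k"
    have gp: "g j \<in> paths S b b" using g[OF j] by simp
    show "?g j \<in> paths S a a" using G[OF gp] .
    have "pclass S (?F (?g j)) = pclass S (g j)"
      unfolding cF[OF G[OF gp]] gj[OF j] using pathsD[OF gp] dd by simp
    then show "c (?F (?g j)) = [(j, True)]"
      using loop_homD(3)[OF c F[OF G[OF gp]] gp] g[OF j] by simp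
  next
    fix p assume p: "p \<in> paths S a a"
    obtain w where w: "fst ` set w \<subseteq> {..<k}" "pclass S (?F p) = pclass S (word_path g b w)"
      using gen[OF F[OF p]] by blast
    have "pclass S p = pmult S (pclass S d) (pmult S (pclass S (?F p)) (pinv S (pclass S d)))"
      unfolding cF[OF p] using pathsD[OF p] dd by simp
    then have "pclass S p = pclass S (word_path ?g a w)" unfolding w(2) gen_g[OF w(1)] .
    then show "\<exists>w. fst ` set w \<subseteq> {..<k} \<and> pclass S p = pclass S (word_path ?g a w)"
      using w(1) by blast
  qed
qed

lemma free_loops_change_base:
  assumes "free_loops S b" "a \<in> S"
  shows "free_loops S a"
proof -
  obtain d where "d \<in> paths S a b"
    using assms path_connected_paths unfolding free_loops_def by blast
  then show ?thesis
    using assms free_basis_change_base unfolding free_loops_def by blast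
qed

lemma pclass_image:
  assumes "continuous_on S f" "f ` S \<subseteq> T" "p \<in> paths S a b" "q \<in> paths S a b" "pclass S p = pclass S q"
  shows "pclass T (f \<circ> p) = pclass T (f \<circ> q)"
proof -
  have "homotopic_paths S p q" using homotopic_pathsI[OF assms(5,4)] .
  then show ?thesis using assms(1,2)
    by (intro pclass_eqI homotopic_paths_continuous_image[of S]) auto
qed

lemma paths_image:
  assumes "continuous_on S f" "f ` S \<subseteq> T" "p \<in> paths S a b"
  shows "f \<circ> p \<in> paths T (f a) (f b)"
  using pathsD[OF assms(3)] assms(1,2) unfolding paths_def
  by (auto simp: path_image_compose pathstart_compose pathfinish_compose
      intro!: path_continuous_image continuous_on_subset[OF assms(1)])

lemma loop_hom_image:
  assumes c: "loop_hom H T (f b) c" and f: "continuous_on S f" "f ` S \<subseteq> T"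
  shows "loop_hom H S b (\<lambda>p. c (f \<circ> p))"
proof -
  have "loop_hom H S b (c \<circ> (\<lambda>p. f \<circ> p))"
  proof (rule loop_hom_comp[OF c])
    fix p q assume pq: "p \<in> paths S b b" "q \<in> paths S b b"
    show "f \<circ> p \<in> paths T (f b) (f b)" using paths_image[OF f pq(1)] .
    show "pclass T (f \<circ> (p +++ q)) = pclass T ((f \<circ> p) +++ (f \<circ> q))" by (simp add: path_compose_join)
    show "pclass T (f \<circ> p) = pclass T (f \<circ> q)" if "pclass S p = pclass S q"
      using pclass_image[OF f pq that] .
  qed
  then show ?thesis by (simp add: o_def)
qed

lemma homeomorphism_comp_path:
  fixes S :: "'a::real_normed_vector set" and T :: "'b::real_normed_vector set"
  assumes "homeomorphism S T f f'" "p \<in> paths T a b"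
  shows "pclass T (f \<circ> (f' \<circ> p)) = pclass T p"
proof (rule pclass_eqI, rule homotopic_paths_eq)
  note p = pathsD[OF assms(2)]
  have 1: "f' \<circ> p \<in> paths S (f' a) (f' b)"
    using assms by (intro paths_image[of T]) (auto simp: homeomorphism_def)
  have 2: "f \<circ> (f' \<circ> p) \<in> paths T (f (f' a)) (f (f' b))"
    using assms 1 by (intro paths_image[of S]) (auto simp: homeomorphism_def)
  show "path (f \<circ> (f' \<circ> p))" "path_image (f \<circ> (f' \<circ> p)) \<subseteq> T" using pathsD[OF 2] by auto
  show "(f \<circ> (f' \<circ> p)) t = p t" if "t \<in> {0..1}" for t
  proof -
    have "p t \<in> T" using that p(2) by (auto simp: path_image_def)
    then show ?thesis using assms(1) by (simp add: homeomorphism_def)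
  qed
qed

lemma free_loops_homeomorphism:
  fixes S :: "'a::real_normed_vector set" and T :: "'b::real_normed_vector set"
  assumes h: "homeomorphism S T f f'" and fl: "free_loops S b"
  shows "free_loops T (f b)"
proof -
  obtain k g c where fb: "free_basis S b k g c" and b: "b \<in> S" and pc: "path_connected S"
    using fl by (auto simp: free_loops_def)
  have c: "loop_hom FN S b c" and g: "\<And>j. j < k \<Longrightarrow> g j \<in> paths S b b \<and> c (g j) = [(j, True)]"
    and gen: "\<And>p. p \<in> paths S b b \<Longrightarrow> \<exists>w. fst ` set w \<subseteq> {..<k} \<and> pclass S p = pclass S (word_path g b w)"
    using fb by (auto simp: free_basis_def)
  have cf: "continuous_on S f" "f ` S \<subseteq> T" "continuous_on T f'" "f' ` T \<subseteq> S" and ff: "\<And>x. x \<in> S \<Longrightarrow> f' (f x) = x"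
    using h by (auto simp: homeomorphism_def)
  have h': "homeomorphism T S f' f" using h homeomorphism_sym by blast
  have fb': "f b \<in> T" "f' (f b) = b" using b cf ff by auto
  have wp: "pclass T (f \<circ> word_path g b w) = pclass T (word_path (\<lambda>j. f \<circ> g j) (f b) w)"
    for w
  proof -
    have "f \<circ> word_path g b w = word_path (\<lambda>j. f \<circ> g j) (f b) w"
    proof (induction w)
      case Nil
      then show ?case by (auto simp: linepath_def fun_eq_iff)
    next
      case (Cons a w)
      then show ?case
        by (cases "snd a") (simp_all only: word_path.simps if_True if_False path_compose_join path_compose_reversepath)
    qed
    then show ?thesis by simp
  qed
  have "free_basis T (f b) k (\<lambda>j. f \<circ> g j) (\<lambda>p. c (f' \<circ> p))"
    unfolding free_basis_def
  proof (intro conjI ballI allI impI)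
    show "loop_hom FN T (f b) (\<lambda>p. c (f' \<circ> p))"
      using loop_hom_image[of FN S f' "f b" c T] c cf fb' by simp
    fix j assume j: "j < k"
    have gj: "g j \<in> paths S b b" using g[OF j] by simp
    show 1: "f \<circ> g j \<in> paths T (f b) (f b)" using paths_image[OF cf(1,2) gj] .
    have "f' \<circ> (f \<circ> g j) \<in> paths S b b" using paths_image[OF cf(3,4) 1] fb' by simp
    then show "c (f' \<circ> (f \<circ> g j)) = [(j, True)]"
      using loop_homD(3)[OF c _ gj homeomorphism_comp_path[OF h' gj]] g[OF j] by simp
  next
    fix p assume p: "p \<in> paths T (f b) (f b)"
    have 1: "f' \<circ> p \<in> paths S b b" using paths_image[OF cf(3,4) p] fb' by simp
    obtain w where w: "fst ` set w \<subseteq> {..<k}" "pclass S (f' \<circ> p) = pclass S (word_path g b w)"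
      using gen[OF 1] by blast
    have wpp: "word_path g b w \<in> paths S b b" using w(1) g by (intro word_path_paths b) auto
    have "pclass T p = pclass T (f \<circ> (f' \<circ> p))" using homeomorphism_comp_path[OF h p] by simp
    also have "\<dots> = pclass T (f \<circ> word_path g b w)" using pclass_image[OF cf(1,2) 1 wpp w(2)] .
    finally show "\<exists>w. fst ` set w \<subseteq> {..<k} \<and> pclass T p = pclass T (word_path (\<lambda>j. f \<circ> g j) (f b) w)"
      using w(1) wp by auto
  qed
  moreover have "path_connected T"
    using pc h homeomorphic_path_connectedness homeomorphic_def by blast
  ultimately show ?thesis using fb' by (auto simp: free_loops_def)
qed

section \<open>Attaching simply connected open sets\<close>

text \<open>Injectivity on fundamental groups is required only as far as homomorphisms to the free group
  detect it. This suffices to transport free bases and passes to increasing unions of open sets.\<close>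

definition loops_equiv :: "'a::real_normed_vector set \<Rightarrow> 'a set \<Rightarrow> 'a \<Rightarrow> bool" where
  "loops_equiv A X b \<longleftrightarrow> path_connected A \<and> path_connected X \<and> A \<subseteq> X \<and> b \<in> A \<and>
     (\<forall>p\<in>paths X b b. \<exists>q\<in>paths A b b. pclass X p = pclass X q) \<and>
     (\<forall>c. loop_hom FN A b c \<longrightarrow>
        (\<forall>p\<in>paths A b b. \<forall>q\<in>paths A b b. pclass X p = pclass X q \<longrightarrow> c p = c q))"

lemma loops_equivD:
  assumes "loops_equiv A X b"
  shows "path_connected A" "path_connected X" "A \<subseteq> X" "b \<in> A"
    and "p \<in> paths X b b \<Longrightarrow> \<exists>q\<in>paths A b b. pclass X p = pclass X q"
    and "loop_hom FN A b c \<Longrightarrow> p \<in> paths A b b \<Longrightarrow> q \<in> paths A b b \<Longrightarrow> pclass X p = pclass X q \<Longrightarrow> c p = c q"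
proof -
  note D = assms[unfolded loops_equiv_def]
  show "path_connected A" "path_connected X" "A \<subseteq> X" "b \<in> A" using D by simp_all
  show "\<exists>q\<in>paths A b b. pclass X p = pclass X q" if "p \<in> paths X b b"
    using D that by simp
  show "c p = c q" if "loop_hom FN A b c" "p \<in> paths A b b" "q \<in> paths A b b" "pclass X p = pclass X q"
    using D[THEN conjunct2, THEN conjunct2, THEN conjunct2, THEN conjunct2, THEN conjunct2,
      rule_format, OF that] .
qed

lemma loops_equiv_refl:
  assumes "path_connected A" "b \<in> A"
  shows "loops_equiv A A b"
  unfolding loops_equiv_def using assms loop_homD(3) by blast

lemma pclass_mono:
  assumes "A \<subseteq> X" "q \<in> paths A a b" "pclass A p = pclass A q"
  shows "pclass X p = pclass X q"
  using homotopic_pathsI[OF assms(3,2)] assms(1) by (intro pclass_eqI) (rule homotopic_paths_subset)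

text \<open>A loop of \<open>X\<close> is replaced by an equivalent loop of \<open>A\<close>; by the
  detection clause the value of \<open>c\<close> does not depend on the choice. Transitivity of
  \<open>loops_equiv\<close> and the transport of a free basis rest on this extension.\<close>

lemma loops_equiv_extend:
  assumes e: "loops_equiv A X b" and c: "loop_hom FN A b c"
  obtains c' where "loop_hom FN X b c'" "\<And>p. p \<in> paths A b b \<Longrightarrow> c' p = c p"
proof -
  note E = loops_equivD[OF e]
  define r where "r p = (SOME q. q \<in> paths A b b \<and> pclass X p = pclass X q)" for p
  have r: "r p \<in> paths A b b" "pclass X p = pclass X (r p)" if "p \<in> paths X b b" for p
    using someI_ex[of "\<lambda>q. q \<in> paths A b b \<and> pclass X p = pclass X q"] E(5)[OF that]
    unfolding r_def by blast+
  show ?thesis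
  proof
    show "loop_hom FN X b (\<lambda>p. c (r p))"
      unfolding loop_hom_def
    proof (intro conjI ballI impI)
      fix p assume p: "p \<in> paths X b b"
      show "c (r p) \<in> carrier FN" using loop_homD(1)[OF c r(1)[OF p]] .
      fix q assume q: "q \<in> paths X b b"
      have rX: "r p \<in> paths X b b" "r q \<in> paths X b b"
        using r(1)[OF p] r(1)[OF q] E(3) paths_mono by blast+
      show "c (r p) = c (r q)" if "pclass X p = pclass X q"
        using E(6)[OF c r(1)[OF p] r(1)[OF q]] r(2)[OF p] r(2)[OF q] that by simp
      have "pclass X (r (p +++ q)) = pclass X (p +++ q)" using r(2)[OF paths_join[OF p q]] by simp
      also have "\<dots> = pmult X (pclass X (r p)) (pclass X (r q))"
        using pathsD[OF p] pathsD[OF q] r(2)[OF p] r(2)[OF q] by (simp add: pclass_join)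
      also have "\<dots> = pclass X (r p +++ r q)" using pathsD[OF rX(1)] pathsD[OF rX(2)] by (simp add: pclass_join)
      finally have "c (r (p +++ q)) = c (r p +++ r q)"
        by (rule E(6)[OF c r(1)[OF paths_join[OF p q]] paths_join[OF r(1)[OF p] r(1)[OF q]]])
      then show "c (r (p +++ q)) = c (r p) \<otimes>\<^bsub>FN\<^esub> c (r q)"
        using loop_homD(2)[OF c r(1)[OF p] r(1)[OF q]] by simp
    qed
    show "c (r p) = c p" if "p \<in> paths A b b" for p
    proof -
      have "p \<in> paths X b b" using that E(3) paths_mono by blast
      from r[OF this] show ?thesis using E(6)[OF c _ that] by simp
    qed
  qed
qed

lemma loops_equiv_trans:
  assumes "loops_equiv A B b" "loops_equiv B X b"
  shows "loops_equiv A X b"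
proof -
  note E = loops_equivD[OF assms(1)] note F = loops_equivD[OF assms(2)]
  show ?thesis
    unfolding loops_equiv_def
  proof (intro conjI ballI allI impI)
    fix p assume "p \<in> paths X b b"
    then obtain q where q: "q \<in> paths B b b" "pclass X p = pclass X q" using F(5) by blast
    then obtain r where r: "r \<in> paths A b b" "pclass B q = pclass B r" using E(5) by blast
    have "r \<in> paths B b b" using r(1) E(3) by (rule paths_mono)
    then have "pclass X q = pclass X r" using pclass_mono[OF F(3) _ r(2)] by simp
    then show "\<exists>q\<in>paths A b b. pclass X p = pclass X q" using q(2) r(1) by auto
  next
    fix c p q assume c: "loop_hom FN A b c" and p: "p \<in> paths A b b" and q: "q \<in> paths A b b"
      and pq: "pclass X p = pclass X q"
    obtain c' where c': "loop_hom FN B b c'" "\<And>p. p \<in> paths A b b \<Longrightarrow> c' p = c p"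
      using loops_equiv_extend[OF assms(1) c] by blast
    have "c' p = c' q"
      using F(6)[OF c'(1) paths_mono[OF p E(3)] paths_mono[OF q E(3)] pq] .
    then show "c p = c q" using c'(2) p q by simp
  qed (use E F in auto)
qed

lemma free_loops_equiv:
  assumes e: "loops_equiv A X b" and fl: "free_loops A b"
  shows "free_loops X b"
proof -
  note E = loops_equivD[OF e]
  obtain k g c where fb: "free_basis A b k g c"
    using fl by (auto simp: free_loops_def)
  have c: "loop_hom FN A b c" and g: "\<And>j. j < k \<Longrightarrow> g j \<in> paths A b b \<and> c (g j) = [(j, True)]"
    and gen: "\<And>p. p \<in> paths A b b \<Longrightarrow> \<exists>w. fst ` set w \<subseteq> {..<k} \<and> pclass A p = pclass A (word_path g b w)"
    using fb by (auto simp: free_basis_def)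
  obtain c' where c': "loop_hom FN X b c'" "\<And>p. p \<in> paths A b b \<Longrightarrow> c' p = c p"
    using loops_equiv_extend[OF e c] by blast
  have "free_basis X b k g c'"
    unfolding free_basis_def
  proof (intro conjI ballI allI impI)
    fix p assume "p \<in> paths X b b"
    then obtain q where q: "q \<in> paths A b b" "pclass X p = pclass X q" using E(5) by blast
    obtain w where w: "fst ` set w \<subseteq> {..<k}" "pclass A q = pclass A (word_path g b w)" using gen[OF q(1)] by blast
    have "word_path g b w \<in> paths A b b" using w(1) g by (intro word_path_paths E(4)) auto
    then have "pclass X q = pclass X (word_path g b w)" using pclass_mono[OF E(3) _ w(2)] by simp
    then show "\<exists>w. fst ` set w \<subseteq> {..<k} \<and> pclass X p = pclass X (word_path g b w)"
      using w(1) q(2) by auto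
  qed (use c' g paths_mono[OF _ E(3)] in auto)
  then show ?thesis using E unfolding free_loops_def by blast
qed

lemma loops_equiv_homeomorphism:
  fixes X :: "'a::real_normed_vector set" and Y :: "'b::real_normed_vector set"
  assumes e: "loops_equiv B Y (f b)" and h: "homeomorphism X Y f f'" and A: "A \<subseteq> X" "f ` A = B" "b \<in> A"
  shows "loops_equiv A X b"
proof -
  note E = loops_equivD[OF e]
  have cf: "continuous_on X f" "f ` X \<subseteq> Y" "continuous_on Y f'" "f' ` Y \<subseteq> X"
    and ff: "\<And>x. x \<in> X \<Longrightarrow> f' (f x) = x" and hs: "homeomorphism Y X f' f"
    using h homeomorphism_sym by (auto simp: homeomorphism_def)
  have cA: "continuous_on A f" "f ` A \<subseteq> B" using cf(1) A continuous_on_subset by blast+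
  have cB: "continuous_on B f'" "f' ` B \<subseteq> A" using cf(3) A E(3) ff continuous_on_subset by (blast, force)
  have hA: "homeomorphism B A f' f" "homeomorphism A B f f'"
    using homeomorphism_of_subsets[OF h A(1) E(3) A(2)] homeomorphism_sym by blast+
  have fb: "f' (f b) = b" using A ff by auto
  show ?thesis
    unfolding loops_equiv_def
  proof (intro conjI ballI allI impI)
    show "path_connected A" using E(1) hA homeomorphic_path_connectedness homeomorphic_def by blast
    show "path_connected X" using E(2) h homeomorphic_path_connectedness homeomorphic_def by blast
    fix p assume p: "p \<in> paths X b b"
    obtain q where q: "q \<in> paths B (f b) (f b)" "pclass Y (f \<circ> p) = pclass Y q"
      using E(5)[OF paths_image[OF cf(1,2) p]] by blast
    have "pclass X p = pclass X (f' \<circ> (f \<circ> p))" using homeomorphism_comp_path[OF hs p] by simp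
    also have "\<dots> = pclass X (f' \<circ> q)"
      using pclass_image[OF cf(3,4) paths_image[OF cf(1,2) p] paths_mono[OF q(1) E(3)] q(2)] .
    finally show "\<exists>q\<in>paths A b b. pclass X p = pclass X q"
      using paths_image[OF cB q(1)] fb by auto
  next
    fix c p q assume c: "loop_hom FN A b c" and p: "p \<in> paths A b b" and q: "q \<in> paths A b b"
      and pq: "pclass X p = pclass X q"
    have "loop_hom FN B (f b) (\<lambda>p. c (f' \<circ> p))"
      using loop_hom_image[of FN A f' "f b" c B] c cB fb by simp
    moreover have "pclass Y (f \<circ> p) = pclass Y (f \<circ> q)"
      using pclass_image[OF cf(1,2) paths_mono[OF p A(1)] paths_mono[OF q A(1)] pq] .
    ultimately have *: "c (f' \<circ> (f \<circ> p)) = c (f' \<circ> (f \<circ> q))"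
      using E(6)[OF _ paths_image[OF cA p] paths_image[OF cA q]] by blast
    have "c (f' \<circ> (f \<circ> r)) = c r" if r: "r \<in> paths A b b" for r
      using loop_homD(3)[OF c _ r homeomorphism_comp_path[OF hA(1) r]]
        paths_image[OF cB paths_image[OF cA r]] fb by simp
    then show "c p = c q" using * p q by simp
  qed (use A in auto)
qed

text \<open>The connecting paths to the ends run, up to homotopy, along \<open>n\<close> to
  \<open>z\<close> and then inside \<open>T\<close>. Closing up a path of \<open>T\<close> thus
  gives the conjugate by \<open>n\<close> of a loop of \<open>T\<close> at \<open>z\<close>, and
  such loops are null in \<open>S\<close>.\<close>

lemma pclass_conj_null:
  assumes ts: "pclass S (t (pathstart p)) = pmult S (pclass S n) (pclass S s)"
    and te: "pclass S (t (pathfinish p)) = pmult S (pclass S n) (pclass S e)"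
    and n: "n \<in> paths S b z" and s: "s \<in> paths T z (pathstart p)" and e: "e \<in> paths T z (pathfinish p)"
    and p: "path p" "path_image p \<subseteq> T" and TS: "T \<subseteq> S"
    and null: "\<And>q. q \<in> paths T z z \<Longrightarrow> pclass S q = pone S z"
    and t: "\<forall>x\<in>S. t x \<in> paths S b x"
  shows "pclass S (conj_path t p) = pone S b"
proof -
  have pT: "p \<in> paths T (pathstart p) (pathfinish p)" using p by (simp add: paths_def)
  have l: "s +++ (p +++ reversepath e) \<in> paths T z z"
    by (intro paths_join[OF s] paths_join[OF pT] paths_reversepath e)
  note S = pathsD[OF paths_mono[OF s TS]] pathsD[OF paths_mono[OF e TS]] pathsD[OF paths_mono[OF pT TS]] pathsD[OF n]
  have 1: "pmult S (pclass S s) (pmult S (pclass S p) (pinv S (pclass S e))) = pone S z"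
    using null[OF l] S by (simp add: pclass_simps)
  have z: "z \<in> S" using paths_ends[OF n] by simp
  have "pclass S (conj_path t p) = pmult S (pmult S (pclass S n) (pclass S s))
      (pmult S (pclass S p) (pinv S (pmult S (pclass S n) (pclass S e))))"
    using pclass_conj_path[OF t, of p] S ts te by simp
  also have "\<dots> = pmult S (pclass S n) (pmult S
      (pmult S (pclass S s) (pmult S (pclass S p) (pinv S (pclass S e)))) (pinv S (pclass S n)))"
    using S by simp
  also have "\<dots> = pone S b" unfolding 1 using S z by simp
  finally show ?thesis .
qed

lemma (in group) loop_hom_conj:
  assumes c: "loop_hom G S b c" and t: "t b \<in> paths S b b" and p: "p \<in> paths S b b"
  shows "c (conj_path t p) = c (t b) \<otimes> c p \<otimes> inv (c (t b))"
proof -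
  have "c (conj_path t p) = c (t b) \<otimes> (c p \<otimes> c (reversepath (t b)))"
    unfolding conj_path_def using pathsD[OF p] t p
    by (simp add: loop_homD(2)[OF c] paths_join paths_reversepath)
  then show ?thesis using loop_hom_reversepath[OF c t] loop_homD(1)[OF c] t p by (simp add: m_assoc)
qed

lemma (in group) conj_cancel:
  assumes "x \<in> carrier G" "y \<in> carrier G" "g \<in> carrier G" "g \<otimes> x \<otimes> inv g = g \<otimes> y \<otimes> inv g"
  shows "x = y"
  using assms by (simp add: m_assoc)

text \<open>Loops of the union can be pushed into \<open>A\<close> because every path in
  \<open>U\<close>, closed up along suitable connecting paths, is null. Conversely, a homomorphism
  on \<open>A\<close> becomes a cocycle that is trivial on the overlap and so extends over
  \<open>U\<close>; the extension takes equal values on loops that become homotopic in the union.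
  The overlap may carry loops of its own as long as they die in \<open>A\<close>, which is the
  situation around the minimum.\<close>

theorem loops_equiv_attach:
  fixes A U :: "'a::real_normed_vector set"
  assumes op: "open A" "open U" and pcA: "path_connected A" and scU: "simply_connected U"
    and pcAU: "path_connected (A \<inter> U)" and z: "z \<in> A \<inter> U" and b: "b \<in> A"
    and null: "\<And>q. q \<in> paths (A \<inter> U) z z \<Longrightarrow> pclass A q = pone A z"
  shows "loops_equiv A (A \<union> U) b"
proof -
  let ?X = "A \<union> U"
  obtain n where n: "n \<in> paths A b z" using path_connected_paths[OF pcA b] z by blast
  obtain s where s: "\<forall>x\<in>A \<inter> U. s x \<in> paths (A \<inter> U) z x"
    using path_connected_paths[OF pcAU z] by metis
  obtain r where r: "\<forall>x\<in>U. r x \<in> paths U z x"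
    using path_connected_paths[OF simply_connected_imp_path_connected[OF scU]] z by (metis IntE)
  obtain a where a: "\<forall>x\<in>A. a x \<in> paths A b x"
    using path_connected_paths[OF pcA b] by metis
  \<comment> \<open>All connecting paths to the overlap share the initial piece \<open>n\<close> and
    continue inside the overlap; this makes the closed-up paths of the overlap null.\<close>
  define t where "t x = (if x \<in> A \<inter> U then n +++ s x else a x)" for x
  define t' where "t' x = (if x \<in> A then t x else n +++ r x)" for x
  define r' where "r' x = (if x \<in> A then s x else r x)" for x
  have AX: "A \<subseteq> ?X" "U \<subseteq> ?X" "A \<inter> U \<subseteq> A" "A \<inter> U \<subseteq> U" by auto
  have t: "\<forall>x\<in>A. t x \<in> paths A b x"
    using a paths_join[OF n paths_mono[OF _ AX(3)]] s by (auto simp: t_def)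
  have r': "\<forall>x\<in>U. r' x \<in> paths U z x"
    using r paths_mono[OF _ AX(4)] s by (auto simp: r'_def)
  have nX: "n \<in> paths ?X b z" using n AX(1) by (rule paths_mono)
  have t': "\<forall>x\<in>?X. t' x \<in> paths ?X b x"
    using paths_mono[OF _ AX(1)] t paths_join[OF nX paths_mono[OF _ AX(2)]] r by (auto simp: t'_def)
  have t'U: "pclass ?X (t' x) = pmult ?X (pclass ?X n) (pclass ?X (r' x))" if "x \<in> U" for x
  proof -
    have "t' x = n +++ r' x" using that by (auto simp: t'_def r'_def t_def)
    moreover have "r' x \<in> paths ?X z x" using r' that AX(2) paths_mono by blast
    ultimately show ?thesis using pathsD[OF nX] pathsD[of "r' x" ?X z x] by (simp add: pclass_join)
  qed
  have nullU: "pclass ?X q = pone ?X z" if "q \<in> paths U z z" for q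
    unfolding pone_def using z by (intro simply_connected_pclass[OF scU AX(2) that] paths_const) auto
  have ends: "pathstart p \<in> T \<and> pathfinish p \<in> T" if "path_image p \<subseteq> T" for p and T :: "'a set"
    using that pathstart_in_path_image pathfinish_in_path_image by blast
  have full: "\<exists>q\<in>paths A b b. pclass ?X (conj_path t' p) = pclass ?X q"
    if p: "path p" "path_image p \<subseteq> ?X" for p
    using op p
  proof (induction rule: path_open_cover_induct)
    case (left p)
    have "conj_path t' p = conj_path t p" using ends[OF left(2)] by (simp add: conj_path_def t'_def)
    then show ?case using conj_path_paths[OF t left] by metis
  next
    case (right p)
    have "pclass ?X (conj_path t' p) = pone ?X b"
    proof (rule pclass_conj_null[OF t'U t'U nX _ _ right AX(2) nullU t'])
      show "r' (pathstart p) \<in> paths U z (pathstart p)" "r' (pathfinish p) \<in> paths U z (pathfinish p)"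
        using r' ends[OF right(2)] by auto
    qed (use ends[OF right(2)] in auto)
    then show ?case unfolding pone_def using paths_const[OF b] by blast
  next
    case (join p q)
    have p: "path_image p \<subseteq> ?X" and q: "path_image q \<subseteq> ?X" using join by auto
    obtain p' q' where *: "p' \<in> paths A b b" "pclass ?X (conj_path t' p) = pclass ?X p'"
      "q' \<in> paths A b b" "pclass ?X (conj_path t' q) = pclass ?X q'" using join by blast
    have "pclass ?X (conj_path t' (p +++ q)) = pclass ?X (conj_path t' p +++ conj_path t' q)"
      using join by (intro pclass_conj_path_join[OF t']) auto
    also have "\<dots> = pclass ?X (p' +++ q')"
      using pathsD[OF conj_path_paths[OF t' join(1) p]] pathsD[OF conj_path_paths[OF t' join(2) q]] *(2,4)
        pathsD[OF paths_mono[OF *(1) AX(1)]] pathsD[OF paths_mono[OF *(3) AX(1)]] by (simp add: pclass_join)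
    finally show ?case using paths_join[OF *(1,3)] by blast
  next
    case (homotopic p q)
    have pq: "path p" "path_image p \<subseteq> ?X" "path q" "path_image q \<subseteq> ?X"
      "pathstart p = pathstart q" "pathfinish p = pathfinish q"
      using homotopic_paths_imp_path[OF homotopic(1)] homotopic_paths_imp_subset[OF homotopic(1)]
        homotopic_paths_imp_pathstart[OF homotopic(1)] homotopic_paths_imp_pathfinish[OF homotopic(1)] by auto
    have "pclass ?X (conj_path t' p) = pclass ?X (conj_path t' q)"
      using pclass_conj_path[OF t' pq(1,2)] pclass_conj_path[OF t' pq(3,4)] pq(5,6) pclass_eqI[OF homotopic(1)] by simp
    then show ?case using homotopic(2) by simp
  qed
  show ?thesis
    unfolding loops_equiv_def
  proof (intro conjI ballI allI impI)
    show "path_connected ?X"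
      using path_connected_Un[OF pcA simply_connected_imp_path_connected[OF scU]] z by blast
    fix p assume p: "p \<in> paths ?X b b"
    note P = pathsD[OF p]
    obtain q where q: "q \<in> paths A b b" "pclass ?X (conj_path t' p) = pclass ?X q"
      using full[OF P(1,2)] by blast
    have tb: "t' b \<in> paths A b b" using t b by (simp add: t'_def)
    have tbX: "t' b \<in> paths ?X b b" using t' b by simp
    have l: "reversepath (t' b) +++ (q +++ t' b) \<in> paths A b b"
      by (intro paths_join[OF paths_reversepath[OF tb]] paths_join[OF q(1)] tb)
    have "pclass ?X (reversepath (t' b) +++ (q +++ t' b)) =
      pmult ?X (pinv ?X (pclass ?X (t' b))) (pmult ?X (pclass ?X (conj_path t' p)) (pclass ?X (t' b)))"
      unfolding q(2) using pathsD[OF tbX] pathsD[OF paths_mono[OF q(1) AX(1)]] by (simp add: pclass_simps)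
    also have "\<dots> = pclass ?X p"
      unfolding pclass_conj_path[OF t' P(1,2)] using pathsD[OF tbX] P by simp
    finally show "\<exists>q\<in>paths A b b. pclass ?X p = pclass ?X q" using l by metis
  next
    fix c p q assume c: "loop_hom FN A b c" and p: "p \<in> paths A b b" and q: "q \<in> paths A b b"
      and pq: "pclass ?X p = pclass ?X q"
    \<comment> \<open>The overlap is connected, so the constant gauge one is the right choice
      here.\<close>
    define d where "d p = inv\<^bsub>FN\<^esub> \<one>\<^bsub>FN\<^esub> \<otimes>\<^bsub>FN\<^esub> c (conj_path t p) \<otimes>\<^bsub>FN\<^esub> \<one>\<^bsub>FN\<^esub>" for p
    have dc: "d p = c (conj_path t p)" if "path p" "path_image p \<subseteq> A" for p
      using loop_homD(1)[OF c conj_path_paths[OF t that]] by (simp add: d_def)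
    have pcoc: "path_cocycle FN A d"
      unfolding d_def by (rule FN.loop_hom_path_cocycle[OF c t]) simp
    have tAU: "pclass A (t x) = pmult A (pclass A n) (pclass A (s x))" if "x \<in> A \<inter> U" for x
    proof -
      have "s x \<in> paths A z x" using s that AX(3) paths_mono by blast
      then show ?thesis using that pathsD[OF n] pathsD[of "s x" A z x] by (simp add: t_def pclass_join)
    qed
    have "d p = \<one>\<^bsub>FN\<^esub>" if p: "path p" "path_image p \<subseteq> A \<inter> U" for p
    proof -
      have "pclass A (conj_path t p) = pone A b"
      proof (rule pclass_conj_null[OF tAU tAU n _ _ p AX(3) null t])
        show "s (pathstart p) \<in> paths (A \<inter> U) z (pathstart p)" "s (pathfinish p) \<in> paths (A \<inter> U) z (pathfinish p)"
          using s ends[OF p(2)] by auto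
      qed (use ends[OF p(2)] in auto)
      then have "c (conj_path t p) = c (linepath b b)"
        using loop_homD(3)[OF c conj_path_paths[OF t p(1)] paths_const[OF b]] p(2) by (simp add: pone_def)
      then show ?thesis using dc[OF p(1)] p(2) FN.loop_hom_const[OF c b] by simp
    qed
    then interpret cocycle_gluing FN A d U
      using pcoc op by (simp add: cocycle_gluing_def cocycle_gluing_axioms_def)
    interpret X: path_cocycle FN ?X glue by (rule path_cocycle_glue)
    have "glue p = glue q"
      using X.cocycle_homotopic homotopic_pathsI[OF pq paths_mono[OF q AX(1)]] by blast
    then have "c (conj_path t p) = c (conj_path t q)"
      using glue_left pathsD[OF p] pathsD[OF q] dc by simp
    then show "c p = c q"
      using FN.loop_hom_conj[OF c _ p, of t] FN.loop_hom_conj[OF c _ q, of t] t b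
        FN.conj_cancel[OF loop_homD(1)[OF c p] loop_homD(1)[OF c q], of "c (t b)"]
        loop_homD(1)[OF c, of "t b"] by simp
  qed (use AX b pcA in auto)
qed

text \<open>The overlap has two simply connected pieces, so one generator is added: the loop
  \<open>T\<close> that leaves \<open>A\<close> through \<open>O1\<close>, crosses \<open>U\<close>
  and returns through \<open>O2\<close>. Freeness is certified by extending \<open>c\<close> over
  \<open>U\<close> after a change of gauge on \<open>O2\<close> by the new letter. Generation
  follows by cover induction, where the connecting paths into \<open>O2\<close> account for the
  occurrences of \<open>T\<close>.\<close>

theorem free_loops_attach:
  fixes A U :: "'a::real_normed_vector set"
  assumes op: "open A" "open U" and scU: "simply_connected U"
    and AU: "A \<inter> U = O1 \<union> O2" "O1 \<inter> O2 = {}" and opO: "open O1" "open O2"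
    and scO: "simply_connected O1" "simply_connected O2" and z: "z1 \<in> O1" "z2 \<in> O2"
    and fl: "free_loops A b"
  shows "free_loops (A \<union> U) b"
proof -
  let ?X = "A \<union> U"
  obtain k g c where fb: "free_basis A b k g c" and b: "b \<in> A" and pcA: "path_connected A"
    using fl by (auto simp: free_loops_def)
  have c: "loop_hom FN A b c" and g: "\<And>j. j < k \<Longrightarrow> g j \<in> paths A b b \<and> c (g j) = [(j, True)]"
    and gen: "\<And>p. p \<in> paths A b b \<Longrightarrow> \<exists>w. fst ` set w \<subseteq> {..<k} \<and> pclass A p = pclass A (word_path g b w)"
    using fb by (auto simp: free_basis_def)
  have AX: "A \<subseteq> ?X" "U \<subseteq> ?X" by auto
  have O: "O1 \<subseteq> A" "O1 \<subseteq> U" "O2 \<subseteq> A" "O2 \<subseteq> U" using AU(1) by blast+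
  have zA: "z1 \<in> A" "z2 \<in> A" "z1 \<in> U" "z2 \<in> U" using O z by blast+
  obtain n1 where n1: "n1 \<in> paths A b z1" using path_connected_paths[OF pcA b zA(1)] by blast
  obtain n2 where n2: "n2 \<in> paths A b z2" using path_connected_paths[OF pcA b zA(2)] by blast
  have pcU: "path_connected U" using simply_connected_imp_path_connected[OF scU] .
  obtain \<beta> where \<beta>: "\<beta> \<in> paths U z1 z2" using path_connected_paths[OF pcU zA(3,4)] by blast
  obtain s1 where s1: "\<forall>x\<in>O1. s1 x \<in> paths O1 z1 x"
    using path_connected_paths[OF simply_connected_imp_path_connected[OF scO(1)] z(1)] by metis
  obtain s2 where s2: "\<forall>x\<in>O2. s2 x \<in> paths O2 z2 x"
    using path_connected_paths[OF simply_connected_imp_path_connected[OF scO(2)] z(2)] by metis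
  obtain r where r: "\<forall>x\<in>U. r x \<in> paths U z1 x"
    using path_connected_paths[OF pcU zA(3)] by metis
  obtain a where a: "\<forall>x\<in>A. a x \<in> paths A b x"
    using path_connected_paths[OF pcA b] by metis
  define t where "t x = (if x \<in> O1 then n1 +++ s1 x else if x \<in> O2 then n2 +++ s2 x else a x)" for x
  have t: "\<forall>x\<in>A. t x \<in> paths A b x"
  proof
    fix x assume x: "x \<in> A"
    have "n1 +++ s1 x \<in> paths A b x" if "x \<in> O1"
      using paths_join[OF n1 paths_mono[OF bspec[OF s1 that] O(1)]] .
    moreover have "n2 +++ s2 x \<in> paths A b x" if "x \<in> O2"
      using paths_join[OF n2 paths_mono[OF bspec[OF s2 that] O(3)]] .
    ultimately show "t x \<in> paths A b x" using a x by (simp add: t_def)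
  qed
  have ends: "pathstart p \<in> T \<and> pathfinish p \<in> T" if "path_image p \<subseteq> T" for p and T :: "'a set"
    using that pathstart_in_path_image pathfinish_in_path_image by blast
  have n1X: "n1 \<in> paths ?X b z1" and n2X: "n2 \<in> paths ?X b z2" and \<beta>X: "\<beta> \<in> paths ?X z1 z2"
    using n1 n2 \<beta> AX paths_mono by blast+
  define T where "T = n1 +++ (\<beta> +++ reversepath n2)"
  have T: "T \<in> paths ?X b b"
    unfolding T_def by (intro paths_join[OF n1X] paths_join[OF \<beta>X] paths_reversepath n2X)
  have t1: "pclass A (t x) = pmult A (pclass A n1) (pclass A (s1 x))" if "x \<in> O1" for x
    using pathsD[OF n1] pathsD[OF paths_mono[OF bspec[OF s1 that] O(1)]] that
    by (simp add: t_def pclass_join)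
  have t2: "pclass A (t x) = pmult A (pclass A n2) (pclass A (s2 x))" if "x \<in> O2" for x
  proof -
    have "t x = n2 +++ s2 x" using that AU(2) by (auto simp: t_def)
    then show ?thesis
      using pathsD[OF n2] pathsD[OF paths_mono[OF bspec[OF s2 that] O(3)]] by (simp add: pclass_join)
  qed
  have null1: "pclass A q = pone A z1" if "q \<in> paths O1 z1 z1" for q
    unfolding pone_def using simply_connected_pclass[OF scO(1) O(1) that paths_const[OF z(1)]] .
  have null2: "pclass A q = pone A z2" if "q \<in> paths O2 z2 z2" for q
    unfolding pone_def using simply_connected_pclass[OF scO(2) O(3) that paths_const[OF z(2)]] .
  have cone: "c q = \<one>\<^bsub>FN\<^esub>" if "q \<in> paths A b b" "pclass A q = pone A b" for q
    using loop_homD(3)[OF c that(1) paths_const[OF b]] that(2) FN.loop_hom_const[OF c b] by (simp add: pone_def)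
  have conj1: "c (conj_path t p) = \<one>\<^bsub>FN\<^esub>" if p: "path p" "path_image p \<subseteq> O1" for p
  proof (rule cone)
    show "conj_path t p \<in> paths A b b" using conj_path_paths[OF t p(1)] p(2) O by blast
    show "pclass A (conj_path t p) = pone A b"
    proof (rule pclass_conj_null[OF t1 t1 n1 _ _ p O(1) null1 t])
      show "s1 (pathstart p) \<in> paths O1 z1 (pathstart p)" "s1 (pathfinish p) \<in> paths O1 z1 (pathfinish p)"
        using s1 ends[OF p(2)] by auto
    qed (use ends[OF p(2)] in auto)
  qed
  have conj2: "c (conj_path t p) = \<one>\<^bsub>FN\<^esub>" if p: "path p" "path_image p \<subseteq> O2" for p
  proof (rule cone)
    show "conj_path t p \<in> paths A b b" using conj_path_paths[OF t p(1)] p(2) O by blast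
    show "pclass A (conj_path t p) = pone A b"
    proof (rule pclass_conj_null[OF t2 t2 n2 _ _ p O(3) null2 t])
      show "s2 (pathstart p) \<in> paths O2 z2 (pathstart p)" "s2 (pathfinish p) \<in> paths O2 z2 (pathfinish p)"
        using s2 ends[OF p(2)] by auto
    qed (use ends[OF p(2)] in auto)
  qed
  define h where "h = [(k, True)]"
  have h: "h \<in> carrier FN" unfolding h_def by (rule FN_gen)
  \<comment> \<open>A path in the overlap stays in one piece, where its closed-up loop is null, so
    any gauge constant on each piece keeps the cocycle trivial there. The inverse of the new letter
    on \<open>O2\<close> gives \<open>T\<close> the letter itself.\<close>
  define \<kappa> where "\<kappa> x = (if x \<in> O2 then inv\<^bsub>FN\<^esub> h else \<one>\<^bsub>FN\<^esub>)" for x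
  have \<kappa>: "\<kappa> x \<in> carrier FN" for x using h by (simp add: \<kappa>_def)
  define d where "d p = inv\<^bsub>FN\<^esub> (\<kappa> (pathstart p)) \<otimes>\<^bsub>FN\<^esub> c (conj_path t p) \<otimes>\<^bsub>FN\<^esub> \<kappa> (pathfinish p)" for p
  have pcoc: "path_cocycle FN A d"
    unfolding d_def by (rule FN.loop_hom_path_cocycle[OF c t \<kappa>])
  have split: "path_image p \<subseteq> O1 \<or> path_image p \<subseteq> O2" if "path p" "path_image p \<subseteq> A \<inter> U" for p
  proof -
    have "path_image p \<subseteq> O1 \<union> O2" using that(2) AU(1) by simp
    moreover have "O1 \<inter> O2 \<inter> path_image p = {}" using AU(2) by blast
    ultimately have "O1 \<inter> path_image p = {} \<or> O2 \<inter> path_image p = {}"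
      using connectedD[OF connected_path_image[OF that(1)] opO] by blast
    then show ?thesis using \<open>path_image p \<subseteq> O1 \<union> O2\<close> by blast
  qed
  have triv: "d p = \<one>\<^bsub>FN\<^esub>" if p: "path p" "path_image p \<subseteq> A \<inter> U" for p
    using split[OF p]
  proof
    assume 1: "path_image p \<subseteq> O1"
    then have "pathstart p \<notin> O2" "pathfinish p \<notin> O2" using ends[OF 1] AU(2) by blast+
    then show ?thesis using conj1[OF p(1) 1] by (simp add: d_def \<kappa>_def)
  next
    assume 2: "path_image p \<subseteq> O2"
    then show ?thesis using conj2[OF p(1) 2] ends[OF 2] h by (simp add: d_def \<kappa>_def)
  qed
  interpret cocycle_gluing FN A d U
    using pcoc op triv by (simp add: cocycle_gluing_def cocycle_gluing_axioms_def)
  interpret X: path_cocycle FN ?X glue by (rule path_cocycle_glue)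
  have tb: "t b \<in> paths A b b" using t b by simp
  have ctb: "c (t b) \<in> carrier FN" using loop_homD(1)[OF c tb] .
  \<comment> \<open>On a loop of \<open>A\<close> at \<open>b\<close> the glued cocycle is the
    conjugate of \<open>c\<close> by this element; \<open>c'\<close> undoes the conjugation and so
    extends \<open>c\<close>.\<close>
  define G where "G = inv\<^bsub>FN\<^esub> (\<kappa> b) \<otimes>\<^bsub>FN\<^esub> c (t b)"
  have G: "G \<in> carrier FN" using \<kappa> ctb by (simp add: G_def)
  define c' where "c' p = inv\<^bsub>FN\<^esub> G \<otimes>\<^bsub>FN\<^esub> glue p \<otimes>\<^bsub>FN\<^esub> G" for p
  have GG: "G \<otimes>\<^bsub>FN\<^esub> (inv\<^bsub>FN\<^esub> G \<otimes>\<^bsub>FN\<^esub> y) = y" "inv\<^bsub>FN\<^esub> G \<otimes>\<^bsub>FN\<^esub> (G \<otimes>\<^bsub>FN\<^esub> y) = y"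
    if "y \<in> carrier FN" for y using G that by (simp_all flip: FN.m_assoc)
  have c'c: "c' p = c p" if p: "p \<in> paths A b b" for p
  proof -
    have cp: "c p \<in> carrier FN" using loop_homD(1)[OF c p] .
    have "glue p = d p" using glue_left pathsD[OF p] by simp
    also have "\<dots> = G \<otimes>\<^bsub>FN\<^esub> c p \<otimes>\<^bsub>FN\<^esub> inv\<^bsub>FN\<^esub> G"
      using pathsD[OF p] FN.loop_hom_conj[where t = t, OF c tb p] cp ctb \<kappa>
      by (simp add: d_def G_def FN.m_assoc FN.inv_mult_group)
    finally show ?thesis using GG G cp by (simp add: c'_def FN.m_assoc)
  qed
  have c'hom: "loop_hom FN ?X b c'"
    unfolding loop_hom_def
  proof (intro conjI ballI impI)
    fix p assume p: "p \<in> paths ?X b b"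
    have gp: "glue p \<in> carrier FN" using pathsD[OF p] X.cocycle_closed by simp
    show "c' p \<in> carrier FN" using gp G by (simp add: c'_def)
    fix q assume q: "q \<in> paths ?X b b"
    have gq: "glue q \<in> carrier FN" using pathsD[OF q] X.cocycle_closed by simp
    have "glue (p +++ q) = glue p \<otimes>\<^bsub>FN\<^esub> glue q"
      using pathsD[OF p] pathsD[OF q] by (intro X.cocycle_join) auto
    then show "c' (p +++ q) = c' p \<otimes>\<^bsub>FN\<^esub> c' q" using gp gq G GG by (simp add: c'_def FN.m_assoc)
    show "c' p = c' q" if "pclass ?X p = pclass ?X q"
      using X.cocycle_homotopic[OF homotopic_pathsI[OF that q]] by (simp add: c'_def)
  qed
  have dn1: "d n1 = G"
  proof -
    have l: "s1 z1 \<in> paths O1 z1 z1" using s1 z by blast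
    have "pclass A (conj_path t n1) = pclass A (t b)"
      using pclass_conj_path[OF t, of n1] pathsD[OF n1] t1[OF z(1)] null1[OF l] pathsD[OF tb] zA by simp
    then have "c (conj_path t n1) = c (t b)"
      using loop_homD(3)[OF c conj_path_paths[OF t] tb] pathsD[OF n1] by simp
    moreover have "z1 \<notin> O2" using AU(2) z by blast
    ultimately show ?thesis using pathsD[OF n1] \<kappa> ctb by (simp add: d_def G_def \<kappa>_def[of z1])
  qed
  have dn2: "d n2 = G \<otimes>\<^bsub>FN\<^esub> inv\<^bsub>FN\<^esub> h"
  proof -
    have l: "s2 z2 \<in> paths O2 z2 z2" using s2 z by blast
    have "pclass A (conj_path t n2) = pclass A (t b)"
      using pclass_conj_path[OF t, of n2] pathsD[OF n2] t2[OF z(2)] null2[OF l] pathsD[OF tb] zA by simp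
    then have "c (conj_path t n2) = c (t b)"
      using loop_homD(3)[OF c conj_path_paths[OF t] tb] pathsD[OF n2] by simp
    then show ?thesis using pathsD[OF n2] z by (simp add: d_def G_def \<kappa>_def[of z2])
  qed
  have c'T: "c' T = h"
  proof -
    have "glue T = glue n1 \<otimes>\<^bsub>FN\<^esub> (glue \<beta> \<otimes>\<^bsub>FN\<^esub> inv\<^bsub>FN\<^esub> (glue n2))"
      unfolding T_def using pathsD[OF n1X] pathsD[OF n2X] pathsD[OF \<beta>X]
      by (simp add: X.cocycle_join X.cocycle_reversepath path_image_join)
    also have "\<dots> = G \<otimes>\<^bsub>FN\<^esub> (h \<otimes>\<^bsub>FN\<^esub> inv\<^bsub>FN\<^esub> G)"
      using glue_left pathsD[OF n1] pathsD[OF n2] glue_right pathsD[OF \<beta>] dn1 dn2 G h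
      by (simp add: FN.inv_mult_group)
    finally show ?thesis using GG G h by (simp add: c'_def FN.m_assoc)
  qed
  define t' where "t' x = (if x \<in> A then t x else n1 +++ r x)" for x
  have t': "\<forall>x\<in>?X. t' x \<in> paths ?X b x"
    using paths_mono[OF _ AX(1)] t paths_join[OF n1X paths_mono[OF _ AX(2)]] r by (auto simp: t'_def)
  \<comment> \<open>From \<open>z1\<close>, a point of \<open>O2\<close> is reached inside
    \<open>U\<close> through \<open>\<beta>\<close> and \<open>z2\<close>, whereas its connecting
    path in \<open>A\<close> runs through \<open>n2\<close>. The two choices differ by the inverse
    of \<open>T\<close>; \<open>E\<close> records this difference and \<open>e\<close> its
    spelling.\<close>
  define r' where "r' x = (if x \<in> O2 then \<beta> +++ s2 x else r x)" for x
  define E where "E x = (if x \<in> O2 then pinv ?X (pclass ?X T) else pone ?X b)" for x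
  have r': "r' x \<in> paths U z1 x" if "x \<in> U" for x
    using that r paths_join[OF \<beta> paths_mono[OF bspec[OF s2] O(4)]] by (simp add: r'_def)
  have bX: "b \<in> ?X" using b by simp
  have Eg: "E x \<in> groupoid ?X" "psrc (E x) = b" "ptgt (E x) = b" for x
    using pathsD[OF T] bX by (simp_all add: E_def)
  define R where "R x = pmult ?X (pclass ?X n1) (pclass ?X (r' x))" for x
  have Rg: "R x \<in> groupoid ?X" "psrc (R x) = b" "ptgt (R x) = x" if "x \<in> U" for x
    using pathsD[OF n1X] pathsD[OF paths_mono[OF r'[OF that] AX(2)]] by (simp_all add: R_def)
  have t'R: "pclass ?X (t' x) = pmult ?X (E x) (R x)" if x: "x \<in> U" for x
  proof (cases "x \<in> O2")
    case True
    then have e: "t' x = n2 +++ s2 x" using AU O(3) by (auto simp: t'_def t_def)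
    have s: "s2 x \<in> paths ?X z2 x" using bspec[OF s2 True] O(3) AX(1) paths_mono by blast
    have "R x = pmult ?X (pclass ?X T) (pclass ?X (t' x))"
      using pathsD[OF n1X] pathsD[OF n2X] pathsD[OF \<beta>X] pathsD[OF s] True
      by (simp add: R_def r'_def e T_def pclass_simps)
    moreover have "t' x \<in> paths ?X b x" using t' x by blast
    ultimately show ?thesis using pathsD[OF T] pathsD[of "t' x" ?X b x] True by (simp add: E_def)
  next
    case False
    have "t' x \<in> paths ?X b x" using t' x by blast
    have "pclass ?X (t' x) = R x"
    proof (cases "x \<in> A")
      case True
      then have x1: "x \<in> O1" using False x AU(1) by blast
      then have e: "t' x = n1 +++ s1 x" using True by (simp add: t'_def t_def)
      have s: "s1 x \<in> paths ?X z1 x" using bspec[OF s1 x1] O(1) AX(1) paths_mono by blast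
      have "pclass ?X (s1 x) = pclass ?X (r x)"
        using simply_connected_pclass[OF scU AX(2) paths_mono[OF bspec[OF s1 x1] O(2)]] r x by blast
      then show ?thesis using pathsD[OF n1X] pathsD[OF s] False by (simp add: R_def r'_def e pclass_simps)
    next
      case nA: False
      then have "t' x = n1 +++ r x" by (simp add: t'_def)
      then show ?thesis
        using pathsD[OF n1X] pathsD[OF paths_mono[OF bspec[OF r x] AX(2)]] False
        by (simp add: R_def r'_def pclass_simps)
    qed
    then show ?thesis using Rg[OF x] False by (simp add: E_def)
  qed
  have nullU: "pclass ?X q = pone ?X z1" if "q \<in> paths U z1 z1" for q
    unfolding pone_def using simply_connected_pclass[OF scU AX(2) that paths_const[OF zA(3)]] .
  define g' where "g' j = (if j < k then g j else T)" for j
  have g': "g' j \<in> paths ?X b b" "j \<le> k \<Longrightarrow> c' (g' j) = [(j, True)]" for j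
  proof -
    show "g' j \<in> paths ?X b b" using g paths_mono[OF _ AX(1)] T by (simp add: g'_def)
    show "c' (g' j) = [(j, True)]" if "j \<le> k"
    proof (cases "j < k")
      case True
      then show ?thesis using g c'c by (simp add: g'_def)
    next
      case False
      then show ?thesis using that c'T by (simp add: g'_def h_def)
    qed
  qed
  have wp: "word_path g' b w \<in> paths ?X b b" for w
    using g'(1) by (intro word_path_paths bX) auto
  have wapp: "pclass ?X (word_path g' b (u @ v)) = pmult ?X (pclass ?X (word_path g' b u)) (pclass ?X (word_path g' b v))" for u v
    using g'(1) by (intro pclass_word_path_append bX) auto
  have winv: "pclass ?X (word_path g' b (word_inv u)) = pinv ?X (pclass ?X (word_path g' b u))" for u
    using g'(1) by (intro pclass_word_path_word_inv bX) auto
  have genA: "\<exists>w. fst ` set w \<subseteq> {..k} \<and> pclass ?X p = pclass ?X (word_path g' b w)" if p: "p \<in> paths A b b" for p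
  proof -
    obtain w where w: "fst ` set w \<subseteq> {..<k}" "pclass A p = pclass A (word_path g b w)" using gen[OF p] by blast
    have "word_path g b w \<in> paths A b b" using w(1) g by (intro word_path_paths b) auto
    then have "pclass ?X p = pclass ?X (word_path g b w)" using pclass_mono[OF AX(1) _ w(2)] by simp
    moreover have "word_path g b w = word_path g' b w" using w(1)
      by (induction w) (auto simp: g'_def)
    ultimately show ?thesis using w(1) by (metis (no_types, lifting) atMost_iff lessThan_iff less_imp_le subset_eq)
  qed
  define e where "e x = (if x \<in> O2 then [(k, False)] else [])" for x
  have eE: "pclass ?X (word_path g' b (e x)) = E x" for x
    using pathsD[OF T] bX by (simp add: e_def E_def g'_def pclass_simps)
  have ek: "fst ` set (e x) \<subseteq> {..k}" for x by (cases "x \<in> O2") (simp_all add: e_def)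
  have full: "\<exists>w. fst ` set w \<subseteq> {..k} \<and> pclass ?X (conj_path t' p) = pclass ?X (word_path g' b w)"
    if p: "path p" "path_image p \<subseteq> ?X" for p
    using op p
  proof (induction rule: path_open_cover_induct)
    case (left p)
    have "conj_path t' p = conj_path t p" using ends[OF left(2)] by (simp add: conj_path_def t'_def)
    then show ?case using genA[OF conj_path_paths[OF t left]] by simp
  next
    case (right p)
    have pU: "pathstart p \<in> U" "pathfinish p \<in> U" using ends[OF right(2)] by auto
    have pX: "path_image p \<subseteq> ?X" using right(2) by blast
    have l: "r' (pathstart p) +++ (p +++ reversepath (r' (pathfinish p))) \<in> paths U z1 z1"
      using paths_join[OF r'[OF pU(1)] paths_join[OF _ paths_reversepath[OF r'[OF pU(2)]]], of p] right
      by (simp add: paths_def)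
    note r's = pathsD[OF paths_mono[OF r'[OF pU(1)] AX(2)]] pathsD[OF paths_mono[OF r'[OF pU(2)] AX(2)]]
    have 1: "pmult ?X (pclass ?X (r' (pathstart p))) (pmult ?X (pclass ?X p) (pinv ?X (pclass ?X (r' (pathfinish p))))) = pone ?X z1"
      using nullU[OF l] r's right(1) pX by (simp add: pclass_simps)
    have 2: "pmult ?X (R (pathstart p)) (pmult ?X (pclass ?X p) (pinv ?X (R (pathfinish p)))) = pone ?X b"
    proof -
      have "pmult ?X (R (pathstart p)) (pmult ?X (pclass ?X p) (pinv ?X (R (pathfinish p))))
        = pmult ?X (pclass ?X n1) (pmult ?X (pmult ?X (pclass ?X (r' (pathstart p)))
          (pmult ?X (pclass ?X p) (pinv ?X (pclass ?X (r' (pathfinish p)))))) (pinv ?X (pclass ?X n1)))"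
        unfolding R_def using r's right(1) pX pathsD[OF n1X] by simp
      also have "\<dots> = pone ?X b" unfolding 1 using pathsD[OF n1X] zA by simp
      finally show ?thesis .
    qed
    have "pclass ?X (conj_path t' p) = pmult ?X (E (pathstart p)) (pmult ?X
       (pmult ?X (R (pathstart p)) (pmult ?X (pclass ?X p) (pinv ?X (R (pathfinish p))))) (pinv ?X (E (pathfinish p))))"
      using pclass_conj_path[OF t' right(1) pX] t'R[OF pU(1)] t'R[OF pU(2)] Rg[OF pU(1)] Rg[OF pU(2)] Eg right(1) pX
      by simp
    also have "\<dots> = pmult ?X (E (pathstart p)) (pinv ?X (E (pathfinish p)))"
      unfolding 2 using Eg bX by simp
    also have "\<dots> = pclass ?X (word_path g' b (e (pathstart p) @ word_inv (e (pathfinish p))))"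
      unfolding wapp winv eE ..
    finally show ?case
      using ek[of "pathstart p"] ek[of "pathfinish p"] set_word_inv[of "e (pathfinish p)"]
      by (intro exI[of _ "e (pathstart p) @ word_inv (e (pathfinish p))"]) (simp add: image_Un)
  next
    case (join p q)
    have p: "path_image p \<subseteq> ?X" and q: "path_image q \<subseteq> ?X" using join by auto
    obtain u v where *: "fst ` set u \<subseteq> {..k}" "pclass ?X (conj_path t' p) = pclass ?X (word_path g' b u)"
      "fst ` set v \<subseteq> {..k}" "pclass ?X (conj_path t' q) = pclass ?X (word_path g' b v)" using join by blast
    have "pclass ?X (conj_path t' (p +++ q)) = pclass ?X (conj_path t' p +++ conj_path t' q)"
      using join by (intro pclass_conj_path_join[OF t']) auto
    also have "\<dots> = pclass ?X (word_path g' b (u @ v))"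
      using pathsD[OF conj_path_paths[OF t' join(1) p]] pathsD[OF conj_path_paths[OF t' join(2) q]] *(2,4)
      unfolding wapp by (simp add: pclass_join)
    finally show ?case using *(1,3) by (intro exI[of _ "u @ v"]) (simp add: image_Un)
  next
    case (homotopic p q)
    have pq: "path p" "path_image p \<subseteq> ?X" "path q" "path_image q \<subseteq> ?X"
      "pathstart p = pathstart q" "pathfinish p = pathfinish q"
      using homotopic_paths_imp_path[OF homotopic(1)] homotopic_paths_imp_subset[OF homotopic(1)]
        homotopic_paths_imp_pathstart[OF homotopic(1)] homotopic_paths_imp_pathfinish[OF homotopic(1)] by auto
    have "pclass ?X (conj_path t' p) = pclass ?X (conj_path t' q)"
      using pclass_conj_path[OF t' pq(1,2)] pclass_conj_path[OF t' pq(3,4)] pq(5,6) pclass_eqI[OF homotopic(1)] by simp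
    then show ?case using homotopic(2) by simp
  qed
  have "free_basis ?X b (Suc k) g' c'"
    unfolding free_basis_def
  proof (intro conjI ballI allI impI)
    show "loop_hom FN ?X b c'" by (rule c'hom)
    show "g' j \<in> paths ?X b b" for j by (rule g'(1))
    show "c' (g' j) = [(j, True)]" if "j < Suc k" for j using g'(2) that by simp
    fix p assume p: "p \<in> paths ?X b b"
    note P = pathsD[OF p]
    obtain w where w: "fst ` set w \<subseteq> {..k}" "pclass ?X (conj_path t' p) = pclass ?X (word_path g' b w)"
      using full[OF P(1,2)] by blast
    have tb': "t' b = t b" using b by (simp add: t'_def)
    have tbX: "t b \<in> paths ?X b b" using tb AX(1) by (rule paths_mono)
    obtain v where v: "fst ` set v \<subseteq> {..k}" "pclass ?X (t b) = pclass ?X (word_path g' b v)"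
      using genA[OF tb] by blast
    have "pclass ?X p = pmult ?X (pinv ?X (pclass ?X (t b))) (pmult ?X (pclass ?X (conj_path t' p)) (pclass ?X (t b)))"
      unfolding pclass_conj_path[OF t' P(1,2)] using pathsD[OF tbX] P tb' by simp
    also have "\<dots> = pclass ?X (word_path g' b (word_inv v @ (w @ v)))"
      unfolding wapp winv w(2) v(2) ..
    finally show "\<exists>w. fst ` set w \<subseteq> {..<Suc k} \<and> pclass ?X p = pclass ?X (word_path g' b w)"
      using w(1) v(1) set_word_inv[of v]
      by (intro exI[of _ "word_inv v @ (w @ v)"]) (simp add: image_Un lessThan_Suc_atMost)
  qed
  moreover have "path_connected ?X"
    using path_connected_Un[OF pcA pcU] zA by blast
  ultimately show ?thesis using bX by (auto simp: free_loops_def)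
qed

corollary loops_equiv_attach_simply_connected:
  fixes A U :: "'a::real_normed_vector set"
  assumes "open A" "open U" "path_connected A" "simply_connected U"
    and sc: "simply_connected (A \<inter> U)" and ne: "A \<inter> U \<noteq> {}" and "b \<in> A"
  shows "loops_equiv A (A \<union> U) b"
proof -
  obtain z where z: "z \<in> A \<inter> U" using ne by blast
  show ?thesis
  proof (rule loops_equiv_attach[OF assms(1-4) simply_connected_imp_path_connected[OF sc] z assms(7)])
    fix q assume q: "q \<in> paths (A \<inter> U) z z"
    show "pclass A q = pone A z"
      unfolding pone_def by (rule simply_connected_pclass[OF sc _ q paths_const[OF z]]) simp
  qed
qed

text \<open>A loop and the image of a homotopy square are compact, so each lies in a single member
  of \<open>F\<close>.\<close>

lemma loops_equiv_directed_Union: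
  fixes X :: "'a::real_normed_vector set"
  assumes cpt: "\<And>K. compact K \<Longrightarrow> K \<subseteq> X \<Longrightarrow> \<exists>Y\<in>F. K \<subseteq> Y"
    and F: "\<And>Y. Y \<in> F \<Longrightarrow> loops_equiv A Y b" "\<And>Y. Y \<in> F \<Longrightarrow> Y \<subseteq> X"
  shows "loops_equiv A X b"
proof -
  obtain Y0 where Y0: "Y0 \<in> F" using cpt[of "{}"] by auto
  note E0 = loops_equivD[OF F(1)[OF Y0]]
  show ?thesis
    unfolding loops_equiv_def
  proof (intro conjI ballI allI impI)
    show "path_connected A" "A \<subseteq> X" "b \<in> A" using E0 F(2)[OF Y0] by auto
    show "path_connected X"
      unfolding path_connected_def
    proof (intro ballI)
      fix x y assume xy: "x \<in> X" "y \<in> X"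
      then obtain Y where Y: "Y \<in> F" "{x, y} \<subseteq> Y" using cpt[of "{x, y}"] by auto
      then obtain g where "path g" "path_image g \<subseteq> Y" "pathstart g = x" "pathfinish g = y"
        using loops_equivD(2)[OF F(1)[OF Y(1)]] unfolding path_connected_def by blast
      then show "\<exists>g. path g \<and> path_image g \<subseteq> X \<and> pathstart g = x \<and> pathfinish g = y"
        using F(2)[OF Y(1)] by blast
    qed
    fix p assume p: "p \<in> paths X b b"
    then obtain Y where Y: "Y \<in> F" "path_image p \<subseteq> Y"
      using cpt[of "path_image p"] compact_path_image pathsD[OF p] by blast
    have "p \<in> paths Y b b" using pathsD[OF p] Y(2) by (simp add: paths_def)
    then obtain q where q: "q \<in> paths A b b" "pclass Y p = pclass Y q"
      using loops_equivD(5)[OF F(1)[OF Y(1)]] by blast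
    have "q \<in> paths Y b b" using q(1) loops_equivD(3)[OF F(1)[OF Y(1)]] by (rule paths_mono)
    then show "\<exists>q\<in>paths A b b. pclass X p = pclass X q"
      using q(1) pclass_mono[OF F(2)[OF Y(1)] _ q(2)] by blast
  next
    fix c p q assume c: "loop_hom FN A b c" and p: "p \<in> paths A b b" and q: "q \<in> paths A b b"
      and pq: "pclass X p = pclass X q"
    have "q \<in> paths X b b" using q E0(3) F(2)[OF Y0] paths_mono by blast
    then have "homotopic_paths X p q" using homotopic_pathsI[OF pq] by blast
    then obtain h where h: "continuous_on ({0..1::real} \<times> {0..1::real}) h" "h \<in> ({0..1} \<times> {0..1}) \<rightarrow> X"
       "\<forall>x \<in> {0..1}. h(0,x) = p x" "\<forall>x \<in> {0..1}. h(1,x) = q x"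
       "\<forall>t \<in> {0..1::real}. pathstart(h \<circ> Pair t) = pathstart p \<and> pathfinish(h \<circ> Pair t) = pathfinish p"
      unfolding homotopic_paths by auto
    have "compact (h ` ({0..1} \<times> {0..1}))" using h(1) by (intro compact_continuous_image compact_Times) auto
    then obtain Y where Y: "Y \<in> F" "h ` ({0..1} \<times> {0..1}) \<subseteq> Y" using cpt h(2) by blast
    then have "homotopic_paths Y p q" unfolding homotopic_paths using h by blast
    then show "c p = c q" using loops_equivD(6)[OF F(1)[OF Y(1)] c p q] pclass_eqI by blast
  qed
qed

text \<open>Real induction: the supremum of the failing points satisfies \<open>P\<close> by
  \<open>lim\<close>, and then \<open>step\<close> keeps failing points away from it. The width in
  \<open>step\<close> may depend on \<open>t\<close>, as it does in the sweep.\<close>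

lemma real_induct_down:
  fixes a T :: real
  assumes T: "P T" "a \<le> T"
    and step: "\<And>t. a < t \<Longrightarrow> t \<le> T \<Longrightarrow> P t \<Longrightarrow> \<exists>\<delta>>0. \<forall>s. t - \<delta> < s \<and> s < t \<and> a \<le> s \<longrightarrow> P s"
    and lim: "\<And>t. a \<le> t \<Longrightarrow> t < T \<Longrightarrow> (\<And>s. t < s \<Longrightarrow> s \<le> T \<Longrightarrow> P s) \<Longrightarrow> P t"
    and t: "a \<le> t" "t \<le> T"
  shows "P t"
proof (rule ccontr)
  assume nP: "\<not> P t"
  define B where "B = {u. a \<le> u \<and> u \<le> T \<and> \<not> P u}"
  have tB: "t \<in> B" using nP t by (simp add: B_def)
  have bd: "bdd_above B" by (auto simp: B_def bdd_above_def)
  define s where "s = Sup B"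
  have ub: "u \<le> s" if "u \<in> B" for u unfolding s_def using that bd by (rule cSup_upper)
  have s: "a \<le> s" "s \<le> T"
  proof -
    show "a \<le> s" using ub[OF tB] t by linarith
    show "s \<le> T" unfolding s_def using tB by (intro cSup_least) (auto simp: B_def)
  qed
  have above: "P u" if "s < u" "u \<le> T" for u
    using ub[of u] that s(1) by (force simp: B_def)
  have Ps: "P s" using T(1) lim[OF s(1)] above s(2) by (cases "s = T") auto
  show False
  proof (cases "s = a")
    case True
    then have "t = a" using ub[OF tB] t by linarith
    then show False using True Ps nP by simp
  next
    case False
    then obtain \<delta> where \<delta>: "\<delta> > 0" "\<And>u. s - \<delta> < u \<Longrightarrow> u < s \<Longrightarrow> a \<le> u \<Longrightarrow> P u"
      using step[OF _ s(2) Ps] s(1) by force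
    have "\<exists>u\<in>B. s - \<delta> < u" unfolding s_def
      by (rule less_cSupE[of "Sup B - \<delta>" B]) (use \<delta>(1) tB in auto)
    then obtain u where u: "u \<in> B" "s - \<delta> < u" by blast
    then have "P u" using \<delta>(2)[of u] ub[OF u(1)] Ps by (cases "u = s") (auto simp: B_def)
    then show False using u(1) by (simp add: B_def)
  qed
qed

section \<open>Passing a level of the sweep\<close>

lemma halfspace3:
  fixes a b c e :: real
  shows "convex {p :: real \<times> real \<times> real. a * fst p + b * fst (snd p) + c * snd (snd p) < e}"
    "open {p :: real \<times> real \<times> real. a * fst p + b * fst (snd p) + c * snd (snd p) < e}"
proof -
  have "{p :: real \<times> real \<times> real. a * fst p + b * fst (snd p) + c * snd (snd p) < e} = {p. inner (a, b, c) p < e}"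
    by (auto simp: inner_prod_def)
  then show "convex {p :: real \<times> real \<times> real. a * fst p + b * fst (snd p) + c * snd (snd p) < e}"
    "open {p :: real \<times> real \<times> real. a * fst p + b * fst (snd p) + c * snd (snd p) < e}"
    by (simp_all add: convex_halfspace_lt open_halfspace_lt)
qed

text \<open>Decreasing the second coordinate never leads into the curtain, so all points can be
  pushed to where it is at most -1; from there straight segments lead to one point.\<close>

lemma simply_connected_below_curtain:
  fixes I :: "real set" and Z :: "(real \<times> real) set"
  assumes I: "convex I" "I \<noteq> {}"
  shows "simply_connected {p :: real \<times> real \<times> real. snd (snd p) \<in> I \<and> (fst (snd p) < 0 \<or> (fst p, snd (snd p)) \<notin> Z)}"
    (is "simply_connected ?S")
proof -
  obtain z0 where z0: "z0 \<in> I" using I by blast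
  define f :: "real \<times> real \<times> real \<Rightarrow> real \<times> real \<times> real" where
    "f p = (fst p, min 0 (fst (snd p)) - 1, snd (snd p))" for p
  have cf: "continuous_on ?S f" unfolding f_def by (intro continuous_intros)
  let ?a = "(0, -1, z0) :: real \<times> real \<times> real"
  have 1: "homotopic_with_canon (\<lambda>_. True) ?S ?S id f"
  proof (rule homotopic_with_linear)
    fix p assume p: "p \<in> ?S"
    show "closed_segment (id p) (f p) \<subseteq> ?S"
    proof
      fix v assume "v \<in> closed_segment (id p) (f p)"
      then obtain u where u: "0 \<le> u" "u \<le> 1" "v = (1 - u) *\<^sub>R p + u *\<^sub>R f p" by (auto simp: in_segment)
      have v: "fst v = fst p" "snd (snd v) = snd (snd p)"
        "fst (snd v) = (1 - u) * fst (snd p) + u * (min 0 (fst (snd p)) - 1)"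
        by (simp_all add: u(3) f_def algebra_simps)
      have "u * (min 0 (fst (snd p)) - 1) \<le> u * fst (snd p)" using u(1) by (intro mult_left_mono) auto
      then have "fst (snd v) \<le> fst (snd p)" unfolding v(3) by (simp add: algebra_simps)
      then show "v \<in> ?S" using p v(1,2) by auto
    qed
  qed (use cf in auto)
  have 2: "homotopic_with_canon (\<lambda>_. True) ?S ?S f (\<lambda>_. ?a)"
  proof (rule homotopic_with_linear)
    fix p assume p: "p \<in> ?S"
    show "closed_segment (f p) ?a \<subseteq> ?S"
    proof
      fix v assume "v \<in> closed_segment (f p) ?a"
      then obtain u where u: "0 \<le> u" "u \<le> 1" "v = (1 - u) *\<^sub>R f p + u *\<^sub>R ?a" by (auto simp: in_segment)
      have "snd (snd v) = (1 - u) *\<^sub>R snd (snd p) + u *\<^sub>R z0" by (simp add: u(3) f_def)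
      moreover have "(1 - u) *\<^sub>R snd (snd p) + u *\<^sub>R z0 \<in> I"
        using convexD[OF I(1), of "snd (snd p)" z0 "1 - u" u] p z0 u(1,2) by simp
      ultimately have vI: "snd (snd v) \<in> I" by simp
      have "fst (snd v) = (1 - u) * min 0 (fst (snd p)) - 1" by (simp add: u(3) f_def algebra_simps)
      moreover have "(1 - u) * min 0 (fst (snd p)) \<le> 0" using u by (intro mult_nonneg_nonpos) auto
      ultimately have "fst (snd v) < 0" by linarith
      then show "v \<in> ?S" using vI by simp
    qed
  qed (use cf in auto)
  have "contractible ?S" unfolding contractible_def using homotopic_with_trans[OF 1 2] by blast
  then show ?thesis by (rule contractible_imp_simply_connected)
qed

text \<open>In the first and third coordinates the removed part is a convex cone with apex
  \<open>(q, 0)\<close>, and the centre lies in the opposite cone, on the upward prolongation of the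
  strand of slope \<open>lo\<close>. Hence a segment from the centre that has entered the cone
  cannot leave it, and a segment to a point outside never enters. The bound on \<open>lo\<close>
  keeps the centre in the box.\<close>

lemma starlike_cone_complement:
  fixes q r \<delta> lo hi :: real
  assumes "lo \<le> hi" "\<bar>lo\<bar> * \<delta> < r" "\<delta> > 0"
  shows "starlike {p :: real \<times> real \<times> real. \<bar>fst p - q\<bar> < r \<and> \<bar>snd (snd p)\<bar> < \<delta> \<and> 0 < fst (snd p) \<and>
     \<not> (snd (snd p) \<le> 0 \<and> 0 \<le> fst p - q + lo * snd (snd p) \<and> fst p - q + hi * snd (snd p) \<le> 0)}"
    (is "starlike ?S")
  unfolding starlike_def
proof (intro bexI[of _ "(q - lo * (\<delta>/2), 1, \<delta>/2)"] ballI)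
  let ?c = "(q - lo * (\<delta>/2), 1, \<delta>/2) :: real \<times> real \<times> real"
  have lo: "\<bar>lo * (\<delta>/2)\<bar> < r"
  proof -
    have "\<bar>lo * (\<delta>/2)\<bar> = \<bar>lo\<bar> * \<delta> / 2" using assms(3) by (simp add: abs_mult)
    moreover have "0 \<le> \<bar>lo\<bar> * \<delta>" using assms(3) by simp
    ultimately show ?thesis using assms(2) by linarith
  qed
  then show "?c \<in> ?S" using assms by auto
  fix p assume p: "p \<in> ?S"
  show "closed_segment ?c p \<subseteq> ?S"
  proof
    fix v assume "v \<in> closed_segment ?c p"
    then obtain u where u: "0 \<le> u" "u \<le> 1" "v = (1 - u) *\<^sub>R ?c + u *\<^sub>R p" by (auto simp: in_segment)
    have v: "fst v = (1 - u) * (q - lo * (\<delta>/2)) + u * fst p"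
      "fst (snd v) = (1 - u) * 1 + u * fst (snd p)" "snd (snd v) = (1 - u) * (\<delta>/2) + u * snd (snd p)"
      by (simp_all add: u(3))
    have cv: "\<And>w. convex {x :: real. \<bar>x - w\<bar> < r}" "convex {x :: real. \<bar>x\<bar> < \<delta>}" "convex {x :: real. 0 < x}"
    proof -
      have "{x :: real. \<bar>x - w\<bar> < r} = {w - r<..<w + r}" for w by auto
      moreover have "{x :: real. \<bar>x\<bar> < \<delta>} = {- \<delta> <..< \<delta>}" by auto
      moreover have "{x :: real. 0 < x} = {0<..}" by auto
      ultimately show "\<And>w. convex {x :: real. \<bar>x - w\<bar> < r}" "convex {x :: real. \<bar>x\<bar> < \<delta>}" "convex {x :: real. 0 < x}"
        by simp_all
    qed
    have 1: "\<bar>fst v - q\<bar> < r"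
      using convexD[OF cv(1)[of q], of "q - lo * (\<delta>/2)" "fst p" "1 - u" u] lo p u v(1) by simp
    have 2: "\<bar>snd (snd v)\<bar> < \<delta>"
      using convexD[OF cv(2), of "\<delta>/2" "snd (snd p)" "1 - u" u] assms p u v(3) by simp
    have 3: "0 < fst (snd v)"
      using convexD[OF cv(3), of 1 "fst (snd p)" "1 - u" u] p u v(2) by simp
    have False if k: "snd (snd v) \<le> 0" "0 \<le> fst v - q + lo * snd (snd v)" "fst v - q + hi * snd (snd v) \<le> 0"
    proof -
      have u0: "u > 0"
      proof (rule ccontr)
        assume "\<not> u > 0"
        then have "u = 0" using u by simp
        then show False using k(1) v(3) assms by simp
      qed
      have "(1 - u) * (\<delta>/2) \<ge> 0" using u assms by simp
      then have "u * snd (snd p) \<le> 0" using k(1) v(3) by linarith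
      then have a: "snd (snd p) \<le> 0" using u0 by (simp add: mult_le_0_iff)
      have "fst v - q + lo * snd (snd v) = u * (fst p - q + lo * snd (snd p))"
        unfolding v by (simp add: field_simps)
      then have b: "0 \<le> fst p - q + lo * snd (snd p)" using k(2) u0 by (simp add: zero_le_mult_iff)
      have "fst v - q + hi * snd (snd v) = (1 - u) * ((hi - lo) * (\<delta>/2)) + u * (fst p - q + hi * snd (snd p))"
        unfolding v by (simp add: field_simps)
      moreover have "(1 - u) * ((hi - lo) * (\<delta>/2)) \<ge> 0" using u assms by simp
      ultimately have "u * (fst p - q + hi * snd (snd p)) \<le> 0" using k(3) by linarith
      then have "fst p - q + hi * snd (snd p) \<le> 0" using u0 by (simp add: mult_le_0_iff)
      then show False using a b p by blast
    qed
    then show "v \<in> ?S" using 1 2 3 by blast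
  qed
qed

text \<open>The following locale describes the set \<open>G\<close> near the level 0 of the third coordinate, after a
  straightening that moves it into the plane \<open>y = 0\<close>: it meets level 0 in the points \<open>q \<in> Q\<close> of the
  x-axis, and the strands leaving \<open>q\<close> downwards have the slopes \<open>D q\<close>. The region below level 0 is
  exhausted by attaching what lies in front of the curtains behind the strands, then what lies behind each
  fan of strands, and finally the windows between neighbouring strands of a fan. Only the windows
  create generators, because they alone meet the previous stage in two components.\<close>

locale slab =
  fixes G :: "(real \<times> real \<times> real) set" and \<Gamma> :: "(real \<times> real) set"
    and Q :: "real set" and D :: "real \<Rightarrow> real set" and \<delta> r :: real
  assumes closed_G: "closed G" and closed_\<Gamma>: "closed \<Gamma>" and \<delta>: "\<delta> > 0"
    and fin_Q: "finite Q" and D: "q \<in> Q \<Longrightarrow> finite (D q)" "q \<in> Q \<Longrightarrow> D q \<noteq> {}"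
    and flat: "\<bar>z\<bar> \<le> \<delta> \<Longrightarrow> (x, y, z) \<in> G \<longleftrightarrow> y = 0 \<and> (x, z) \<in> \<Gamma>"
    and legs: "-\<delta> \<le> z \<Longrightarrow> z \<le> 0 \<Longrightarrow> (x, z) \<in> \<Gamma> \<longleftrightarrow> (\<exists>q\<in>Q. \<exists>d\<in>D q. x = q - d * z)"
    and narrow: "q \<in> Q \<Longrightarrow> d \<in> D q \<Longrightarrow> \<bar>d\<bar> * \<delta> < r"
    and apart: "q \<in> Q \<Longrightarrow> q' \<in> Q \<Longrightarrow> q \<noteq> q' \<Longrightarrow> 2 * r \<le> \<bar>q - q'\<bar>"
begin

definition region :: "real \<Rightarrow> (real \<times> real \<times> real) set" where
  "region t = {p. t < snd (snd p)} - G"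

definition lo :: "real \<Rightarrow> real" where "lo q = Min (D q)"
definition hi :: "real \<Rightarrow> real" where "hi q = Max (D q)"

definition fan :: "real \<Rightarrow> (real \<times> real) set" where
  "fan q = {(x, z). z \<le> 0 \<and> 0 \<le> x - q + lo q * z \<and> x - q + hi q * z \<le> 0}"

text \<open>Below level 0 the curtain covers the whole sector between the extreme strands of a fan,
  not only the strands. The box behind a fan then meets the earlier stage in a star-shaped set, and
  the gaps between strands are left to the windows.\<close>

definition shadow :: "(real \<times> real) set" where
  "shadow = {(x, z). 0 \<le> z \<and> (x, z) \<in> \<Gamma>} \<union> (\<Union>q\<in>Q. fan q)"

definition front :: "(real \<times> real \<times> real) set" where
  "front = {p. snd (snd p) \<in> {- \<delta> <..< \<delta>} \<and> (fst (snd p) < 0 \<or> (fst p, snd (snd p)) \<notin> shadow)}"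

definition rear :: "real \<Rightarrow> (real \<times> real \<times> real) set" where
  "rear q = {p. \<bar>fst p - q\<bar> < r \<and> \<bar>snd (snd p)\<bar> < \<delta> \<and> 0 < fst (snd p)}"

text \<open>A window is named by its apex and by the smaller slope of its two bounding strands; the
  greatest slope opens none, so a fan of \<open>a\<close> strands has \<open>a - 1\<close>
  windows.\<close>

definition windows :: "(real \<times> real) set" where
  "windows = {(q, d). q \<in> Q \<and> d \<in> D q \<and> d < hi q}"

definition next_leg :: "real \<Rightarrow> real \<Rightarrow> real" where
  "next_leg q d = Min {d' \<in> D q. d < d'}"

definition window :: "real \<times> real \<Rightarrow> (real \<times> real \<times> real) set" where
  "window = (\<lambda>(q, d). {p. -\<delta> < snd (snd p) \<and> snd (snd p) < 0 \<and> 0 < fst p - q + d * snd (snd p) \<and>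
      fst p - q + next_leg q d * snd (snd p) < 0})"

lemma lo_hi: "q \<in> Q \<Longrightarrow> lo q \<in> D q" "q \<in> Q \<Longrightarrow> hi q \<in> D q" "q \<in> Q \<Longrightarrow> d \<in> D q \<Longrightarrow> lo q \<le> d"
  "q \<in> Q \<Longrightarrow> d \<in> D q \<Longrightarrow> d \<le> hi q"
  using D by (auto simp: lo_def hi_def)

lemma closed_shadow: "closed shadow"
proof -
  have "closed (fan q)" for q
  proof -
    have "fan q = {p. snd p \<le> 0} \<inter> {p. 0 \<le> fst p - q + lo q * snd p} \<inter> {p. fst p - q + hi q * snd p \<le> 0}"
      by (auto simp: fan_def)
    moreover have "closed \<dots>" by (intro closed_Int closed_Collect_le continuous_intros)
    ultimately show ?thesis by simp
  qed
  moreover have "closed {(x, z). 0 \<le> z \<and> (x, z) \<in> \<Gamma>}"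
  proof -
    have "{(x, z). 0 \<le> z \<and> (x, z) \<in> \<Gamma>} = {p. 0 \<le> snd p} \<inter> \<Gamma>" by auto
    moreover have "closed \<dots>" by (intro closed_Int closed_Collect_le continuous_intros closed_\<Gamma>)
    ultimately show ?thesis by simp
  qed
  ultimately show ?thesis unfolding shadow_def using fin_Q by (intro closed_Un closed_UN) auto
qed

lemma open_region: "open (region t)"
  unfolding region_def by (intro open_Diff open_Collect_less continuous_intros closed_G)

lemma open_front: "open front"
proof -
  have "closed ((\<lambda>p :: real \<times> real \<times> real. (fst p, snd (snd p))) -` shadow)"
    by (intro closed_vimage closed_shadow continuous_intros)
  moreover have "front = {p. -\<delta> < snd (snd p)} \<inter> {p. snd (snd p) < \<delta>} \<inter>
      ({p. fst (snd p) < 0} \<union> - ((\<lambda>p. (fst p, snd (snd p))) -` shadow))"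
    by (auto simp: front_def)
  ultimately show ?thesis
    by (auto intro!: open_Int open_Un open_Collect_less continuous_intros)
qed

lemma rear_halfspaces: "convex (rear q)" "open (rear q)"
proof -
  have "rear q = {p. 1 * fst p + 0 * fst (snd p) + 0 * snd (snd p) < q + r} \<inter>
     {p. (-1) * fst p + 0 * fst (snd p) + 0 * snd (snd p) < r - q} \<inter>
     {p. 0 * fst p + 0 * fst (snd p) + 1 * snd (snd p) < \<delta>} \<inter>
     {p. 0 * fst p + 0 * fst (snd p) + (-1) * snd (snd p) < \<delta>} \<inter>
     {p. 0 * fst p + (-1) * fst (snd p) + 0 * snd (snd p) < 0}"
    by (auto simp: rear_def)
  moreover have "convex \<dots>" "open \<dots>" by (intro convex_Int open_Int halfspace3)+
  ultimately show "convex (rear q)" "open (rear q)" by simp_all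
qed

lemma window_halfspaces: "convex (window i)" "open (window i)"
proof -
  obtain q d where i: "i = (q, d)" by (cases i)
  have "window i = {p. 0 * fst p + 0 * fst (snd p) + (-1) * snd (snd p) < \<delta>} \<inter>
     {p. 0 * fst p + 0 * fst (snd p) + 1 * snd (snd p) < 0} \<inter>
     {p. (-1) * fst p + 0 * fst (snd p) + (-d) * snd (snd p) < -q} \<inter>
     {p. 1 * fst p + 0 * fst (snd p) + next_leg q d * snd (snd p) < q}"
    by (auto simp: window_def i)
  moreover have "convex \<dots>" "open \<dots>" by (intro convex_Int open_Int halfspace3)+
  ultimately show "convex (window i)" "open (window i)" by simp_all
qed

lemma fan_narrow:
  assumes q: "q \<in> Q" and "(x, z) \<in> fan q" "-\<delta> < z"
  shows "\<bar>x - q\<bar> < r"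
proof -
  have z: "z \<le> 0" "x - q \<ge> - lo q * z" "x - q \<le> - hi q * z" using assms(2) by (auto simp: fan_def)
  have "\<bar>z\<bar> \<le> \<delta>" using z(1) assms(3) by simp
  then have "\<bar>lo q * z\<bar> \<le> \<bar>lo q\<bar> * \<delta>" "\<bar>hi q * z\<bar> \<le> \<bar>hi q\<bar> * \<delta>"
    unfolding abs_mult by (auto intro: mult_left_mono)
  then show ?thesis using z narrow[OF q lo_hi(1)[OF q]] narrow[OF q lo_hi(2)[OF q]] by linarith
qed

lemma shadow_iff:
  assumes "q \<in> Q" "\<bar>x - q\<bar> < r" "-\<delta> < z" "z \<le> 0"
  shows "(x, z) \<in> shadow \<longleftrightarrow> (x, z) \<in> fan q"
proof
  assume "(x, z) \<in> shadow"
  then consider "z = 0" "(x, z) \<in> \<Gamma>" | q' where "q' \<in> Q" "(x, z) \<in> fan q'"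
    using assms by (auto simp: shadow_def)
  then have "\<exists>q'\<in>Q. (x, z) \<in> fan q'"
  proof cases
    case 1
    then obtain q' d where "q' \<in> Q" "x = q'" using legs[of z x] \<delta> by auto
    then show ?thesis using 1 by (auto simp: fan_def)
  qed blast
  then obtain q' where q': "q' \<in> Q" "(x, z) \<in> fan q'" by blast
  have "\<bar>x - q'\<bar> < r" using fan_narrow[OF q' assms(3)] .
  then have "q' = q" using apart[OF assms(1) q'(1)] assms(2) by linarith
  then show "(x, z) \<in> fan q" using q' by simp
qed (use assms in \<open>auto simp: shadow_def\<close>)

lemma window_fan:
  assumes i: "(q, d) \<in> windows" and p: "p \<in> window (q, d)"
  shows "(fst p, snd (snd p)) \<in> fan q" "q \<in> Q"
proof -
  show q: "q \<in> Q" using i by (simp add: windows_def)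
  have d: "d \<in> D q" "d < hi q" using i by (auto simp: windows_def)
  have "finite {d' \<in> D q. d < d'}" "hi q \<in> {d' \<in> D q. d < d'}" using D(1)[OF q] lo_hi(2)[OF q] d by auto
  then have n: "next_leg q d \<in> D q" unfolding next_leg_def using Min_in by blast
  have z: "snd (snd p) < 0" using p by (simp add: window_def)
  have "d * snd (snd p) \<le> lo q * snd (snd p)" "hi q * snd (snd p) \<le> next_leg q d * snd (snd p)"
    using z lo_hi(3)[OF q d(1)] lo_hi(4)[OF q n] by (auto intro: mult_right_mono_neg)
  moreover have "0 < fst p - q + d * snd (snd p)" "fst p - q + next_leg q d * snd (snd p) < 0"
    using p by (auto simp: window_def)
  ultimately have "0 \<le> fst p - q + lo q * snd (snd p)" "fst p - q + hi q * snd (snd p) \<le> 0" by linarith+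
  then show "(fst p, snd (snd p)) \<in> fan q" using z by (simp add: fan_def)
qed

lemma window_disjoint:
  assumes i: "i \<in> windows" and j: "j \<in> windows" and "i \<noteq> j"
  shows "window i \<inter> window j = {}"
proof (rule ccontr)
  assume "window i \<inter> window j \<noteq> {}"
  then obtain p where p: "p \<in> window i" "p \<in> window j" by blast
  obtain q d q' d' where ij: "i = (q, d)" "j = (q', d')" by (cases i, cases j)
  note f = window_fan[of q d p] window_fan[of q' d' p]
  have z: "-\<delta> < snd (snd p)" "snd (snd p) < 0" using p(1) by (auto simp: ij window_def)
  have "\<bar>fst p - q\<bar> < r" "\<bar>fst p - q'\<bar> < r"
    using f i j p fan_narrow z(1) by (auto simp: ij)
  then have qq: "q' = q" using apart[of q q'] f i j p by (force simp: ij)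
  have lt: False if "d1 < d2" "d1 \<in> D q" "d2 \<in> D q" "p \<in> window (q, d1)" "p \<in> window (q, d2)" for d1 d2
  proof -
    have "next_leg q d1 \<le> d2" unfolding next_leg_def using that D(1) f i p by (intro Min_le) (auto simp: ij)
    then have "d2 * snd (snd p) \<le> next_leg q d1 * snd (snd p)" using z by (intro mult_right_mono_neg) auto
    moreover have "fst p - q + next_leg q d1 * snd (snd p) < 0" "0 < fst p - q + d2 * snd (snd p)"
      using that(4,5) by (auto simp: window_def)
    ultimately show False by linarith
  qed
  have "d \<noteq> d'" using assms(3) qq by (simp add: ij)
  moreover have "d \<in> D q" "d' \<in> D q" using i j qq by (auto simp: ij windows_def)
  moreover have "p \<in> window (q, d)" "p \<in> window (q, d')" using p qq by (auto simp: ij)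
  ultimately show False using lt[of d d'] lt[of d' d] by (meson linorder_neqE_linordered_idom)
qed

text \<open>Both \<open>front\<close> and its overlap with \<open>region 0\<close> have the shape
  treated in \<open>simply_connected_below_curtain\<close>, over the intervals from
  \<open>-\<delta>\<close> to \<open>\<delta>\<close> and from 0 to \<open>\<delta>\<close>.\<close>

lemma stage_front:
  assumes "path_connected (region 0)" "b \<in> region 0"
  shows "loops_equiv (region 0) (region 0 \<union> front) b"
proof (rule loops_equiv_attach_simply_connected[OF open_region open_front assms(1) _ _ _ assms(2)])
  show "simply_connected front"
    unfolding front_def by (rule simply_connected_below_curtain) (use \<delta> in auto)
  have eq: "region 0 \<inter> front = {p. snd (snd p) \<in> {0 <..< \<delta>} \<and> (fst (snd p) < 0 \<or> (fst p, snd (snd p)) \<notin> \<Gamma>)}"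
  proof (rule iffD2[OF set_eq_iff], rule allI)
    fix p :: "real \<times> real \<times> real"
    obtain x y z where p: "p = (x, y, z)" by (cases p)
    show "p \<in> region 0 \<inter> front \<longleftrightarrow> p \<in> {p. snd (snd p) \<in> {0 <..< \<delta>} \<and> (fst (snd p) < 0 \<or> (fst p, snd (snd p)) \<notin> \<Gamma>)}"
      using flat[of z x y] \<delta> by (auto simp: p region_def front_def shadow_def fan_def)
  qed
  show "simply_connected (region 0 \<inter> front)"
    unfolding eq by (rule simply_connected_below_curtain) (use \<delta> in auto)
  have "(0, -1, \<delta>/2) \<in> region 0 \<inter> front" unfolding eq using \<delta> by auto
  then show "region 0 \<inter> front \<noteq> {}" by blast
qed

text \<open>By \<open>apart\<close> the boxes behind different fans are disjoint, so attaching one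
  leaves the overlap of the next unchanged: the star-shaped complement of a cone.\<close>

lemma stage_rear:
  assumes pc: "path_connected (region 0)" and b: "b \<in> region 0" and I: "finite I" "I \<subseteq> Q"
  shows "loops_equiv (region 0) (region 0 \<union> front \<union> (\<Union>q\<in>I. rear q)) b"
  using I
proof (induction I)
  case empty
  then show ?case using stage_front[OF pc b] by simp
next
  case (insert q I)
  let ?A = "region 0 \<union> front \<union> (\<Union>q\<in>I. rear q)"
  have q: "q \<in> Q" and qI: "q \<notin> I" "I \<subseteq> Q" using insert by auto
  have IH: "loops_equiv (region 0) ?A b" using insert by simp
  have disj: "rear q' \<inter> rear q = {}" if "q' \<in> I" for q'
  proof -
    have "2 * r \<le> \<bar>q - q'\<bar>" using apart[OF q] that qI by auto
    then show ?thesis by (auto simp: rear_def)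
  qed
  have eq: "?A \<inter> rear q = {p :: real \<times> real \<times> real. \<bar>fst p - q\<bar> < r \<and> \<bar>snd (snd p)\<bar> < \<delta> \<and> 0 < fst (snd p) \<and>
     \<not> (snd (snd p) \<le> 0 \<and> 0 \<le> fst p - q + lo q * snd (snd p) \<and> fst p - q + hi q * snd (snd p) \<le> 0)}" (is "_ = ?S")
  proof (rule iffD2[OF set_eq_iff], rule allI)
    fix p :: "real \<times> real \<times> real"
    obtain x y z where p: "p = (x, y, z)" by (cases p)
    show "p \<in> ?A \<inter> rear q \<longleftrightarrow> p \<in> ?S"
    proof (cases "p \<in> rear q")
      case True
      then have pb: "\<bar>x - q\<bar> < r" "\<bar>z\<bar> < \<delta>" "0 < y" by (auto simp: rear_def p)
      then have "p \<notin> G" using flat[of z x y] by (auto simp: p)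
      moreover have "p \<notin> (\<Union>q\<in>I. rear q)" using disj True by blast
      ultimately have "p \<in> ?A \<longleftrightarrow> 0 < z \<or> (x, z) \<notin> shadow"
        using pb by (auto simp: p region_def front_def)
      moreover have "z \<le> 0 \<Longrightarrow> (x, z) \<in> shadow \<longleftrightarrow> (x, z) \<in> fan q" using shadow_iff[OF q pb(1)] pb(2) by auto
      ultimately show ?thesis using True pb by (auto simp: p fan_def)
    qed (auto simp: rear_def)
  qed
  have sl: "starlike ?S"
    using lo_hi(3)[OF q lo_hi(2)[OF q]] narrow[OF q lo_hi(1)[OF q]] \<delta> by (rule starlike_cone_complement)
  have "loops_equiv ?A (?A \<union> rear q) b"
  proof (rule loops_equiv_attach_simply_connected)
    show "open ?A" using open_region open_front rear_halfspaces(2) by auto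
    show "open (rear q)" by (rule rear_halfspaces)
    show "path_connected ?A" "b \<in> ?A" using loops_equivD[OF IH] by auto
    show "simply_connected (rear q)" using rear_halfspaces(1) by (rule convex_imp_simply_connected)
    show "simply_connected (?A \<inter> rear q)" unfolding eq using sl by (rule starlike_imp_simply_connected)
    show "?A \<inter> rear q \<noteq> {}" unfolding eq using sl by (auto simp: starlike_def)
  qed
  moreover have "region 0 \<union> front \<union> (\<Union>q\<in>insert q I. rear q) = ?A \<union> rear q" by blast
  ultimately show ?case using loops_equiv_trans[OF IH] by (simp only:)
qed

text \<open>Of a window only the part in the plane \<open>y = 0\<close> is still missing:
  \<open>y < 0\<close> lies in \<open>front\<close> and \<open>y > 0\<close> in the box of its fan.
  The overlap consists of two convex halves, and each window contributes one generator.\<close>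

lemma stage_windows:
  assumes fl: "free_loops (region 0 \<union> front \<union> (\<Union>q\<in>Q. rear q)) b" and J: "finite J" "J \<subseteq> windows"
  shows "free_loops (region 0 \<union> front \<union> (\<Union>q\<in>Q. rear q) \<union> (\<Union>i\<in>J. window i)) b"
  using J
proof (induction J)
  case empty
  then show ?case using fl by simp
next
  case (insert i J)
  let ?B = "region 0 \<union> front \<union> (\<Union>q\<in>Q. rear q)"
  let ?A = "?B \<union> (\<Union>i\<in>J. window i)"
  obtain q d where i: "i = (q, d)" by (cases i)
  have iw: "(q, d) \<in> windows" using insert i by simp
  let ?O1 = "window i \<inter> {p. fst (snd p) < 0}" and ?O2 = "window i \<inter> {p. 0 < fst (snd p)}"
  have O: "convex {p :: real \<times> real \<times> real. fst (snd p) < 0}" "open {p :: real \<times> real \<times> real. fst (snd p) < 0}"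
    "convex {p :: real \<times> real \<times> real. 0 < fst (snd p)}" "open {p :: real \<times> real \<times> real. 0 < fst (snd p)}"
    using halfspace3[of 0 1 0 0] halfspace3[of 0 "-1" 0 0] by simp_all
  have eq: "?A \<inter> window i = ?O1 \<union> ?O2"
  proof (rule iffD2[OF set_eq_iff], rule allI)
    fix p :: "real \<times> real \<times> real"
    obtain x y z where p: "p = (x, y, z)" by (cases p)
    show "p \<in> ?A \<inter> window i \<longleftrightarrow> p \<in> ?O1 \<union> ?O2"
    proof (cases "p \<in> window i")
      case True
      have f: "(x, z) \<in> fan q" "q \<in> Q" using window_fan[OF iw] True by (auto simp: i p)
      have z: "-\<delta> < z" "z < 0" using True by (auto simp: i p window_def)
      have xq: "\<bar>x - q\<bar> < r" using fan_narrow[OF f(2,1) z(1)] .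
      have sh: "(x, z) \<in> shadow" using f by (auto simp: shadow_def)
      have "p \<notin> (\<Union>i\<in>J. window i)" using window_disjoint[of i] insert True by auto
      then have "p \<in> ?A \<longleftrightarrow> y < 0 \<or> (\<exists>q\<in>Q. p \<in> rear q)"
        using z \<delta> sh by (auto simp: p region_def front_def)
      moreover have "(\<exists>q\<in>Q. p \<in> rear q) \<longleftrightarrow> 0 < y" using f(2) xq z \<delta> by (auto simp: rear_def p)
      ultimately show ?thesis using True by (auto simp: p)
    qed auto
  qed
  have ne: "\<exists>p\<in>window i. fst (snd p) = s" for s :: real
  proof -
    have q: "q \<in> Q" and d: "d \<in> D q" "d < hi q" using iw by (auto simp: windows_def)
    have "finite {d' \<in> D q. d < d'}" "hi q \<in> {d' \<in> D q. d < d'}" using D(1)[OF q] lo_hi(2)[OF q] d by auto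
    then have "d < next_leg q d" unfolding next_leg_def using Min_in by blast
    then have "(q + (d + next_leg q d) / 2 * (\<delta>/2), s, -\<delta>/2) \<in> window i"
      using \<delta> by (auto simp: i window_def field_simps)
    then show ?thesis by force
  qed
  obtain z1 z2 where z: "z1 \<in> ?O1" "z2 \<in> ?O2" using ne[of "-1"] ne[of 1] by force
  have "free_loops (?A \<union> window i) b"
  proof (rule free_loops_attach[OF _ window_halfspaces(2) _ eq _ _ _ _ _ z])
    show "open ?A" by (intro open_Un open_UN ballI open_region open_front rear_halfspaces(2) window_halfspaces(2))
    show "simply_connected (window i)" by (intro convex_imp_simply_connected window_halfspaces)
    show "open ?O1" "open ?O2" by (intro open_Int window_halfspaces O)+
    show "simply_connected ?O1" "simply_connected ?O2"
      by (intro convex_imp_simply_connected convex_Int window_halfspaces O)+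
    show "free_loops ?A b" using insert by simp
  qed auto
  moreover have "?B \<union> (\<Union>i\<in>insert i J. window i) = ?A \<union> window i" by blast
  ultimately show ?case by (simp only:)
qed

lemma region_cover: "region (-\<delta>) = region 0 \<union> front \<union> (\<Union>q\<in>Q. rear q) \<union> (\<Union>i\<in>windows. window i)"
proof
  show "region (-\<delta>) \<subseteq> region 0 \<union> front \<union> (\<Union>q\<in>Q. rear q) \<union> (\<Union>i\<in>windows. window i)"
  proof
    fix p assume p: "p \<in> region (-\<delta>)"
    obtain x y z where pe: "p = (x, y, z)" by (cases p)
    have z: "-\<delta> < z" and nG: "(x, y, z) \<notin> G" using p by (auto simp: region_def pe)
    show "p \<in> region 0 \<union> front \<union> (\<Union>q\<in>Q. rear q) \<union> (\<Union>i\<in>windows. window i)"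
    proof (cases "0 < z \<or> y < 0 \<or> (x, z) \<notin> shadow")
      case True
      then show ?thesis using z nG \<delta> by (auto simp: region_def front_def pe)
    next
      case False
      then have z0: "z \<le> 0" and y: "0 \<le> y" and sh: "(x, z) \<in> shadow" by auto
      have zd: "\<bar>z\<bar> \<le> \<delta>" using z z0 by simp
      obtain q where q: "q \<in> Q" "(x, z) \<in> fan q"
      proof -
        consider "z = 0" "(x, z) \<in> \<Gamma>" | q' where "q' \<in> Q" "(x, z) \<in> fan q'"
          using sh z0 by (auto simp: shadow_def)
        then show ?thesis
        proof cases
          case 1
          then obtain q' d where "q' \<in> Q" "x = q'" using legs[of z x] \<delta> by auto
          then show ?thesis using 1 that[of q'] by (auto simp: fan_def)
        qed (use that in blast)
      qed
      have xq: "\<bar>x - q\<bar> < r" using fan_narrow[OF q z] .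
      show ?thesis
      proof (cases "0 < y")
        case True
        then have "p \<in> rear q" using xq z z0 \<delta> by (auto simp: rear_def pe)
        then show ?thesis using q by blast
      next
        case False
        then have "y = 0" using y by simp
        then have n\<Gamma>: "(x, z) \<notin> \<Gamma>" using nG flat[OF zd] by simp
        have zn: "z < 0"
        proof (rule ccontr)
          assume "\<not> z < 0"
          then have "z = 0" "x = q" using z0 q(2) by (auto simp: fan_def)
          then show False using n\<Gamma> legs[of z x] \<delta> q(1) lo_hi(1)[OF q(1)] by auto
        qed
        \<comment> \<open>The slope of a strand that would join the apex to the point; its position
          between two neighbouring slopes of \<open>D q\<close> identifies the window.\<close>
        define m where "m = (x - q) / (- z)"
        have xm: "x = q - m * z" using zn by (simp add: m_def)
        have nD: "m \<notin> D q" using n\<Gamma> legs[of z x] z z0 q(1) xm by auto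
        have "lo q \<le> m" "m \<le> hi q"
          using q(2) zn unfolding fan_def xm by (auto simp: algebra_simps mult_le_cancel_right)
        then have lm: "lo q < m" "m < hi q" using nD lo_hi(1,2)[OF q(1)] by (force simp: less_le)+
        define d where "d = Max {d \<in> D q. d < m}"
        have fin: "finite {d \<in> D q. d < m}" "lo q \<in> {d \<in> D q. d < m}"
          using D(1)[OF q(1)] lm lo_hi(1)[OF q(1)] by auto
        then have d: "d \<in> D q" "d < m" unfolding d_def using Max_in[OF fin(1)] by blast+
        have fin2: "finite {d' \<in> D q. d < d'}" "hi q \<in> {d' \<in> D q. d < d'}"
          using D(1)[OF q(1)] lm d lo_hi(2)[OF q(1)] by auto
        have nx: "next_leg q d \<in> D q" "d < next_leg q d"
          unfolding next_leg_def using Min_in[OF fin2(1)] fin2(2) by blast+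
        have "m < next_leg q d"
        proof (rule ccontr)
          assume "\<not> m < next_leg q d"
          then have "next_leg q d \<in> {d \<in> D q. d < m}" using nx nD by (auto simp: less_le)
          then have "next_leg q d \<le> d" unfolding d_def using fin(1) by (rule Max_ge[rotated])
          then show False using nx by simp
        qed
        then have "d * z > m * z" "m * z > next_leg q d * z" using d zn by (auto intro: mult_strict_right_mono_neg)
        then have "p \<in> window (q, d)" using z zn unfolding window_def pe xm by simp
        moreover have "(q, d) \<in> windows" using q d lm by (auto simp: windows_def)
        ultimately show ?thesis by blast
      qed
    qed
  qed
next
  have gs: "p \<in> region (-\<delta>)" if "-\<delta> < snd (snd p)" "snd (snd p) < \<delta>" "fst (snd p) = 0 \<Longrightarrow> (fst p, snd (snd p)) \<notin> \<Gamma>" for p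
    using flat[of "snd (snd p)" "fst p" "fst (snd p)"] that by (auto simp: region_def)
  have "region 0 \<subseteq> region (-\<delta>)" using \<delta> by (auto simp: region_def)
  moreover have "front \<subseteq> region (-\<delta>)"
  proof
    fix p assume p: "p \<in> front"
    have "(fst p, snd (snd p)) \<notin> \<Gamma>" if "(fst p, snd (snd p)) \<notin> shadow"
    proof
      assume g: "(fst p, snd (snd p)) \<in> \<Gamma>"
      show False
      proof (cases "0 \<le> snd (snd p)")
        case True
        then show False using g that by (auto simp: shadow_def)
      next
        case False
        then obtain q d where q: "q \<in> Q" "d \<in> D q" "fst p = q - d * snd (snd p)"
          using g legs[of "snd (snd p)" "fst p"] p by (auto simp: front_def)
        have "d * snd (snd p) \<le> lo q * snd (snd p)" "hi q * snd (snd p) \<le> d * snd (snd p)"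
          using False lo_hi(3,4)[OF q(1,2)] by (auto intro: mult_right_mono_neg)
        then have "0 \<le> fst p - q + lo q * snd (snd p)" "fst p - q + hi q * snd (snd p) \<le> 0"
          using q(3) by linarith+
        then have "(fst p, snd (snd p)) \<in> fan q" using False by (simp add: fan_def)
        then show False using that q(1) by (auto simp: shadow_def)
      qed
    qed
    then show "p \<in> region (-\<delta>)" using p by (intro gs) (auto simp: front_def)
  qed
  moreover have "rear q \<subseteq> region (-\<delta>)" for q
    by (auto simp: rear_def intro!: gs)
  moreover have "window i \<subseteq> region (-\<delta>)" if i: "i \<in> windows" for i
  proof
    fix p assume p: "p \<in> window i"
    obtain q d where ie: "i = (q, d)" by (cases i)
    have iw: "(q, d) \<in> windows" using i ie by simp
    have f: "(fst p, snd (snd p)) \<in> fan q" "q \<in> Q" using window_fan[OF iw] p ie by auto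
    have z: "-\<delta> < snd (snd p)" "snd (snd p) < 0" using p by (auto simp: ie window_def)
    have xq: "\<bar>fst p - q\<bar> < r" using fan_narrow[OF f(2,1) z(1)] .
    have "(fst p, snd (snd p)) \<notin> \<Gamma>"
    proof
      assume "(fst p, snd (snd p)) \<in> \<Gamma>"
      then obtain q' d' where q': "q' \<in> Q" "d' \<in> D q'" "fst p = q' - d' * snd (snd p)"
        using legs[of "snd (snd p)" "fst p"] z by auto
      have "\<bar>snd (snd p)\<bar> \<le> \<delta>" using z by simp
      then have "\<bar>d' * snd (snd p)\<bar> \<le> \<bar>d'\<bar> * \<delta>" unfolding abs_mult by (rule mult_left_mono) simp
      then have "\<bar>fst p - q'\<bar> < r" using narrow[OF q'(1,2)] q'(3) by linarith
      then have "q' = q" using apart[OF f(2) q'(1)] xq by linarith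
      then have qd: "d' \<in> D q" "fst p = q - d' * snd (snd p)" using q' by auto
      have "(d - d') * snd (snd p) > 0" "(next_leg q d - d') * snd (snd p) < 0"
        using p qd(2) by (auto simp: ie window_def algebra_simps)
      then have "d < d'" "d' < next_leg q d" using z by (auto simp: zero_less_mult_iff mult_less_0_iff)
      moreover have "next_leg q d \<le> d'" unfolding next_leg_def
        using qd(1) \<open>d < d'\<close> D(1)[OF f(2)] by (intro Min_le) auto
      ultimately show False by simp
    qed
    then show "p \<in> region (-\<delta>)" using z \<delta> by (intro gs) auto
  qed
  ultimately show "region 0 \<union> front \<union> (\<Union>q\<in>Q. rear q) \<union> (\<Union>i\<in>windows. window i) \<subseteq> region (-\<delta>)"
    by blast
qed

theorem free_loops_region:
  assumes "free_loops (region 0) b"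
  shows "free_loops (region (-\<delta>)) b"
proof -
  have "path_connected (region 0)" "b \<in> region 0" using assms by (auto simp: free_loops_def)
  then have "free_loops (region 0 \<union> front \<union> (\<Union>q\<in>Q. rear q)) b"
    using free_loops_equiv[OF stage_rear[OF _ _ fin_Q order_refl] assms] by blast
  moreover have "finite windows"
  proof (rule finite_subset)
    show "windows \<subseteq> (SIGMA q:Q. D q)" by (auto simp: windows_def)
    show "finite (SIGMA q:Q. D q)" using fin_Q D(1) by auto
  qed
  ultimately show ?thesis unfolding region_cover by (rule stage_windows) simp
qed

theorem loops_equiv_region:
  assumes "path_connected (region 0)" "b \<in> region 0" and single: "\<And>q. q \<in> Q \<Longrightarrow> \<exists>d. D q = {d}"
  shows "loops_equiv (region 0) (region (-\<delta>)) b"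
proof -
  have "windows = {}" using single by (force simp: windows_def hi_def)
  then show ?thesis using stage_rear[OF assms(1,2) fin_Q order_refl] region_cover by simp
qed

end

section \<open>Adapted frames of three-space\<close>

lemma avoid_hyperplanes:
  fixes B :: "'a::euclidean_space set"
  assumes "finite B" "0 \<notin> B"
  obtains u where "\<And>v. v \<in> B \<Longrightarrow> u \<bullet> v \<noteq> 0"
proof -
  have "negligible (\<Union>v\<in>B. {x. v \<bullet> x = 0})"
    using assms by (intro negligible_Union) (auto intro!: negligible_hyperplane)
  then have "(\<Union>v\<in>B. {x. v \<bullet> x = 0}) \<noteq> UNIV" using non_negligible_UNIV by metis
  then obtain u where "\<And>v. v \<in> B \<Longrightarrow> v \<bullet> u \<noteq> 0" by blast
  then show ?thesis using that by (metis inner_commute)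
qed

text \<open>The axes are orthogonal but not normalised, hence the divisions by squared lengths in
  \<open>uncoord\<close>; \<open>total\<close> says that they span.\<close>

locale frame3 =
  fixes u w h :: "real^3"
  assumes uw: "u \<bullet> w = 0" and uh: "u \<bullet> h = 0" and wh: "w \<bullet> h = 0"
    and u0: "u \<noteq> 0" and w0: "w \<noteq> 0" and h0: "h \<noteq> 0"
    and total: "p \<bullet> u = 0 \<Longrightarrow> p \<bullet> w = 0 \<Longrightarrow> p \<bullet> h = 0 \<Longrightarrow> p = 0"
begin

definition coord :: "real^3 \<Rightarrow> real \<times> real \<times> real" where
  "coord p = (u \<bullet> p, w \<bullet> p, h \<bullet> p)"

definition uncoord :: "real \<times> real \<times> real \<Rightarrow> real^3" where
  "uncoord = (\<lambda>(x, y, s). (x / (u \<bullet> u)) *\<^sub>R u + (y / (w \<bullet> w)) *\<^sub>R w + (s / (h \<bullet> h)) *\<^sub>R h)"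

lemma coord_uncoord [simp]: "coord (uncoord q) = q"
  using uw uh wh u0 w0 h0
  by (cases q) (simp add: coord_def uncoord_def inner_simps inner_commute)

lemma uncoord_coord [simp]: "uncoord (coord p) = p"
proof -
  have "coord (p - uncoord (coord p)) = 0"
    using coord_uncoord[of "coord p"] by (simp add: coord_def inner_diff_right zero_prod_def)
  then have "p - uncoord (coord p) = 0"
    by (intro total) (auto simp: coord_def inner_commute zero_prod_def)
  then show ?thesis by simp
qed

lemma continuous_coord: "continuous_on S coord" "continuous_on T uncoord"
proof -
  show "continuous_on S coord" unfolding coord_def by (intro continuous_intros)
  have "uncoord = (\<lambda>q. (fst q / (u \<bullet> u)) *\<^sub>R u + (fst (snd q) / (w \<bullet> w)) *\<^sub>R w + (snd (snd q) / (h \<bullet> h)) *\<^sub>R h)"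
    by (auto simp: uncoord_def)
  moreover have "continuous_on T \<dots>" by (intro continuous_intros) (use u0 w0 h0 in auto)
  ultimately show "continuous_on T uncoord" by simp
qed

end

text \<open>A vector off finitely many hyperplanes is made orthogonal to \<open>h\<close>; this
  leaves its inner products with the horizontal vectors of \<open>B\<close> unchanged. The third
  axis is a cross product.\<close>

lemma adapted_frame:
  fixes h :: "real^3"
  assumes h: "h \<noteq> 0" and B: "finite B" "\<And>v. v \<in> B \<Longrightarrow> v \<noteq> 0 \<and> h \<bullet> v = 0"
  obtains u w where "frame3 u w h" "\<And>v. v \<in> B \<Longrightarrow> u \<bullet> v \<noteq> 0"
proof -
  \<comment> \<open>A nonzero inner product with \<open>v0\<close> is demanded as well, which
    guarantees \<open>u \<noteq> 0\<close> even for empty \<open>B\<close>.\<close>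
  obtain v0 where v0: "v0 \<noteq> 0" "orthogonal h v0"
    using orthogonal_to_vector_exists[of h] by (auto simp: orthogonal_commute)
  obtain x where x: "\<And>v. v \<in> insert v0 B \<Longrightarrow> x \<bullet> v \<noteq> 0"
    using avoid_hyperplanes[of "insert v0 B"] B v0 by blast
  define u where "u = x - ((x \<bullet> h) / (h \<bullet> h)) *\<^sub>R h"
  have uv: "u \<bullet> v = x \<bullet> v" if "h \<bullet> v = 0" for v using that by (simp add: u_def inner_simps)
  have uB: "u \<bullet> v \<noteq> 0" if "v \<in> insert v0 B" for v
    using x[OF that] uv[of v] that B v0 by (auto simp: orthogonal_def)
  have u0: "u \<noteq> 0" using uB[of v0] by auto
  have uh: "u \<bullet> h = 0" using h by (simp add: u_def inner_simps)
  define w where "w = cross3 h u"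
  have w0: "w \<noteq> 0" using norm_and_cross_eq_0[of h u] uh u0 h by (auto simp: w_def inner_commute)
  have "frame3 u w h"
  proof
    show "u \<bullet> w = 0" "w \<bullet> h = 0" by (simp_all add: w_def dot_cross_self)
    fix p assume p: "p \<bullet> u = 0" "p \<bullet> w = 0" "p \<bullet> h = 0"
    have "cross3 p w = 0" unfolding w_def using p by (simp add: Lagrange)
    then show "p = 0" using norm_and_cross_eq_0[of p w] p w0 by simp
  qed (use u0 w0 h uh in auto)
  then show ?thesis using that uB by blast
qed

text \<open>Finitely many strict inequalities survive every sufficiently small perturbation. The
  thickness of the slabs and a bound on the shift of the vertices come from this.\<close>

lemma eventually_small_scale:
  fixes c k :: "'i \<Rightarrow> real"
  assumes "finite I" "\<And>i. i \<in> I \<Longrightarrow> k i > 0"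
  shows "\<exists>\<delta>0>0. \<forall>\<delta>. 0 < \<delta> \<longrightarrow> \<delta> < \<delta>0 \<longrightarrow> (\<forall>i\<in>I. \<delta> * c i < k i)"
  using assms
proof (induction I)
  case empty
  show ?case by (intro exI[of _ 1]) simp
next
  case (insert i I)
  obtain d where d: "d > 0" "\<And>\<delta> i. 0 < \<delta> \<Longrightarrow> \<delta> < d \<Longrightarrow> i \<in> I \<Longrightarrow> \<delta> * c i < k i"
    using insert by blast
  define e where "e = k i / (\<bar>c i\<bar> + 1)"
  have e: "e > 0" using insert.prems by (simp add: e_def)
  have "\<delta> * c i < k i" if "0 < \<delta>" "\<delta> < e" for \<delta>
  proof -
    have "\<delta> * c i \<le> \<delta> * (\<bar>c i\<bar> + 1)" using that by (intro mult_left_mono) auto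
    also have "\<dots> < k i" using that(2) unfolding e_def by (simp add: pos_less_divide_eq add_nonneg_pos)
    finally show ?thesis .
  qed
  then show ?case using d e by (intro exI[of _ "min d e"]) auto
qed

section \<open>Sweeping a graph with a unique local minimum\<close>

text \<open>By \<open>descent\<close> each vertex other than \<open>m\<close> has a strand leaving
  it downwards, as the nonempty fans of \<open>slab\<close> demand; by \<open>slanted\<close> edges
  can be parametrised by height.\<close>

locale sweep =
  fixes V :: "'v set" and E :: "'v set set" and f :: "'v \<Rightarrow> real^3" and h :: "real^3" and m :: 'v
  assumes simple: "simple_graph V E" and emb: "linear_embedding V E f" and h0: "h \<noteq> 0"
    and slanted: "\<And>a b. {a, b} \<in> E \<Longrightarrow> a \<noteq> b \<Longrightarrow> h \<bullet> f a \<noteq> h \<bullet> f b"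
    and m: "m \<in> V" and descent: "\<And>v. v \<in> V \<Longrightarrow> v \<noteq> m \<Longrightarrow> \<exists>a\<in>V. {a, v} \<in> E \<and> h \<bullet> f a < h \<bullet> f v"
begin

section \<open>Edges parametrised by height\<close>

abbreviation ht :: "'v \<Rightarrow> real" where "ht v \<equiv> h \<bullet> f v"
abbreviation G :: "(real^3) set" where "G \<equiv> graph_image V E f"

definition arcs :: "('v \<times> 'v) set" where
  "arcs = {(a, b). a \<in> V \<and> b \<in> V \<and> {a, b} \<in> E \<and> ht a < ht b}"

text \<open>Scaled to rise by one unit of height, so that \<open>point e s\<close> is the point at
  height \<open>s\<close> on the line through the edge, also beyond its ends.\<close>

definition slope :: "'v \<times> 'v \<Rightarrow> real^3" where
  "slope e = (1 / (ht (snd e) - ht (fst e))) *\<^sub>R (f (snd e) - f (fst e))"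

definition point :: "'v \<times> 'v \<Rightarrow> real \<Rightarrow> real^3" where
  "point e s = f (fst e) + (s - ht (fst e)) *\<^sub>R slope e"

definition above :: "real \<Rightarrow> (real^3) set" where
  "above t = {p. t < h \<bullet> p} - G"

lemma fin: "finite V" "finite arcs"
proof -
  show V: "finite V" using simple by (simp add: simple_graph_def)
  show "finite arcs" by (rule finite_subset[of _ "V \<times> V"]) (use V in \<open>auto simp: arcs_def\<close>)
qed

lemma ht_min: "v \<in> V \<Longrightarrow> v \<noteq> m \<Longrightarrow> ht m < ht v"
proof -
  define k where "k = arg_min_on ht V"
  have k: "k \<in> V" "\<And>v. v \<in> V \<Longrightarrow> ht k \<le> ht v"
    using arg_min_if_finite(1)[of V ht] arg_min_least[of V _ ht] fin(1) m unfolding k_def by auto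
  have km: "k = m" using descent[OF k(1)] k(2) by force
  show "ht m < ht v" if v: "v \<in> V" "v \<noteq> m"
  proof -
    obtain a where "a \<in> V" "ht a < ht v" using descent[OF v] by blast
    then show ?thesis using k(2)[of a] km by simp
  qed
qed

lemma ht_slope: "e \<in> arcs \<Longrightarrow> h \<bullet> slope e = 1"
  by (auto simp: arcs_def slope_def inner_simps)

lemma ht_point: "e \<in> arcs \<Longrightarrow> h \<bullet> point e s = s"
  by (simp add: point_def inner_simps ht_slope)

lemma point_add: "point e (s + d) = point e s + d *\<^sub>R slope e"
  by (simp add: point_def algebra_simps)

lemma edge_seg_eq: "edge_seg f {a, b} = closed_segment (f a) (f b)"
  by (simp add: edge_seg_def segment_convex_hull)

lemma arc_seg:
  assumes "e \<in> arcs"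
  shows "p \<in> edge_seg f {fst e, snd e} \<longleftrightarrow> ht (fst e) \<le> h \<bullet> p \<and> h \<bullet> p \<le> ht (snd e) \<and> p = point e (h \<bullet> p)"
proof -
  obtain a b where e: "e = (a, b)" by (cases e)
  have lt: "ht a < ht b" using assms by (simp add: arcs_def e)
  show ?thesis
  proof
    assume "p \<in> edge_seg f {fst e, snd e}"
    then obtain t where t: "0 \<le> t" "t \<le> 1" "p = (1 - t) *\<^sub>R f a + t *\<^sub>R f b"
      by (auto simp: edge_seg_eq e in_segment)
    have hp: "h \<bullet> p = ht a + t * (ht b - ht a)" unfolding t(3) by (simp add: inner_simps algebra_simps)
    have "t * (ht b - ht a) \<ge> 0" "t * (ht b - ht a) \<le> 1 * (ht b - ht a)"
      using t lt by (auto intro!: mult_right_mono mult_nonneg_nonneg)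
    moreover have "(h \<bullet> p - ht a) *\<^sub>R slope e = t *\<^sub>R (f b - f a)"
      using lt by (simp add: slope_def e hp)
    then have "point e (h \<bullet> p) = p"
      by (simp add: point_def e t(3) algebra_simps)
    ultimately show "ht (fst e) \<le> h \<bullet> p \<and> h \<bullet> p \<le> ht (snd e) \<and> p = point e (h \<bullet> p)"
      using hp by (simp add: e)
  next
    assume A: "ht (fst e) \<le> h \<bullet> p \<and> h \<bullet> p \<le> ht (snd e) \<and> p = point e (h \<bullet> p)"
    define t where "t = (h \<bullet> p - ht a) / (ht b - ht a)"
    have "0 \<le> t" "t \<le> 1" using A lt by (auto simp: t_def e divide_simps)
    moreover have "p = (1 - t) *\<^sub>R f a + t *\<^sub>R f b"
    proof -
      have "p = f a + t *\<^sub>R (f b - f a)" using A by (simp add: point_def slope_def e t_def)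
      then show ?thesis by (simp add: algebra_simps)
    qed
    ultimately show "p \<in> edge_seg f {fst e, snd e}" by (auto simp: edge_seg_eq e in_segment)
  qed
qed

lemma edge_arc:
  assumes "e \<in> E"
  obtains a where "a \<in> arcs" "e = {fst a, snd a}"
proof -
  obtain x y where xy: "x \<in> V" "y \<in> V" "x \<noteq> y" "e = {x, y}"
    using simple assms by (auto simp: simple_graph_def)
  then have "ht x < ht y \<or> ht y < ht x" using slanted[of x y] assms by (auto simp: neq_iff)
  then show ?thesis
    using that[of "(x, y)"] that[of "(y, x)"] xy assms by (auto simp: arcs_def insert_commute)
qed

lemma compact_G: "compact G"
proof -
  have "compact (edge_seg f e)" if "e \<in> E" for e
  proof -
    obtain x y where "e = {x, y}" using simple \<open>e \<in> E\<close> by (auto simp: simple_graph_def)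
    then show ?thesis by (simp add: edge_seg_eq)
  qed
  moreover have "finite E"
    by (rule finite_subset[of _ "Pow V"]) (use simple in \<open>auto simp: simple_graph_def\<close>)
  ultimately have "compact (\<Union>e\<in>E. edge_seg f e)" by (intro compact_UN)
  moreover have "compact (f ` V)" using fin(1) by (intro finite_imp_compact finite_imageI)
  ultimately show ?thesis unfolding graph_image_def by (intro compact_Un)
qed

lemma open_above: "open (above t)"
  unfolding above_def by (intro open_Diff open_Collect_less continuous_intros compact_imp_closed compact_G)

lemma arc_in_G: "e \<in> arcs \<Longrightarrow> ht (fst e) \<le> s \<Longrightarrow> s \<le> ht (snd e) \<Longrightarrow> point e s \<in> G"
proof -
  assume e: "e \<in> arcs" and s: "ht (fst e) \<le> s" "s \<le> ht (snd e)"
  have "point e s \<in> edge_seg f {fst e, snd e}" using arc_seg[OF e] s ht_point[OF e] by simp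
  moreover have "{fst e, snd e} \<in> E" using e by (auto simp: arcs_def)
  ultimately show ?thesis unfolding graph_image_def by blast
qed

lemma vertex_arc_down:
  assumes "v \<in> V" "v \<noteq> m"
  obtains e where "e \<in> arcs" "ht (fst e) < ht v" "snd e = v" "point e (ht v) = f v"
proof -
  obtain a where a: "a \<in> V" "{a, v} \<in> E" "ht a < ht v" using descent[OF assms] by blast
  show ?thesis
    by (rule that[of "(a, v)"]) (use a assms in \<open>auto simp: arcs_def point_def slope_def\<close>)
qed

text \<open>No vertex height other than \<open>t\<close> lies within \<open>\<delta>\<close> of
  \<open>t\<close>, so an edge that enters the slab reaches level \<open>t\<close>. A graph point at
  or below \<open>t\<close> even lies on an edge coming from strictly below: if its own edge only
  starts at level \<open>t\<close>, the point is a vertex, and \<open>vertex_arc_down\<close>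
  supplies another edge.\<close>

lemma near_level:
  assumes t: "ht m < t" and d: "\<And>v. v \<in> V \<Longrightarrow> ht v \<noteq> t \<Longrightarrow> \<delta> < \<bar>ht v - t\<bar>" "0 < \<delta>" and p: "p \<in> G" "\<bar>h \<bullet> p - t\<bar> \<le> \<delta>"
  shows "\<exists>e\<in>arcs. ht (fst e) \<le> t \<and> t \<le> ht (snd e) \<and> p = point e (h \<bullet> p) \<and> ht (fst e) \<le> h \<bullet> p"
    and "h \<bullet> p \<le> t \<Longrightarrow> \<exists>e\<in>arcs. ht (fst e) < t \<and> t \<le> ht (snd e) \<and> p = point e (h \<bullet> p)"
proof -
  have vd: "\<exists>e\<in>arcs. ht (fst e) < t \<and> t \<le> ht (snd e) \<and> f v = point e (ht v)" if v: "v \<in> V" "\<bar>ht v - t\<bar> \<le> \<delta>" for v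
  proof -
    have "ht v = t" using d(1)[OF v(1)] v(2) by fastforce
    moreover then have "v \<noteq> m" using t by auto
    ultimately show ?thesis using vertex_arc_down[OF v(1)] by (metis order_refl)
  qed
  have ed: "ht (fst e) \<le> t \<and> t \<le> ht (snd e)"
    if e: "e \<in> arcs" "ht (fst e) \<le> h \<bullet> p" "h \<bullet> p \<le> ht (snd e)" for e
  proof -
    have "fst e \<in> V" "snd e \<in> V" using e(1) by (auto simp: arcs_def)
    from d(1)[OF this(1)] d(1)[OF this(2)] show ?thesis using e p(2) d(2) by fastforce
  qed
  have "(\<exists>e\<in>arcs. ht (fst e) \<le> t \<and> t \<le> ht (snd e) \<and> p = point e (h \<bullet> p) \<and> ht (fst e) \<le> h \<bullet> p) \<and>
    (h \<bullet> p \<le> t \<longrightarrow> (\<exists>e\<in>arcs. ht (fst e) < t \<and> t \<le> ht (snd e) \<and> p = point e (h \<bullet> p)))"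
    using p(1) unfolding graph_image_def
  proof
    assume "p \<in> f ` V"
    then obtain v where v: "v \<in> V" "p = f v" by blast
    have "\<bar>ht v - t\<bar> \<le> \<delta>" using p(2) v(2) by simp
    from vd[OF v(1) this] obtain e where e: "e \<in> arcs" "ht (fst e) < t" "t \<le> ht (snd e)" "f v = point e (ht v)" by blast
    have "ht v = t" using d(1)[OF v(1)] p(2) v(2) by fastforce
    then show ?thesis using e v(2) by (intro conjI impI bexI[of _ e]) auto
  next
    assume "p \<in> (\<Union>e\<in>E. edge_seg f e)"
    then obtain e0 where "e0 \<in> E" "p \<in> edge_seg f e0" by blast
    then obtain e where e: "e \<in> arcs" "p \<in> edge_seg f {fst e, snd e}" by (metis edge_arc)
    then have pe: "ht (fst e) \<le> h \<bullet> p" "h \<bullet> p \<le> ht (snd e)" "p = point e (h \<bullet> p)" using arc_seg[OF e(1)] by auto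
    have et: "ht (fst e) \<le> t \<and> t \<le> ht (snd e)" using ed[OF e(1) pe(1,2)] .
    have "\<exists>e\<in>arcs. ht (fst e) < t \<and> t \<le> ht (snd e) \<and> p = point e (h \<bullet> p)" if "h \<bullet> p \<le> t"
    proof (cases "ht (fst e) = t")
      case True
      then have hp: "h \<bullet> p = ht (fst e)" using that pe by simp
      then have "p = f (fst e)" using pe(3) by (simp add: point_def)
      moreover have "fst e \<in> V" using e(1) by (auto simp: arcs_def)
      ultimately show ?thesis using vd[of "fst e"] p(2) by auto
    next
      case False
      then show ?thesis using e(1) et pe(3) by (intro bexI[of _ e]) auto
    qed
    then show ?thesis using e(1) et pe by blast
  qed
  then show "\<exists>e\<in>arcs. ht (fst e) \<le> t \<and> t \<le> ht (snd e) \<and> p = point e (h \<bullet> p) \<and> ht (fst e) \<le> h \<bullet> p"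
    and "h \<bullet> p \<le> t \<Longrightarrow> \<exists>e\<in>arcs. ht (fst e) < t \<and> t \<le> ht (snd e) \<and> p = point e (h \<bullet> p)" by blast+
qed

lemma arc_unique:
  assumes e: "e \<in> arcs" "e' \<in> arcs" and s: "ht (fst e) \<le> s" "s \<le> ht (snd e)" "ht (fst e') \<le> s" "s \<le> ht (snd e')"
    and eq: "point e s = point e' s" and nv: "s \<notin> ht ` V"
  shows "e = e'"
proof (rule ccontr)
  assume ne: "e \<noteq> e'"
  obtain a b a' b' where ab: "e = (a, b)" "e' = (a', b')" by (cases e, cases e')
  have E: "{a, b} \<in> E" "{a', b'} \<in> E" "{a, b} \<subseteq> V" "ht a < ht b" "ht a' < ht b'"
    using e by (auto simp: arcs_def ab)
  have "{a, b} \<noteq> {a', b'}"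
    using ne E(4,5) by (auto simp: ab doubleton_eq_iff)
  then have int: "edge_seg f {a, b} \<inter> edge_seg f {a', b'} = f ` ({a, b} \<inter> {a', b'})"
    using emb[unfolded linear_embedding_def, THEN conjunct2, THEN conjunct2, rule_format, OF E(1,2)] by simp
  have "point e s \<in> edge_seg f {a, b}" "point e' s \<in> edge_seg f {a', b'}"
    using arc_seg[OF e(1)] arc_seg[OF e(2)] s ht_point[OF e(1)] ht_point[OF e(2)] by (auto simp: ab)
  then have "point e s \<in> f ` ({a, b} \<inter> {a', b'})" using int eq by auto
  then obtain v where "v \<in> V" "point e s = f v" using E(3) by blast
  then show False using nv ht_point[OF e(1), of s] by (metis imageI)
qed

end

text \<open>On a compact set an injective projection is a homeomorphism onto its image, so the set
  is the graph of a continuous function; Tietze's theorem extends it to the plane.\<close>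

lemma compact_graph_function:
  fixes K :: "(real \<times> real \<times> real) set"
  assumes K: "compact K" and inj: "\<And>x y y' z. (x, y, z) \<in> K \<Longrightarrow> (x, y', z) \<in> K \<Longrightarrow> y = y'"
  obtains F :: "real \<times> real \<Rightarrow> real" where "continuous_on UNIV F" "\<And>x y z. (x, y, z) \<in> K \<Longrightarrow> F (x, z) = y"
proof -
  define pr :: "real \<times> real \<times> real \<Rightarrow> real \<times> real" where "pr p = (fst p, snd (snd p))" for p
  have cpr: "continuous_on K pr" unfolding pr_def by (intro continuous_intros)
  have ipr: "inj_on pr K"
    by (rule inj_onI) (auto simp: pr_def intro: inj)
  have "continuous_on (pr ` K) (the_inv_into K pr)"
    using continuous_on_inv_into[OF cpr K ipr] the_inv_into_f_f[OF ipr] inv_into_f_f[OF ipr]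
    by (auto intro: continuous_on_eq)
  then have 1: "continuous_on (pr ` K) (\<lambda>q. fst (snd (the_inv_into K pr q)))" by (intro continuous_intros)
  have "closedin (top_of_set UNIV) (pr ` K)"
    using compact_imp_closed[OF compact_continuous_image[OF cpr K]] by simp
  then obtain F where F: "continuous_on UNIV F" "\<And>q. q \<in> pr ` K \<Longrightarrow> F q = fst (snd (the_inv_into K pr q))"
    using Tietze_unbounded[OF 1] by metis
  have "F (x, z) = y" if "(x, y, z) \<in> K" for x y z
    using F(2)[OF imageI[OF that]] the_inv_into_f_f[OF ipr that] by (simp add: pr_def)
  then show ?thesis using that F(1) by blast
qed

context sweep
begin

text \<open>The slab is so thin that projection to the coordinates \<open>u\<close> and
  \<open>h\<close> is injective on its part of the graph; a shear along \<open>w\<close> then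
  produces a \<open>slab\<close>. The construction serves vertex levels, where generators may be
  added, and other levels, where each fan is a single strand.\<close>

lemma level_step:
  assumes t: "ht m < t"
  shows "\<exists>\<delta>0>0. \<forall>s. t - \<delta>0 < s \<longrightarrow> s < t \<longrightarrow> (\<forall>b. (free_loops (above t) b \<longrightarrow> free_loops (above s) b) \<and>
    (t \<notin> ht ` V \<longrightarrow> path_connected (above t) \<longrightarrow> b \<in> above t \<longrightarrow> loops_equiv (above t) (above s) b))"
proof -
  \<comment> \<open>Differences of positions at level \<open>t\<close> and of slopes, all
    horizontal. If \<open>u\<close> is orthogonal to no nonzero one, different points of the level
    and different directions stay different in the projection.\<close>
  define B where "B = ((\<lambda>(e, e'). point e t - point e' t) ` (arcs \<times> arcs) \<union>
    (\<lambda>(e, e'). slope e - slope e') ` (arcs \<times> arcs)) - {0}"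
  have "finite B" unfolding B_def using fin(2) by auto
  moreover have "v \<noteq> 0 \<and> h \<bullet> v = 0" if "v \<in> B" for v
    using that by (auto simp: B_def inner_diff_right ht_point ht_slope)
  ultimately obtain u w where fr: "frame3 u w h" and uB: "\<And>v. v \<in> B \<Longrightarrow> u \<bullet> v \<noteq> 0"
    using adapted_frame[OF h0, of B] by metis
  interpret frame3 u w h by (rule fr)
  have uP: "u \<bullet> (point e t - point e' t) \<noteq> 0" if "e \<in> arcs" "e' \<in> arcs" "point e t \<noteq> point e' t" for e e'
    using that by (intro uB) (auto simp: B_def)
  have uS: "u \<bullet> (slope e - slope e') \<noteq> 0" if "e \<in> arcs" "e' \<in> arcs" "slope e \<noteq> slope e'" for e e'
    using that by (intro uB) (auto simp: B_def)
  \<comment> \<open>An edge whose upper end is at level \<open>t\<close> is a strand; an edge whose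
    lower end is there leaves upwards and is none.\<close>
  define Ed where "Ed = {e \<in> arcs. ht (fst e) < t \<and> t \<le> ht (snd e)}"
  have finEd: "finite Ed" using fin(2) by (simp add: Ed_def)
  define Q where "Q = (\<lambda>e. u \<bullet> point e t) ` Ed"
  \<comment> \<open>Along an edge \<open>x\<close> grows by \<open>u \<bullet> slope e\<close> per
    unit of height, whereas strands are written \<open>x = q - d * z\<close>; hence the
    sign.\<close>
  define D where "D q = (\<lambda>e. - (u \<bullet> slope e)) ` {e \<in> Ed. u \<bullet> point e t = q}" for q
  have finQ: "finite Q" using finEd by (simp add: Q_def)
  obtain r0 where r0: "r0 > 0" "\<And>\<delta> i. 0 < \<delta> \<Longrightarrow> \<delta> < r0 \<Longrightarrow> i \<in> {i \<in> Q \<times> Q. fst i \<noteq> snd i} \<Longrightarrow> \<delta> * 2 < \<bar>fst i - snd i\<bar>"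
    using eventually_small_scale[of "{i \<in> Q \<times> Q. fst i \<noteq> snd i}" "\<lambda>i. \<bar>fst i - snd i\<bar>" "\<lambda>_. 2"] finQ by auto
  define r where "r = r0 / 2"
  have r: "r > 0" using r0 by (simp add: r_def)
  have apart: "2 * r \<le> \<bar>q - q'\<bar>" if "q \<in> Q" "q' \<in> Q" "q \<noteq> q'" for q q'
    using r0(2)[of r "(q, q')"] r0(1) that by (simp add: r_def)
  obtain d1 where d1: "d1 > 0" "\<And>\<delta> v. 0 < \<delta> \<Longrightarrow> \<delta> < d1 \<Longrightarrow> v \<in> {v \<in> V. ht v \<noteq> t} \<Longrightarrow> \<delta> * 1 < \<bar>ht v - t\<bar>"
    using eventually_small_scale[of "{v \<in> V. ht v \<noteq> t}" "\<lambda>v. \<bar>ht v - t\<bar>" "\<lambda>_. 1"] fin(1) by auto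
  define I2 where "I2 = {i \<in> arcs \<times> arcs. point (fst i) t \<noteq> point (snd i) t}"
  have I2: "finite I2" unfolding I2_def using fin(2) by simp
  \<comment> \<open>Edges that are apart at level \<open>t\<close> have projections that cannot meet
    within height \<open>\<delta>\<close> of it.\<close>
  obtain d2 where d2: "d2 > 0" "\<And>\<delta> i. 0 < \<delta> \<Longrightarrow> \<delta> < d2 \<Longrightarrow> i \<in> I2 \<Longrightarrow>
     \<delta> * \<bar>u \<bullet> (slope (fst i) - slope (snd i))\<bar> < \<bar>u \<bullet> (point (fst i) t - point (snd i) t)\<bar>"
    using eventually_small_scale[OF I2, of "\<lambda>i. \<bar>u \<bullet> (point (fst i) t - point (snd i) t)\<bar>"
        "\<lambda>i. \<bar>u \<bullet> (slope (fst i) - slope (snd i))\<bar>"] uP by (auto simp: I2_def)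
  obtain d3 where d3: "d3 > 0" "\<And>\<delta> e. 0 < \<delta> \<Longrightarrow> \<delta> < d3 \<Longrightarrow> e \<in> Ed \<Longrightarrow> \<delta> * \<bar>u \<bullet> slope e\<bar> < r"
    using eventually_small_scale[OF finEd, of "\<lambda>_. r" "\<lambda>e. \<bar>u \<bullet> slope e\<bar>"] r by auto
  show ?thesis
  proof (intro exI[of _ "min d1 (min d2 d3)"] conjI allI impI)
    show "0 < min d1 (min d2 d3)" using d1 d2 d3 by simp
    fix s assume s: "t - min d1 (min d2 d3) < s" "s < t"
    define \<delta> where "\<delta> = t - s"
    have \<delta>: "0 < \<delta>" "\<delta> < d1" "\<delta> < d2" "\<delta> < d3" using s by (auto simp: \<delta>_def)
    have far: "\<delta> < \<bar>ht v - t\<bar>" if "v \<in> V" "ht v \<noteq> t" for v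
      using d1(2)[OF \<delta>(1,2), of v] that by simp
    define L where "L = {p. \<bar>h \<bullet> p - t\<bar> \<le> \<delta>}"
    note near = near_level[OF t far \<delta>(1)]
    have inj: "p = p'" if p: "p \<in> G \<inter> L" and p': "p' \<in> G \<inter> L" and hh: "h \<bullet> p = h \<bullet> p'" and uu: "u \<bullet> p = u \<bullet> p'" for p p'
    proof -
      obtain e where e: "e \<in> arcs" "p = point e (h \<bullet> p)" using near(1)[of p] p by (auto simp: L_def)
      obtain e' where e': "e' \<in> arcs" "p' = point e' (h \<bullet> p')" using near(1)[of p'] p' by (auto simp: L_def)
      define \<sigma> where "\<sigma> = h \<bullet> p - t"
      have \<sigma>: "\<bar>\<sigma>\<bar> \<le> \<delta>" using p by (simp add: L_def \<sigma>_def)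
      have pe: "p = point e t + \<sigma> *\<^sub>R slope e" "p' = point e' t + \<sigma> *\<^sub>R slope e'"
        using e(2) e'(2) hh point_add[of e t \<sigma>] point_add[of e' t \<sigma>] by (simp_all add: \<sigma>_def)
      have z: "u \<bullet> (point e t - point e' t) + \<sigma> * (u \<bullet> (slope e - slope e')) = 0"
        using uu unfolding pe by (simp add: inner_simps algebra_simps)
      show ?thesis
      proof (cases "point e t = point e' t")
        case True
        then have "\<sigma> = 0 \<or> u \<bullet> (slope e - slope e') = 0" using z by simp
        then have "\<sigma> = 0 \<or> slope e = slope e'" using uS[OF e(1) e'(1)] by blast
        then show ?thesis using pe True by auto
      next
        case False
        then have "(e, e') \<in> I2" using e e' by (simp add: I2_def)
        then have lt: "\<delta> * \<bar>u \<bullet> (slope e - slope e')\<bar> < \<bar>u \<bullet> (point e t - point e' t)\<bar>"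
          using d2(2)[OF \<delta>(1,3), of "(e, e')"] by (simp only: fst_conv snd_conv)
        have "\<bar>u \<bullet> (point e t - point e' t)\<bar> = \<bar>\<sigma> * (u \<bullet> (slope e - slope e'))\<bar>" using z by linarith
        also have "\<dots> \<le> \<delta> * \<bar>u \<bullet> (slope e - slope e')\<bar>" unfolding abs_mult using \<sigma> by (intro mult_right_mono) auto
        finally show ?thesis using lt by simp
      qed
    qed
    have cL: "compact (G \<inter> L)"
    proof -
      have "L = {p. h \<bullet> p - t \<le> \<delta>} \<inter> {p. - \<delta> \<le> h \<bullet> p - t}" by (auto simp: L_def)
      moreover have "closed \<dots>" by (intro closed_Int closed_Collect_le continuous_intros)
      ultimately show ?thesis using compact_G by (simp add: compact_Int_closed)
    qed
    define \<Lambda> where "\<Lambda> p = (u \<bullet> p, w \<bullet> p, h \<bullet> p - t)" for p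
    have "compact (\<Lambda> ` (G \<inter> L))"
      unfolding \<Lambda>_def by (intro compact_continuous_image cL continuous_intros)
    moreover have "y = y'" if yy: "(x, y, z) \<in> \<Lambda> ` (G \<inter> L)" "(x, y', z) \<in> \<Lambda> ` (G \<inter> L)" for x y y' z
    proof -
      obtain p where p: "(x, y, z) = \<Lambda> p" "p \<in> G \<inter> L" using yy(1) by (rule imageE)
      obtain p' where p': "(x, y', z) = \<Lambda> p'" "p' \<in> G \<inter> L" using yy(2) by (rule imageE)
      have "p = p'" using inj[OF p(2) p'(2)] p(1) p'(1) by (simp add: \<Lambda>_def)
      then have "(x, y, z) = (x, y', z)" using p(1) p'(1) by (simp only:)
      then show ?thesis by simp
    qed
    ultimately obtain F where F: "continuous_on UNIV F" "\<And>x y z. (x, y, z) \<in> \<Lambda> ` (G \<inter> L) \<Longrightarrow> F (x, z) = y"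
      using compact_graph_function[of "\<Lambda> ` (G \<inter> L)"] by metis
    \<comment> \<open>Since \<open>F\<close> is defined on the whole plane, this shear is a
      homeomorphism of all of space and restricts to \<open>above t\<close> and to
      \<open>above s\<close> alike.\<close>
    define \<Psi> where "\<Psi> p = (u \<bullet> p, w \<bullet> p - F (u \<bullet> p, h \<bullet> p - t), h \<bullet> p - t)" for p
    define \<Psi>' where "\<Psi>' q = uncoord (fst q, fst (snd q) + F (fst q, snd (snd q)), snd (snd q) + t)" for q
    have inv: "\<Psi>' (\<Psi> p) = p" "\<Psi> (\<Psi>' q) = q" for p q
    proof -
      show "\<Psi>' (\<Psi> p) = p" using uncoord_coord[of p] by (simp add: \<Psi>_def \<Psi>'_def coord_def)
      have "coord (\<Psi>' q) = (fst q, fst (snd q) + F (fst q, snd (snd q)), snd (snd q) + t)"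
        unfolding \<Psi>'_def by simp
      then have "u \<bullet> \<Psi>' q = fst q" "w \<bullet> \<Psi>' q = fst (snd q) + F (fst q, snd (snd q))" "h \<bullet> \<Psi>' q = snd (snd q) + t"
        by (simp_all add: coord_def)
      then show "\<Psi> (\<Psi>' q) = q" by (simp add: \<Psi>_def)
    qed
    have cont: "continuous_on UNIV \<Psi>" "continuous_on UNIV \<Psi>'"
    proof -
      have 1: "continuous_on UNIV (\<lambda>p. F (u \<bullet> p, h \<bullet> p - t))"
        by (intro continuous_on_compose2[OF F(1)] continuous_intros) auto
      show "continuous_on UNIV \<Psi>" unfolding \<Psi>_def by (intro continuous_intros 1)
      have 2: "continuous_on UNIV (\<lambda>q::real \<times> real \<times> real. F (fst q, snd (snd q)))"
        by (intro continuous_on_compose2[OF F(1)] continuous_intros) auto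
      show "continuous_on UNIV \<Psi>'" unfolding \<Psi>'_def
        by (intro continuous_on_compose2[OF continuous_coord(2)[of UNIV]] continuous_intros 2) auto
    qed
    have hom: "homeomorphism UNIV UNIV \<Psi> \<Psi>'"
      unfolding homeomorphism_def using inv cont surjI[of \<Psi> \<Psi>'] surjI[of \<Psi>' \<Psi>] by simp
    define G' where "G' = \<Psi> ` G"
    define \<Gamma> where "\<Gamma> = (\<lambda>p. (u \<bullet> p, h \<bullet> p - t)) ` (G \<inter> L)"
    have G'_iff: "\<Psi> p \<in> G' \<longleftrightarrow> p \<in> G" for p
    proof
      assume "\<Psi> p \<in> G'"
      then obtain q where "\<Psi> p = \<Psi> q" "q \<in> G" unfolding G'_def by (rule imageE)
      moreover from this have "\<Psi>' (\<Psi> p) = \<Psi>' (\<Psi> q)" by (simp only:)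
      ultimately show "p \<in> G" unfolding inv by simp
    qed (simp add: G'_def)
    have flat0: "\<Psi> p = (u \<bullet> p, 0, h \<bullet> p - t)" if "p \<in> G \<inter> L" for p
      using F(2)[of "u \<bullet> p" "w \<bullet> p" "h \<bullet> p - t"] that by (simp add: \<Psi>_def \<Lambda>_def)
    have sl: "slab G' \<Gamma> Q D \<delta> r"
    proof
      show "closed G'" unfolding G'_def
        by (intro compact_imp_closed compact_continuous_image compact_G continuous_on_subset[OF cont(1)]) simp
      show "closed \<Gamma>" unfolding \<Gamma>_def by (intro compact_imp_closed compact_continuous_image cL continuous_intros)
      show "0 < \<delta>" "finite Q" using \<delta> finQ by auto
      show "finite (D q)" for q unfolding D_def using finEd by simp
      show "D q \<noteq> {}" if "q \<in> Q" for q using that by (auto simp: D_def Q_def)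
      show "2 * r \<le> \<bar>q - q'\<bar>" if "q \<in> Q" "q' \<in> Q" "q \<noteq> q'" for q q' using apart that .
      show "\<bar>d\<bar> * \<delta> < r" if qd: "q \<in> Q" "d \<in> D q" for q d
      proof -
        obtain e where "e \<in> Ed" "d = - (u \<bullet> slope e)" using qd by (auto simp: D_def)
        then show ?thesis using d3(2)[OF \<delta>(1,4)] by (simp add: mult.commute)
      qed
      show "((x, y, z) \<in> G') = (y = 0 \<and> (x, z) \<in> \<Gamma>)" if z: "\<bar>z\<bar> \<le> \<delta>" for x y z
      proof
        assume "(x, y, z) \<in> G'"
        then obtain p where "(x, y, z) = \<Psi> p" "p \<in> G" unfolding G'_def by (rule imageE)
        then have p: "p \<in> G" "\<Psi> p = (x, y, z)" by simp_all
        then have "h \<bullet> p - t = z" by (simp add: \<Psi>_def)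
        then have "p \<in> G \<inter> L" using z p(1) by (simp add: L_def)
        then show "y = 0 \<and> (x, z) \<in> \<Gamma>" using flat0 p(2) by (force simp: \<Gamma>_def)
      next
        assume "y = 0 \<and> (x, z) \<in> \<Gamma>"
        then obtain p where "p \<in> G \<inter> L" "x = u \<bullet> p" "z = h \<bullet> p - t" "y = 0" by (auto simp: \<Gamma>_def)
        then have "\<Psi> p = (x, y, z)" "p \<in> G" using flat0 by auto
        then show "(x, y, z) \<in> G'" unfolding G'_def by (metis imageI)
      qed
      show "((x, z) \<in> \<Gamma>) = (\<exists>q\<in>Q. \<exists>d\<in>D q. x = q - d * z)" if z: "- \<delta> \<le> z" "z \<le> 0" for x z
      proof
        assume "(x, z) \<in> \<Gamma>"
        then obtain p where p: "p \<in> G" "p \<in> L" "x = u \<bullet> p" "z = h \<bullet> p - t" by (auto simp: \<Gamma>_def)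
        then obtain e where e: "e \<in> arcs" "ht (fst e) < t" "t \<le> ht (snd e)" "p = point e (h \<bullet> p)"
          using near(2)[of p] z by (auto simp: L_def)
        have "p = point e t + z *\<^sub>R slope e" using e(4) point_add[of e t z] p(4) by simp
        then have "x = u \<bullet> point e t - (- (u \<bullet> slope e)) * z" using p(3) by (simp add: inner_simps algebra_simps)
        moreover have "e \<in> Ed" using e by (simp add: Ed_def)
        then have "u \<bullet> point e t \<in> Q" "- (u \<bullet> slope e) \<in> D (u \<bullet> point e t)"
          unfolding Q_def D_def by blast+
        ultimately show "\<exists>q\<in>Q. \<exists>d\<in>D q. x = q - d * z" by blast
      next
        assume "\<exists>q\<in>Q. \<exists>d\<in>D q. x = q - d * z"
        then obtain q d where qd: "d \<in> D q" "x = q - d * z" by blast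
        from qd(1) obtain e where "e \<in> Ed" "u \<bullet> point e t = q" "d = - (u \<bullet> slope e)" unfolding D_def by blast
        then have e: "e \<in> Ed" "x = u \<bullet> point e t - (- (u \<bullet> slope e)) * z" using qd(2) by simp_all
        have ea: "e \<in> arcs" "ht (fst e) < t" "t \<le> ht (snd e)" using e(1) by (auto simp: Ed_def)
        have "fst e \<in> V" using ea(1) by (auto simp: arcs_def)
        then have "ht (fst e) \<le> t + z" using far[of "fst e"] ea(2) z by linarith
        then have "point e (t + z) \<in> G" using arc_in_G[OF ea(1)] ea(3) z by simp
        moreover have "h \<bullet> point e (t + z) = t + z" using ht_point[OF ea(1)] .
        moreover have "u \<bullet> point e (t + z) = x" using e(2) by (simp add: point_add inner_simps algebra_simps)
        ultimately show "(x, z) \<in> \<Gamma>" unfolding \<Gamma>_def using z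
          by (intro image_eqI[of _ _ "point e (t + z)"]) (auto simp: L_def)
      qed
    qed
    interpret S: slab G' \<Gamma> Q D \<delta> r by (rule sl)
    have snd_\<Psi>: "snd (snd (\<Psi> p)) = h \<bullet> p - t" for p by (simp add: \<Psi>_def)
    have reg: "\<Psi> ` above (t + d) = S.region d" for d
    proof
      show "\<Psi> ` above (t + d) \<subseteq> S.region d"
        using G'_iff snd_\<Psi> by (auto simp: above_def S.region_def)
      show "S.region d \<subseteq> \<Psi> ` above (t + d)"
      proof
        fix q assume q: "q \<in> S.region d"
        have "\<Psi>' q \<in> above (t + d)"
          using q G'_iff[of "\<Psi>' q"] snd_\<Psi>[of "\<Psi>' q"] by (auto simp: inv above_def S.region_def)
        then show "q \<in> \<Psi> ` above (t + d)" using inv(2) by (metis imageI)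
      qed
    qed
    have reg0: "\<Psi> ` above t = S.region 0" "\<Psi> ` above s = S.region (- \<delta>)"
      using reg[of 0] reg[of "- \<delta>"] by (simp_all add: \<delta>_def)
    have h1: "homeomorphism (above t) (S.region 0) \<Psi> \<Psi>'" "homeomorphism (above s) (S.region (- \<delta>)) \<Psi> \<Psi>'"
      using homeomorphism_of_subsets[OF hom _ _ reg0(1)] homeomorphism_of_subsets[OF hom _ _ reg0(2)] by auto
    fix b
    show "free_loops (above s) b" if "free_loops (above t) b"
    proof -
      have "free_loops (S.region (- \<delta>)) (\<Psi> b)"
        by (intro S.free_loops_region free_loops_homeomorphism[OF h1(1) that])
      then show ?thesis
        using free_loops_homeomorphism[OF h1(2)[THEN homeomorphism_symD]] inv(1) by metis
    qed
    show "loops_equiv (above t) (above s) b"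
      if nv: "t \<notin> ht ` V" and pc: "path_connected (above t)" and b: "b \<in> above t"
    proof -
      have "path_connected (S.region 0)"
        using pc h1(1) homeomorphic_path_connectedness homeomorphic_def by blast
      moreover have "\<Psi> b \<in> S.region 0" using b reg0 by blast
      \<comment> \<open>Away from vertex heights a point of level \<open>t\<close> lies on one edge
        only, so its fan has one strand.\<close>
      moreover have "\<exists>d. D q = {d}" if q: "q \<in> Q" for q
      proof -
        obtain e where e: "e \<in> Ed" "u \<bullet> point e t = q" using q by (auto simp: Q_def)
        have "{e \<in> Ed. u \<bullet> point e t = q} = {e}"
        proof -
          have "e' = e" if e': "e' \<in> Ed" "u \<bullet> point e' t = q" for e'
          proof -
            have a: "e \<in> arcs" "e' \<in> arcs" using e e' by (auto simp: Ed_def)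
            have "u \<bullet> (point e' t - point e t) = 0" using e e' by (simp add: inner_diff_right)
            then have "point e' t = point e t" using uP[OF a(2,1)] by blast
            then show ?thesis using arc_unique[OF a(2,1), of t] e e' nv by (simp add: Ed_def)
          qed
          then show ?thesis using e by blast
        qed
        then show ?thesis unfolding D_def by auto
      qed
      ultimately have "loops_equiv (S.region 0) (S.region (- \<delta>)) (\<Psi> b)" by (rule S.loops_equiv_region)
      then show ?thesis
        using h1(2) by (rule loops_equiv_homeomorphism) (use s b reg0 in \<open>auto simp: above_def\<close>)
    qed
  qed
qed

section \<open>Descent through all levels down to the minimum\<close>

lemma above_directed:
  assumes "t < T" "compact K" "K \<subseteq> above t"
  shows "\<exists>Y\<in>{above s | s. t < s \<and> s \<le> T}. K \<subseteq> Y"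
proof (cases "K = {}")
  case True
  then show ?thesis using assms(1) by blast
next
  case False
  have "continuous_on K (\<lambda>p. h \<bullet> p)" by (intro continuous_intros)
  then obtain p where p: "p \<in> K" "\<And>q. q \<in> K \<Longrightarrow> h \<bullet> p \<le> h \<bullet> q"
    using continuous_attains_inf[OF assms(2) False, of "\<lambda>p. h \<bullet> p"] by blast
  define s where "s = min T ((t + h \<bullet> p) / 2)"
  have "t < h \<bullet> p" using p(1) assms(3) by (auto simp: above_def)
  then have s: "t < s" "s \<le> T" "s < h \<bullet> p" using assms(1) unfolding s_def by (simp_all add: min_less_iff_disj)
  have "K \<subseteq> above s" using assms(3) p(2) s by (force simp: above_def)
  then show ?thesis using s by blast
qed

lemma above_mono: "s \<le> t \<Longrightarrow> above t \<subseteq> above s"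
  by (auto simp: above_def)

text \<open>Real induction along \<open>level_step\<close> gives all levels strictly above
  \<open>t\<close>. The level \<open>t\<close> itself, possibly a vertex height, is reached as an
  increasing union.\<close>

lemma vertex_free_limit:
  assumes "t < t1" and nv: "\<And>v. v \<in> V \<Longrightarrow> \<not> (t < ht v \<and> ht v \<le> t1)" and "ht m \<le> t"
    and pc: "path_connected (above t1)" "b \<in> above t1"
  shows "loops_equiv (above t1) (above t) b"
proof (rule loops_equiv_directed_Union[where F = "{above s | s. t < s \<and> s \<le> t1}"])
  have "loops_equiv (above t1) (above s0) b" if s0: "t < s0" "s0 \<le> t1" for s0
  proof (rule real_induct_down[where P = "\<lambda>s. loops_equiv (above t1) (above s) b" and a = s0 and T = t1])
    show "loops_equiv (above t1) (above t1) b" using pc by (rule loops_equiv_refl)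
    fix s assume s: "s0 < s" "s \<le> t1" and e: "loops_equiv (above t1) (above s) b"
    have sn: "s \<notin> ht ` V" using nv s s0 by force
    obtain \<delta> where \<delta>: "\<delta> > 0" "\<And>s'. s - \<delta> < s' \<Longrightarrow> s' < s \<Longrightarrow> path_connected (above s) \<Longrightarrow> b \<in> above s \<Longrightarrow>
        loops_equiv (above s) (above s') b"
      using level_step[of s] s s0 assms(3) sn by (smt (verit, best))
    have "b \<in> above s" using loops_equivD(3,4)[OF e] by blast
    then show "\<exists>\<delta>>0. \<forall>s'. s - \<delta> < s' \<and> s' < s \<and> s0 \<le> s' \<longrightarrow> loops_equiv (above t1) (above s') b"
      using \<delta> loops_equivD(2)[OF e] loops_equiv_trans[OF e] by blast
  next
    fix s assume s: "s0 \<le> s" "s < t1" and IH: "\<And>s'. s < s' \<Longrightarrow> s' \<le> t1 \<Longrightarrow> loops_equiv (above t1) (above s') b"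
    show "loops_equiv (above t1) (above s) b"
    proof (rule loops_equiv_directed_Union[where F = "{above s' | s'. s < s' \<and> s' \<le> t1}"])
      fix K assume "compact K" "K \<subseteq> above s"
      then show "\<exists>Y\<in>{above s' |s'. s < s' \<and> s' \<le> t1}. K \<subseteq> Y" using above_directed[OF s(2)] by blast
    next
      fix Y assume "Y \<in> {above s' |s'. s < s' \<and> s' \<le> t1}"
      then obtain s' where s': "Y = above s'" "s < s'" "s' \<le> t1" by blast
      show "loops_equiv (above t1) Y b" unfolding s'(1) using IH s' by blast
      show "Y \<subseteq> above s" unfolding s'(1) using s'(2) by (intro above_mono) simp
    qed
  qed (use s0 in auto)
  then show "\<And>Y. Y \<in> {above s |s. t < s \<and> s \<le> t1} \<Longrightarrow> loops_equiv (above t1) Y b" by blast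
  show "\<And>Y. Y \<in> {above s |s. t < s \<and> s \<le> t1} \<Longrightarrow> Y \<subseteq> above t" using above_mono[of t] less_imp_le by blast
  fix K assume "compact K" "K \<subseteq> above t"
  then show "\<exists>Y\<in>{above s |s. t < s \<and> s \<le> t1}. K \<subseteq> Y" using above_directed[OF assms(1)] by blast
qed

lemma G_bounded: obtains T where "\<And>p. p \<in> G \<Longrightarrow> h \<bullet> p < T" "ht m < T"
proof -
  have "f m \<in> G" using m by (simp add: graph_image_def)
  moreover have "continuous_on G (\<lambda>p. h \<bullet> p)" by (intro continuous_intros)
  ultimately obtain q where "q \<in> G" "\<And>p. p \<in> G \<Longrightarrow> h \<bullet> p \<le> h \<bullet> q"
    using continuous_attains_sup[OF compact_G, of "\<lambda>p. h \<bullet> p"] by blast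
  then show ?thesis using that[of "h \<bullet> q + 1"] \<open>f m \<in> G\<close> by force
qed

lemma free_loops_above_min: "\<exists>b. free_loops (above (ht m)) b"
proof -
  obtain T where T: "\<And>p. p \<in> G \<Longrightarrow> h \<bullet> p < T" "ht m < T" using G_bounded by metis
  have aT: "above T = {p. T < h \<bullet> p}" using T(1) by (force simp: above_def)
  define b where "b = ((T + 1) / (h \<bullet> h)) *\<^sub>R h"
  have bT: "b \<in> above T" unfolding aT using h0 by (simp add: b_def)
  have cv: "convex (above T)" unfolding aT using convex_halfspace_gt[of T h] by simp
  have "free_loops (above (ht m)) b"
  proof (rule real_induct_down[where P = "\<lambda>t. free_loops (above t) b" and a = "ht m" and T = T])
    show "free_loops (above T) b"
      using free_loops_simply_connected[OF convex_imp_simply_connected[OF cv] bT] .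
    show "\<exists>\<delta>>0. \<forall>s. t - \<delta> < s \<and> s < t \<and> ht m \<le> s \<longrightarrow> free_loops (above s) b"
      if "ht m < t" "free_loops (above t) b" for t
      using level_step[OF that(1)] that(2) by blast
    fix t assume t: "ht m \<le> t" "t < T" and IH: "\<And>s. t < s \<Longrightarrow> s \<le> T \<Longrightarrow> free_loops (above s) b"
    \<comment> \<open>Half way from \<open>t\<close> to the lowest vertex height above it, with
      \<open>T\<close> as a fallback; no vertex occurs between \<open>t\<close> and
      \<open>t1\<close>.\<close>
    define t1 where "t1 = (t + Min (insert T (ht ` {v \<in> V. t < ht v}))) / 2"
    have "t < Min (insert T (ht ` {v \<in> V. t < ht v}))" (is "_ < ?M") using t fin(1) by auto
    moreover have "?M \<le> T" using fin(1) by simp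
    moreover have "\<And>v. v \<in> V \<Longrightarrow> t < ht v \<Longrightarrow> ?M \<le> ht v" using fin(1) by simp
    ultimately have t1: "t < t1" "t1 \<le> T" "\<And>v. v \<in> V \<Longrightarrow> \<not> (t < ht v \<and> ht v \<le> t1)"
      unfolding t1_def by (auto simp: not_le) (smt (verit) field_sum_of_halves)+
    have fl: "free_loops (above t1) b" using IH t1 by blast
    have "loops_equiv (above t1) (above t) b"
      using vertex_free_limit[OF t1(1,3) t(1)] fl by (simp add: free_loops_def)
    then show "free_loops (above t) b" using fl by (rule free_loops_equiv)
  qed (use T in auto)
  then show ?thesis by blast
qed

end

text \<open>The graph lies in a convex cone with apex at the minimum, and the outside of the cone is
  star-shaped. It meets \<open>above (ht m)\<close> in a connected set that surrounds the cone.
  Loops of this set are null in \<open>above (ht m)\<close>: scaling from the apex preserves the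
  outside of the cone and lifts them above the graph, into a half-space.\<close>

theorem (in sweep) free_loops_complement:
  assumes "p \<notin> G"
  shows "free_loops (- G) p"
proof -
  obtain b where fl: "free_loops (above (ht m)) b" using free_loops_above_min by blast
  obtain u w where "frame3 u w h" using adapted_frame[OF h0, of "{}"] by auto
  then interpret frame3 u w h .
  define z where "z = f m"
  define x where "x p = u \<bullet> (p - z)" for p
  define y where "y p = w \<bullet> (p - z)" for p
  define s where "s p = h \<bullet> (p - z)" for p
  note xys = x_def y_def s_def
  have sht: "s p = h \<bullet> p - ht m" for p by (simp add: s_def z_def inner_diff_right)
  \<comment> \<open>Large enough for every vertex other than \<open>m\<close>, since each quotient
    is at most the sum; the quotient at \<open>m\<close> is 0 by the convention on division by zero.
    The summand 1 makes \<open>K\<close> positive even if the sum vanishes.\<close>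
  define K where "K = 1 + (\<Sum>v\<in>V. (\<bar>x (f v)\<bar> + \<bar>y (f v)\<bar>) / s (f v))"
  have sv: "s (f v) \<ge> 0" if "v \<in> V" for v
    using ht_min[OF that] by (cases "v = m") (auto simp: sht)
  have Knn: "(\<Sum>v\<in>V. (\<bar>x (f v)\<bar> + \<bar>y (f v)\<bar>) / s (f v)) \<ge> 0"
    using sv by (intro sum_nonneg divide_nonneg_nonneg) auto
  have K0: "K > 0" using Knn by (simp add: K_def)
  \<comment> \<open>A pyramid rather than a round cone: it is an intersection of four half-spaces,
    and its outside at positive height is a union of four convex wedges.\<close>
  define C where "C = {p. \<bar>x p\<bar> \<le> K * s p \<and> \<bar>y p\<bar> \<le> K * s p}"
  have Ceq: "C = {p. (u - K *\<^sub>R h) \<bullet> p \<le> (u - K *\<^sub>R h) \<bullet> z} \<inter> {p. (- u - K *\<^sub>R h) \<bullet> p \<le> (- u - K *\<^sub>R h) \<bullet> z} \<inter>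
      {p. (w - K *\<^sub>R h) \<bullet> p \<le> (w - K *\<^sub>R h) \<bullet> z} \<inter> {p. (- w - K *\<^sub>R h) \<bullet> p \<le> (- w - K *\<^sub>R h) \<bullet> z}"
    by (auto simp: C_def xys inner_simps abs_le_iff algebra_simps)
  have Cconv: "convex C" unfolding Ceq by (intro convex_Int convex_halfspace_le)
  have Cclosed: "closed C" unfolding Ceq by (intro closed_Int closed_halfspace_le)
  have VC: "f v \<in> C" if v: "v \<in> V" for v
  proof (cases "v = m")
    case True
    then show ?thesis by (simp add: C_def xys z_def)
  next
    case False
    have pos: "s (f v) > 0" using ht_min[OF v False] by (simp add: sht)
    have "(\<bar>x (f v)\<bar> + \<bar>y (f v)\<bar>) / s (f v) \<le> (\<Sum>v\<in>V. (\<bar>x (f v)\<bar> + \<bar>y (f v)\<bar>) / s (f v))"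
      using sv v fin(1) by (intro member_le_sum divide_nonneg_nonneg) auto
    then have "(\<bar>x (f v)\<bar> + \<bar>y (f v)\<bar>) / s (f v) \<le> K" by (simp add: K_def)
    then have "\<bar>x (f v)\<bar> + \<bar>y (f v)\<bar> \<le> K * s (f v)" using pos by (simp add: pos_divide_le_eq)
    then have "\<bar>x (f v)\<bar> \<le> K * s (f v)" "\<bar>y (f v)\<bar> \<le> K * s (f v)" by linarith+
    then show ?thesis by (simp add: C_def)
  qed
  have GC: "G \<subseteq> C"
  proof -
    have "edge_seg f e \<subseteq> C" if "e \<in> E" for e
    proof -
      obtain a b where "a \<in> V" "b \<in> V" "e = {a, b}" using simple \<open>e \<in> E\<close> by (auto simp: simple_graph_def)
      then show ?thesis unfolding edge_seg_def using VC Cconv by (intro hull_minimal) auto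
    qed
    then show ?thesis unfolding graph_image_def using VC by blast
  qed
  have scale: "x (z + l *\<^sub>R (p - z)) = l * x p" "y (z + l *\<^sub>R (p - z)) = l * y p" "s (z + l *\<^sub>R (p - z)) = l * s p" for l p
    by (simp_all add: xys)
  have hh: "h \<bullet> h > 0" using h0 by simp
  let ?A = "above (ht m)" and ?U = "- C"
  have U_star: "starlike ?U"
    unfolding starlike_def
  \<comment> \<open>The centre lies in the cone opposite to \<open>C\<close>, so a segment from it
    that has entered \<open>C\<close> stays in \<open>C\<close>.\<close>
  proof (intro bexI[of _ "z - h"] ballI)
    have c: "x (z - h) = 0" "y (z - h) = 0" "s (z - h) = - (h \<bullet> h)"
      using uh wh by (simp_all add: xys inner_simps)
    have neg: "\<not> 0 \<le> K * (- (h \<bullet> h))" using K0 hh by (simp add: mult_less_0_iff not_le)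
    then show "z - h \<in> ?U" using c by (simp add: C_def)
    fix q assume q: "q \<in> ?U"
    show "closed_segment (z - h) q \<subseteq> ?U"
    proof
      fix v assume "v \<in> closed_segment (z - h) q"
      then obtain t where t: "0 \<le> t" "t \<le> 1" "v = (1 - t) *\<^sub>R (z - h) + t *\<^sub>R q" by (auto simp: in_segment)
      have vz: "v - z = (1 - t) *\<^sub>R (- h) + t *\<^sub>R (q - z)" unfolding t(3) by (simp add: algebra_simps)
      have v: "x v = t * x q" "y v = t * y q" "s v = t * s q - (1 - t) * (h \<bullet> h)"
        unfolding xys vz using uh wh by (simp_all add: inner_simps)
      show "v \<in> ?U"
      proof
        assume vC: "v \<in> C"
        have t0: "t > 0"
        proof (rule ccontr)
          assume "\<not> t > 0"
          then have "t = 0" using t by simp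
          then show False using vC v neg by (simp add: C_def)
        qed
        have "K * s v \<le> t * (K * s q)"
          using K0 hh t by (simp add: v(3) algebra_simps mult_left_le)
        moreover have "\<bar>x v\<bar> = t * \<bar>x q\<bar>" "\<bar>y v\<bar> = t * \<bar>y q\<bar>" using v t0 by (simp_all add: abs_mult)
        moreover have "\<bar>x v\<bar> \<le> K * s v" "\<bar>y v\<bar> \<le> K * s v" using vC by (auto simp: C_def)
        ultimately have "t * \<bar>x q\<bar> \<le> t * (K * s q)" "t * \<bar>y q\<bar> \<le> t * (K * s q)" by linarith+
        then have "q \<in> C" using t0 by (simp add: C_def)
        then show False using q by simp
      qed
    qed
  qed
  have cover: "?A \<union> ?U = - G"
  proof
    show "?A \<union> ?U \<subseteq> - G" using GC by (auto simp: above_def)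
    show "- G \<subseteq> ?A \<union> ?U"
    proof
      fix p assume p: "p \<in> - G"
      show "p \<in> ?A \<union> ?U"
      proof (cases "p \<in> C")
        case True
        have "s p > 0"
        proof (rule ccontr)
          assume "\<not> s p > 0"
          then have "K * s p \<le> 0" using K0 by (simp add: mult_le_0_iff)
          moreover have "\<bar>x p\<bar> \<le> K * s p" "\<bar>y p\<bar> \<le> K * s p" using True by (auto simp: C_def)
          ultimately have "x p = 0" "y p = 0" "K * s p = 0" by linarith+
          then have "p - z = 0" using K0 by (intro total) (auto simp: xys inner_commute)
          then have "p \<in> G" using m by (auto simp: z_def graph_image_def)
          then show False using p by simp
        qed
        then show ?thesis using p by (auto simp: above_def sht)
      qed simp
    qed
  qed
  have OU: "?A \<inter> ?U = {p. 0 < s p \<and> \<not> (\<bar>x p\<bar> \<le> K * s p \<and> \<bar>y p\<bar> \<le> K * s p)}"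
    using GC by (auto simp: above_def sht C_def)
  define pt where "pt a b c = z + uncoord (a, b, c)" for a b c
  have pt: "x (pt a b c) = a" "y (pt a b c) = b" "s (pt a b c) = c" for a b c
    using coord_uncoord[of "(a, b, c)"] by (simp_all add: coord_def xys pt_def)
  have pc: "path_connected (?A \<inter> ?U)"
  proof -
    let ?W = "\<lambda>a. {p. 0 < s p \<and> K * s p < a \<bullet> (p - z)}"
    have cW: "path_connected (?W a)" for a
    proof -
      have "?W a = {p. h \<bullet> p > h \<bullet> z} \<inter> {p. (a - K *\<^sub>R h) \<bullet> p > (a - K *\<^sub>R h) \<bullet> z}"
        by (auto simp: s_def inner_simps algebra_simps)
      moreover have "convex \<dots>" by (intro convex_Int convex_halfspace_gt)
      ultimately show ?thesis by (simp add: convex_imp_path_connected)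
    qed
    have W: "?W u = {p. 0 < s p \<and> K * s p < x p}" "?W (- u) = {p. 0 < s p \<and> K * s p < - x p}"
      "?W w = {p. 0 < s p \<and> K * s p < y p}" "?W (- w) = {p. 0 < s p \<and> K * s p < - y p}"
      by (auto simp: xys)
    have eq: "?A \<inter> ?U = ?W u \<union> ?W w \<union> ?W (- u) \<union> ?W (- w)"
      unfolding OU W by auto
    \<comment> \<open>Points that adjacent wedges share at \<open>s = 1\<close> link the four of
      them.\<close>
    have "pt (2 * K) (2 * K) 1 \<in> ?W u \<inter> ?W w" unfolding W using pt K0 by simp
    then have 1: "path_connected (?W u \<union> ?W w)" using path_connected_Un[OF cW cW] by blast
    have "pt (- 2 * K) (2 * K) 1 \<in> (?W u \<union> ?W w) \<inter> ?W (- u)" unfolding W using pt K0 by simp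
    then have 2: "path_connected (?W u \<union> ?W w \<union> ?W (- u))" using path_connected_Un[OF 1 cW] by blast
    have "pt (2 * K) (- 2 * K) 1 \<in> (?W u \<union> ?W w \<union> ?W (- u)) \<inter> ?W (- w)" unfolding W using pt K0 by simp
    then show ?thesis unfolding eq using path_connected_Un[OF 2 cW] by blast
  qed
  define z0 where "z0 = pt (2 * K) (2 * K) 1"
  have z0: "z0 \<in> ?A \<inter> ?U" unfolding OU z0_def using pt K0 by simp
  obtain T where T: "\<And>p. p \<in> G \<Longrightarrow> h \<bullet> p < T" "ht m < T" using G_bounded by metis
  have null: "pclass ?A q = pone ?A z0" if q: "q \<in> paths (?A \<inter> ?U) z0 z0" for q
  proof -
    note q' = pathsD[OF q]
    have qt: "q t \<in> ?A \<inter> ?U" if "t \<in> {0..1}" for t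
    proof -
      have "q t \<in> path_image q" using that unfolding path_image_def by (rule imageI)
      then show ?thesis using q'(2) by (rule rev_subsetD)
    qed
    have "continuous_on {0..1} (\<lambda>t. s (q t))" unfolding s_def
      using q'(1) by (intro continuous_intros) (simp add: path_def)
    then obtain t0 where t0: "t0 \<in> {0..1}" "\<And>t. t \<in> {0..1} \<Longrightarrow> s (q t0) \<le> s (q t)"
      using continuous_attains_inf[of "{0..1::real}" "\<lambda>t. s (q t)"] by auto
    have e0: "s (q t0) > 0" using qt[OF t0(1)] unfolding OU by simp
    \<comment> \<open>The factor is determined by the lowest point of the loop, so that every scaled
      point exceeds height \<open>T\<close>; the maximum with 1 makes the scaling an
      enlargement.\<close>
    define l where "l = max 1 ((T - ht m) / s (q t0) + 1)"
    have l: "l \<ge> 1" "l * s (q t) > T - ht m" if "t \<in> {0..1}" for t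
    proof -
      show "l \<ge> 1" by (simp add: l_def)
      have "T - ht m < ((T - ht m) / s (q t0) + 1) * s (q t0)" using e0 by (simp add: distrib_right)
      also have "\<dots> \<le> l * s (q t0)" using e0 by (intro mult_right_mono) (auto simp: l_def)
      also have "\<dots> \<le> l * s (q t)" using t0(2)[OF that] by (intro mult_left_mono) (auto simp: l_def)
      finally show "l * s (q t) > T - ht m" .
    qed
    define q1 where "q1 t = z + l *\<^sub>R (q t - z)" for t
    have pq1: "path q1" using q'(1) unfolding q1_def path_def by (intro continuous_intros)
    have top: "convex {p. T < h \<bullet> p}" "{p. T < h \<bullet> p} \<subseteq> ?A"
      using convex_halfspace_gt[of T h] T by (auto simp: above_def dest: less_asym)
    have q1T: "T < h \<bullet> q1 t" if "t \<in> {0..1}" for t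
      using l(2)[OF that] sht[of "q1 t"] scale(3)[of l "q t"] by (simp add: q1_def)
    \<comment> \<open>The base point moves with the loop; a loop freely homotopic to a constant one
      is nevertheless null as a based loop.\<close>
    have "homotopic_loops ?A q q1"
    proof (rule homotopic_loops_linear)
      show "pathfinish q = pathstart q" "pathfinish q1 = pathstart q1"
        using q' by (simp_all add: q1_def pathfinish_def pathstart_def)
      fix t :: real assume t: "t \<in> {0..1}"
      show "closed_segment (q t) (q1 t) \<subseteq> ?A"
      proof
        fix v assume "v \<in> closed_segment (q t) (q1 t)"
        then obtain r where r: "0 \<le> r" "r \<le> 1" "v = (1 - r) *\<^sub>R q t + r *\<^sub>R q1 t" by (auto simp: in_segment)
        define k where "k = 1 + r * (l - 1)"
        have k: "k > 0" using r l(1)[OF t] by (simp add: k_def add_pos_nonneg)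
        have v: "v = z + k *\<^sub>R (q t - z)" unfolding r(3) q1_def k_def by (simp add: algebra_simps)
        have "\<not> (\<bar>x (q t)\<bar> \<le> K * s (q t) \<and> \<bar>y (q t)\<bar> \<le> K * s (q t))" "0 < s (q t)"
          using qt[OF t] unfolding OU by auto
        moreover have e: "\<bar>x v\<bar> = k * \<bar>x (q t)\<bar>" "\<bar>y v\<bar> = k * \<bar>y (q t)\<bar>" "K * s v = k * (K * s (q t))"
          unfolding v scale using k by (simp_all add: abs_mult)
        have "\<bar>x v\<bar> \<le> K * s v \<longleftrightarrow> \<bar>x (q t)\<bar> \<le> K * s (q t)" "\<bar>y v\<bar> \<le> K * s v \<longleftrightarrow> \<bar>y (q t)\<bar> \<le> K * s (q t)"
          unfolding e using k by (simp_all only: mult_le_cancel_left_pos)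
        moreover have "s v > 0" unfolding v scale using k \<open>0 < s (q t)\<close> by simp
        ultimately have "v \<in> ?A \<inter> ?U" unfolding OU by simp
        then show "v \<in> ?A" by simp
      qed
    qed (use q' pq1 in auto)
    moreover have "homotopic_loops ?A q1 (linepath (q1 0) (q1 0))"
    proof (rule homotopic_loops_linear)
      show "pathfinish q1 = pathstart q1"
        using q' by (simp_all add: q1_def pathfinish_def pathstart_def)
      fix t :: real assume t: "t \<in> {0..1}"
      have "closed_segment (q1 t) (q1 0) \<subseteq> {p. T < h \<bullet> p}"
        using q1T[OF t] q1T[of 0] by (intro closed_segment_subset top(1)) auto
      then show "closed_segment (q1 t) (linepath (q1 0) (q1 0) t) \<subseteq> ?A"
        using top(2) by (simp add: linepath_def algebra_simps)
    qed (use pq1 in auto)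
    ultimately have "homotopic_loops ?A q (linepath (q1 0) (q1 0))" by (rule homotopic_loops_trans)
    then have "homotopic_paths ?A q (linepath (pathstart q) (pathstart q))"
      by (rule homotopic_loops_imp_homotopic_paths_null)
    then show ?thesis unfolding pone_def using q'(3) by (intro pclass_eqI) simp
  qed
  have "loops_equiv ?A (?A \<union> ?U) b"
  proof (rule loops_equiv_attach[OF open_above _ _ starlike_imp_simply_connected[OF U_star] pc z0 _ null])
    show "open ?U" using Cclosed by (simp add: open_Compl)
    show "path_connected ?A" "b \<in> ?A" using fl by (auto simp: free_loops_def)
  qed
  then have "free_loops (- G) b" unfolding cover using fl by (rule free_loops_equiv)
  then show ?thesis by (rule free_loops_change_base) (use assms in simp)
qed

section \<open>Perturbing a linear embedding\<close>

text \<open>McShane's formula: the infimum of \<open>r + L * dist x p\<close> over the prescribed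
  pairs. The Lipschitz condition at distance 0 makes the relation \<open>R\<close>
  single-valued.\<close>

lemma lipschitz_extension:
  fixes R :: "('a::metric_space \<times> real) set"
  assumes L: "L \<ge> 0" and R: "\<And>p r p' r'. (p, r) \<in> R \<Longrightarrow> (p', r') \<in> R \<Longrightarrow> \<bar>r - r'\<bar> \<le> L * dist p p'"
  shows "\<exists>\<phi>. (\<forall>p r. (p, r) \<in> R \<longrightarrow> \<phi> p = r) \<and> (\<forall>x y. \<bar>\<phi> x - \<phi> y\<bar> \<le> L * dist x y)"
proof (cases "R = {}")
  case True
  then show ?thesis using L by (intro exI[of _ "\<lambda>_. 0"]) simp
next
  case False
  then obtain p0 r0 where 0: "(p0, r0) \<in> R" by auto
  define F where "F x = (\<lambda>(p, r). r + L * dist x p) ` R" for x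
  define \<phi> where "\<phi> x = Inf (F x)" for x
  have ne: "F x \<noteq> {}" for x using False by (simp add: F_def)
  have bd: "bdd_below (F x)" for x
  proof (rule bdd_belowI)
    fix y assume "y \<in> F x"
    then obtain p r where pr: "(p, r) \<in> R" "y = r + L * dist x p" by (auto simp: F_def)
    have "L * dist p p0 \<le> L * (dist x p + dist x p0)"
      using L dist_triangle3[of p p0 x] by (intro mult_left_mono) auto
    then show "r0 - L * dist x p0 \<le> y" using R[OF pr(1) 0] pr(2) by (simp add: algebra_simps)
  qed
  have le: "\<phi> x \<le> \<phi> y + L * dist x y" for x y
  proof -
    have "\<phi> x - L * dist x y \<le> v" if v: "v \<in> F y" for v
    proof -
      obtain p r where pr: "(p, r) \<in> R" "v = r + L * dist y p" using v by (auto simp: F_def)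
      have "\<phi> x \<le> r + L * dist x p" unfolding \<phi>_def using bd pr(1) by (intro cInf_lower) (force simp: F_def)
      moreover have "L * dist x p \<le> L * (dist x y + dist y p)" using L by (intro mult_left_mono dist_triangle)
      ultimately show ?thesis using pr(2) by (simp add: algebra_simps)
    qed
    then have "\<phi> x - L * dist x y \<le> \<phi> y" unfolding \<phi>_def[of y] using ne by (intro cInf_greatest)
    then show ?thesis by simp
  qed
  have "\<bar>\<phi> x - \<phi> y\<bar> \<le> L * dist x y" for x y using le[of x y] le[of y x] by (simp add: dist_commute abs_le_iff)
  moreover have "\<phi> p = r" if pr: "(p, r) \<in> R" for p r
  proof (rule antisym)
    show "\<phi> p \<le> r" unfolding \<phi>_def using bd pr by (intro cInf_lower) (force simp: F_def)
    show "r \<le> \<phi> p" unfolding \<phi>_def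
    proof (intro cInf_greatest ne)
      fix v assume "v \<in> F p"
      then obtain p' r' where p': "(p', r') \<in> R" "v = r' + L * dist p p'" by (auto simp: F_def)
      then show "r \<le> v" using R[OF pr p'(1)] by simp
    qed
  qed
  ultimately show ?thesis by (intro exI[of _ \<phi>]) blast
qed

text \<open>After scaling the larger parameter to 1, the difference joins the end of one segment to
  a point of the other, and that end has positive distance from the other segment. So two segments
  from \<open>z\<close> separate at a linear rate.\<close>

lemma wedge_bound:
  fixes z p p' :: "'a::euclidean_space"
  assumes "p \<notin> closed_segment z p'" "p' \<notin> closed_segment z p"
  obtains d where "d > 0" "\<And>s t. s \<in> {0..1} \<Longrightarrow> t \<in> {0..1} \<Longrightarrow> d * max s t \<le> norm (s *\<^sub>R (p - z) - t *\<^sub>R (p' - z))"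
proof -
  have half: "\<exists>d>0. \<forall>s t. 0 \<le> t \<longrightarrow> t \<le> s \<longrightarrow> d * s \<le> norm (s *\<^sub>R (p - z) - t *\<^sub>R (p' - z))"
    if np: "p \<notin> closed_segment z p'" for p p' :: 'a
  proof -
    have "\<exists>d>0. \<forall>y\<in>closed_segment z p'. d \<le> dist p y"
      using separate_point_closed[OF closed_segment(1)] np by (simp add: separate_point_closed)
    then obtain d where d: "d > 0" "\<And>y. y \<in> closed_segment z p' \<Longrightarrow> d \<le> dist p y" by blast
    have "d * s \<le> norm (s *\<^sub>R (p - z) - t *\<^sub>R (p' - z))" if st: "0 \<le> t" "t \<le> s" for s t
    proof (cases "s = 0")
      case False
      then have s: "s > 0" using st by simp
      have "z + (t / s) *\<^sub>R (p' - z) \<in> closed_segment z p'"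
        using st s by (auto simp: in_segment algebra_simps intro!: exI[of _ "t / s"])
      then have "d \<le> norm (p - (z + (t / s) *\<^sub>R (p' - z)))" using d(2) by (simp add: dist_norm)
      then have "d * s \<le> norm (p - (z + (t / s) *\<^sub>R (p' - z))) * s" using s by (simp add: mult_right_mono)
      also have "\<dots> = norm (s *\<^sub>R (p - (z + (t / s) *\<^sub>R (p' - z))))" using s by simp
      also have "s *\<^sub>R (p - (z + (t / s) *\<^sub>R (p' - z))) = s *\<^sub>R (p - z) - t *\<^sub>R (p' - z)"
        using s by (simp add: algebra_simps)
      finally show ?thesis .
    qed (use st in simp)
    then show ?thesis using d(1) by blast
  qed
  obtain d1 where d1: "d1 > 0" "\<And>s t. 0 \<le> t \<Longrightarrow> t \<le> s \<Longrightarrow> d1 * s \<le> norm (s *\<^sub>R (p - z) - t *\<^sub>R (p' - z))"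
    using half[OF assms(1)] by blast
  obtain d2 where d2: "d2 > 0" "\<And>s t. 0 \<le> t \<Longrightarrow> t \<le> s \<Longrightarrow> d2 * s \<le> norm (s *\<^sub>R (p' - z) - t *\<^sub>R (p - z))"
    using half[OF assms(2)] by blast
  show ?thesis
  proof (rule that[of "min d1 d2"])
    fix s t :: real assume st: "s \<in> {0..1}" "t \<in> {0..1}"
    show "min d1 d2 * max s t \<le> norm (s *\<^sub>R (p - z) - t *\<^sub>R (p' - z))"
    proof (cases "t \<le> s")
      case True
      have "min d1 d2 * max s t \<le> d1 * s" using True st by (simp add: mult_right_mono)
      also have "\<dots> \<le> norm (s *\<^sub>R (p - z) - t *\<^sub>R (p' - z))" by (rule d1(2)) (use True st in auto)
      finally show ?thesis .
    next
      case False
      have "min d1 d2 * max s t \<le> d2 * t" using False st by (simp add: mult_right_mono)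
      also have "\<dots> \<le> norm (t *\<^sub>R (p' - z) - s *\<^sub>R (p - z))" by (rule d2(2)) (use False st in auto)
      finally show ?thesis by (simp only: norm_minus_commute)
    qed
  qed (use d1 d2 in auto)
qed

section \<open>Lipschitz extension of functions that are affine on edges\<close>

lemma simple_graph_edge_subset: "simple_graph V E \<Longrightarrow> e \<in> E \<Longrightarrow> e \<subseteq> V"
  by (force simp: simple_graph_def)

definition edge_values :: "('v \<Rightarrow> 'a::real_vector) \<Rightarrow> ('v \<Rightarrow> real) \<Rightarrow> 'v \<Rightarrow> 'v \<Rightarrow> ('a \<times> real) set" where
  "edge_values f a u v = (\<lambda>t. (f u + t *\<^sub>R (f v - f u), a u + t * (a v - a u))) ` {0..1}"

lemma edge_values_commute: "edge_values f a u v = edge_values f a v u"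
proof -
  have "edge_values f a u v \<subseteq> edge_values f a v u" for u v
  proof
    fix q assume "q \<in> edge_values f a u v"
    then obtain t where t: "t \<in> {0..1}" "q = (f u + t *\<^sub>R (f v - f u), a u + t * (a v - a u))"
      by (auto simp: edge_values_def)
    then have "q = (f v + (1 - t) *\<^sub>R (f u - f v), a v + (1 - t) * (a u - a v))"
      by (simp add: algebra_simps)
    then show "q \<in> edge_values f a v u"
      unfolding edge_values_def using t(1) by (intro image_eqI[of _ _ "1 - t"]) auto
  qed
  then show ?thesis by blast
qed

lemma edge_values_segment:
  assumes "(p, r) \<in> edge_values f a u v"
  shows "p \<in> closed_segment (f u) (f v)" "\<bar>r\<bar> \<le> \<bar>a u\<bar> + \<bar>a v\<bar>"
proof -
  obtain t where t: "t \<in> {0..1}" "p = f u + t *\<^sub>R (f v - f u)" "r = a u + t * (a v - a u)"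
    using assms by (auto simp: edge_values_def)
  show "p \<in> closed_segment (f u) (f v)"
    using t by (auto simp: in_segment algebra_simps intro!: exI[of _ t])
  have "r = (1 - t) * a u + t * a v" using t(3) by (simp add: algebra_simps)
  then have "\<bar>r\<bar> \<le> (1 - t) * \<bar>a u\<bar> + t * \<bar>a v\<bar>"
    using abs_triangle_ineq[of "(1 - t) * a u" "t * a v"] t(1) by (simp add: abs_mult)
  also have "\<dots> \<le> 1 * \<bar>a u\<bar> + 1 * \<bar>a v\<bar>" using t(1) by (intro add_mono mult_right_mono) auto
  finally show "\<bar>r\<bar> \<le> \<bar>a u\<bar> + \<bar>a v\<bar>" by simp
qed

text \<open>On one edge the values are affine; on two edges with a common end the values agree there
  and the edges separate linearly by \<open>wedge_bound\<close>; disjoint edges have positive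
  distance while the values are bounded.\<close>

lemma edge_values_lipschitz:
  fixes f :: "'v \<Rightarrow> real^3"
  assumes gr: "simple_graph V E" and emb: "linear_embedding V E f"
    and e: "{u, v} \<in> E" "u \<noteq> v" and e': "{u', v'} \<in> E" "u' \<noteq> v'"
  shows "\<exists>L\<ge>0. \<forall>(p, r)\<in>edge_values f a u v. \<forall>(p', r')\<in>edge_values f a u' v'. \<bar>r - r'\<bar> \<le> L * dist p p'"
    (is "?P u v u' v'")
proof -
  have inV: "x \<in> V" if "x \<in> ed" "ed \<in> E" for x ed
    using gr that by (auto simp: simple_graph_def)
  have inj: "inj_on f V" and off: "\<And>ed x. ed \<in> E \<Longrightarrow> x \<in> V \<Longrightarrow> x \<notin> ed \<Longrightarrow> f x \<notin> edge_seg f ed"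
    and int: "\<And>ed ed'. ed \<in> E \<Longrightarrow> ed' \<in> E \<Longrightarrow> ed \<noteq> ed' \<Longrightarrow> edge_seg f ed \<inter> edge_seg f ed' = f ` (ed \<inter> ed')"
    using emb unfolding linear_embedding_def by auto
  have seg: "edge_seg f {x, y} = closed_segment (f x) (f y)" for x y
    by (simp add: edge_seg_def segment_convex_hull)
  \<comment> \<open>Edges with a common end are parametrised from that end; the four ways of sharing
    an end reduce to this by \<open>edge_values_commute\<close>.\<close>
  have start: "?P x y x y'" if xy: "{x, y} \<in> E" "x \<noteq> y" "{x, y'} \<in> E" "x \<noteq> y'" for x y y'
  proof (cases "y = y'")
    case True
    have V: "x \<in> V" "y \<in> V" using inV[of x "{x, y}"] inV[of y "{x, y}"] xy(1) by auto
    have n: "norm (f y - f x) > 0" using inj V xy(2) by (auto simp: inj_on_def)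
    define L where "L = \<bar>a y - a x\<bar> / norm (f y - f x)"
    have L0: "L \<ge> 0" by (simp add: L_def)
    have "\<bar>r - r'\<bar> \<le> L * dist p p'" if pr: "(p, r) \<in> edge_values f a x y" "(p', r') \<in> edge_values f a x y" for p r p' r'
    proof -
      obtain t where t: "p = f x + t *\<^sub>R (f y - f x)" "r = a x + t * (a y - a x)"
        using pr(1) by (auto simp: edge_values_def)
      obtain t' where t': "p' = f x + t' *\<^sub>R (f y - f x)" "r' = a x + t' * (a y - a x)"
        using pr(2) by (auto simp: edge_values_def)
      have "r - r' = (t - t') * (a y - a x)" unfolding t t' by (simp add: algebra_simps)
      moreover have "p - p' = (t - t') *\<^sub>R (f y - f x)" unfolding t t' by (simp add: algebra_simps)
      ultimately have "\<bar>r - r'\<bar> = \<bar>t - t'\<bar> * \<bar>a y - a x\<bar>" "dist p p' = \<bar>t - t'\<bar> * norm (f y - f x)"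
        by (simp_all add: dist_norm abs_mult)
      then show ?thesis using n by (simp add: L_def)
    qed
    then show ?thesis using L0 True by (intro exI[of _ L]) auto
  next
    case False
    have V: "x \<in> V" "y \<in> V" "y' \<in> V"
      using inV[of x "{x, y}"] inV[of y "{x, y}"] inV[of y' "{x, y'}"] xy(1,3) by auto
    have 1: "f y \<notin> closed_segment (f x) (f y')" using off[OF xy(3) V(2)] xy False by (simp add: seg)
    have 2: "f y' \<notin> closed_segment (f x) (f y)" using off[OF xy(1) V(3)] xy False by (simp add: seg)
    obtain d where d: "d > 0" "\<And>s t. s \<in> {0..1} \<Longrightarrow> t \<in> {0..1} \<Longrightarrow>
        d * max s t \<le> norm (s *\<^sub>R (f y - f x) - t *\<^sub>R (f y' - f x))"
      using wedge_bound[OF 1 2] by metis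
    define M where "M = \<bar>a y - a x\<bar> + \<bar>a y' - a x\<bar>"
    have "\<bar>r - r'\<bar> \<le> M / d * dist p p'" if pr: "(p, r) \<in> edge_values f a x y" "(p', r') \<in> edge_values f a x y'" for p r p' r'
    proof -
      obtain s where s: "s \<in> {0..1}" "p = f x + s *\<^sub>R (f y - f x)" "r = a x + s * (a y - a x)"
        using pr(1) by (auto simp: edge_values_def)
      obtain t where t: "t \<in> {0..1}" "p' = f x + t *\<^sub>R (f y' - f x)" "r' = a x + t * (a y' - a x)"
        using pr(2) by (auto simp: edge_values_def)
      have "\<bar>s * (a y - a x)\<bar> \<le> max s t * \<bar>a y - a x\<bar>" "\<bar>t * (a y' - a x)\<bar> \<le> max s t * \<bar>a y' - a x\<bar>"
        unfolding abs_mult using s t by (auto intro!: mult_right_mono)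
      moreover have "r - r' = s * (a y - a x) - t * (a y' - a x)" using s t by simp
      ultimately have "\<bar>r - r'\<bar> \<le> max s t * \<bar>a y - a x\<bar> + max s t * \<bar>a y' - a x\<bar>" by linarith
      then have "\<bar>r - r'\<bar> \<le> M * max s t" by (simp add: M_def algebra_simps)
      also have "\<dots> = M / d * (d * max s t)" using d(1) by simp
      also have "\<dots> \<le> M / d * norm (s *\<^sub>R (f y - f x) - t *\<^sub>R (f y' - f x))"
        using d s t by (intro mult_left_mono d(2)) (auto simp: M_def)
      also have "s *\<^sub>R (f y - f x) - t *\<^sub>R (f y' - f x) = p - p'" using s t by simp
      finally show ?thesis by (simp add: dist_norm)
    qed
    moreover have "M / d \<ge> 0" using d(1) by (simp add: M_def)
    ultimately show ?thesis by (intro exI[of _ "M / d"]) auto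
  qed
  show ?thesis
  proof (cases "{u, v} \<inter> {u', v'} = {}")
    case True
    then have "edge_seg f {u, v} \<inter> edge_seg f {u', v'} = {}" using int[OF e(1) e'(1)] by auto
    then have "closed_segment (f u) (f v) \<inter> closed_segment (f u') (f v') = {}" by (simp add: seg)
    then obtain d where d: "d > 0" "\<And>p p'. p \<in> closed_segment (f u) (f v) \<Longrightarrow> p' \<in> closed_segment (f u') (f v') \<Longrightarrow> d \<le> dist p p'"
      using separate_compact_closed[OF compact_segment(1) closed_segment(1)] by metis
    define M where "M = \<bar>a u\<bar> + \<bar>a v\<bar> + (\<bar>a u'\<bar> + \<bar>a v'\<bar>)"
    have "\<bar>r - r'\<bar> \<le> M / d * dist p p'" if pr: "(p, r) \<in> edge_values f a u v" "(p', r') \<in> edge_values f a u' v'" for p r p' r'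
    proof -
      have "\<bar>r - r'\<bar> \<le> M" using edge_values_segment(2)[OF pr(1)] edge_values_segment(2)[OF pr(2)] unfolding M_def by linarith
      also have "\<dots> = M / d * d" using d(1) by simp
      also have "\<dots> \<le> M / d * dist p p'"
        using d edge_values_segment(1)[OF pr(1)] edge_values_segment(1)[OF pr(2)]
        by (intro mult_left_mono d(2)) (auto simp: M_def)
      finally show ?thesis .
    qed
    moreover have "M / d \<ge> 0" using d(1) by (simp add: M_def)
    ultimately show ?thesis by (intro exI[of _ "M / d"]) auto
  next
    case False
    have e2: "{v, u} \<in> E" "{v', u'} \<in> E" using e e' by (simp_all add: insert_commute)
    consider "u = u'" | "u = v'" | "v = u'" | "v = v'" using False by auto
    then show ?thesis
    proof cases
      case 1
      then show ?thesis using start[of u v v'] e e' by simp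
    next
      case 2
      then have "?P u v v' u'" using start[of u v u'] e e2(2) e'(2) by auto
      then show ?thesis by (simp only: edge_values_commute[of f a v' u'])
    next
      case 3
      then have "?P v u u' v'" using start[of v u v'] e2(1) e(2) e' by auto
      then show ?thesis by (simp only: edge_values_commute[of f a v u])
    next
      case 4
      then have "?P v u v' u'" using start[of v u u'] e2 e(2) e'(2) by auto
      then show ?thesis by (simp only: edge_values_commute[of f a v u] edge_values_commute[of f a v' u'])
    qed
  qed
qed

lemma affine_on_edges_extension:
  fixes f :: "'v \<Rightarrow> real^3" and a :: "'v \<Rightarrow> real"
  assumes gr: "simple_graph V E" and emb: "linear_embedding V E f"
  obtains L \<phi> where "L \<ge> 0" "\<And>x y. \<bar>\<phi> x - \<phi> y\<bar> \<le> L * dist x y"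
    "\<And>u v t. {u, v} \<in> E \<Longrightarrow> u \<noteq> v \<Longrightarrow> t \<in> {0..1} \<Longrightarrow> \<phi> (f u + t *\<^sub>R (f v - f u)) = a u + t * (a v - a u)"
proof -
  define ED where "ED = {(u, v). u \<in> V \<and> v \<in> V \<and> {u, v} \<in> E \<and> u \<noteq> v}"
  have fE: "finite ED"
    by (rule finite_subset[of _ "V \<times> V"]) (use gr in \<open>auto simp: ED_def simple_graph_def\<close>)
  define ev where "ev = (\<lambda>(u, v). edge_values f a u v)"
  have "\<exists>L\<ge>0. \<forall>(p, r)\<in>ev i. \<forall>(p', r')\<in>ev j. \<bar>r - r'\<bar> \<le> L * dist p p'" if ij: "i \<in> ED" "j \<in> ED" for i j
  proof -
    obtain u v u' v' where "i = (u, v)" "j = (u', v')" by (cases i, cases j)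
    then show ?thesis unfolding ev_def using edge_values_lipschitz[OF gr emb, of u v u' v' a] ij
      by (simp add: ED_def)
  qed
  then obtain Lc where Lc: "\<And>i j. i \<in> ED \<Longrightarrow> j \<in> ED \<Longrightarrow> Lc i j \<ge> 0"
    "\<And>i j p r p' r'. i \<in> ED \<Longrightarrow> j \<in> ED \<Longrightarrow> (p, r) \<in> ev i \<Longrightarrow> (p', r') \<in> ev j \<Longrightarrow> \<bar>r - r'\<bar> \<le> Lc i j * dist p p'"
    unfolding split_beta by (metis fst_conv snd_conv)
  define L where "L = (\<Sum>i\<in>ED. \<Sum>j\<in>ED. Lc i j)"
  have L0: "L \<ge> 0" unfolding L_def using Lc(1) by (intro sum_nonneg)
  have LcL: "Lc i j \<le> L" if "i \<in> ED" "j \<in> ED" for i j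
  proof -
    have "Lc i j \<le> (\<Sum>j\<in>ED. Lc i j)" using Lc(1) fE that by (intro member_le_sum) auto
    also have "\<dots> \<le> L" unfolding L_def using Lc(1) fE that by (intro member_le_sum sum_nonneg) auto
    finally show ?thesis .
  qed
  have lip: "\<bar>r - r'\<bar> \<le> L * dist p p'" if pr: "(p, r) \<in> (\<Union>i\<in>ED. ev i)" "(p', r') \<in> (\<Union>i\<in>ED. ev i)" for p r p' r'
  proof -
    obtain i where i: "i \<in> ED" "(p, r) \<in> ev i" using pr(1) by blast
    obtain j where j: "j \<in> ED" "(p', r') \<in> ev j" using pr(2) by blast
    have "\<bar>r - r'\<bar> \<le> Lc i j * dist p p'" using Lc(2)[OF i(1) j(1) i(2) j(2)] .
    also have "\<dots> \<le> L * dist p p'" using LcL[OF i(1) j(1)] by (rule mult_right_mono) simp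
    finally show ?thesis .
  qed
  have "\<exists>\<phi>. (\<forall>p r. (p, r) \<in> (\<Union>i\<in>ED. ev i) \<longrightarrow> \<phi> p = r) \<and> (\<forall>x y. \<bar>\<phi> x - \<phi> y\<bar> \<le> L * dist x y)"
    by (rule lipschitz_extension[OF L0]) (rule lip)
  then obtain \<phi> where \<phi>: "\<And>p r. (p, r) \<in> (\<Union>i\<in>ED. ev i) \<Longrightarrow> \<phi> p = r" "\<And>x y. \<bar>\<phi> x - \<phi> y\<bar> \<le> L * dist x y"
    by blast
  have "\<phi> (f u + t *\<^sub>R (f v - f u)) = a u + t * (a v - a u)" if uv: "{u, v} \<in> E" "u \<noteq> v" and t: "t \<in> {0..1}" for u v t
  proof (rule \<phi>(1))
    have "{u, v} \<subseteq> V" using simple_graph_edge_subset[OF gr uv(1)] .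
    then have "(u, v) \<in> ED" using uv by (simp add: ED_def)
    moreover have "(f u + t *\<^sub>R (f v - f u), a u + t * (a v - a u)) \<in> ev (u, v)"
      unfolding ev_def edge_values_def by (simp only: prod.case) (rule imageI[OF t])
    ultimately show "(f u + t *\<^sub>R (f v - f u), a u + t * (a v - a u)) \<in> (\<Union>i\<in>ED. ev i)" by blast
  qed
  with L0 \<phi>(2) show ?thesis by (rule that)
qed

text \<open>Distances shrink by no more than the factor \<open>k\<close>, whence injectivity and a
  Lipschitz inverse. A preimage of \<open>q\<close> is sought on the line through \<open>q\<close>
  in direction \<open>h\<close>, where the equation becomes a fixed-point problem for a contraction
  of the reals.\<close>

lemma shear_homeomorphism:
  fixes h :: "'a::banach" and \<phi> :: "'a \<Rightarrow> real"
  assumes lip: "\<And>x y. \<bar>\<phi> x - \<phi> y\<bar> \<le> L * dist x y" and L: "L \<ge> 0" "L * norm h < 1"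
  obtains \<Phi>' where "homeomorphism UNIV UNIV (\<lambda>p. p + \<phi> p *\<^sub>R h) \<Phi>'"
proof -
  define \<Phi> where "\<Phi> p = p + \<phi> p *\<^sub>R h" for p
  define k where "k = 1 - L * norm h"
  have k: "k > 0" using L by (simp add: k_def)
  have exp: "k * dist x y \<le> dist (\<Phi> x) (\<Phi> y)" for x y
  proof -
    have e: "\<Phi> x - \<Phi> y = (x - y) + (\<phi> x - \<phi> y) *\<^sub>R h" by (simp add: \<Phi>_def algebra_simps)
    have "norm (x - y) \<le> norm (\<Phi> x - \<Phi> y) + norm ((\<phi> x - \<phi> y) *\<^sub>R h)"
      using norm_triangle_ineq4[of "\<Phi> x - \<Phi> y" "(\<phi> x - \<phi> y) *\<^sub>R h"] by (simp add: e)
    also have "norm ((\<phi> x - \<phi> y) *\<^sub>R h) \<le> (L * dist x y) * norm h"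
      using lip by (simp add: mult_right_mono)
    finally show ?thesis by (simp add: k_def dist_norm algebra_simps)
  qed
  have inj: "inj \<Phi>"
  proof (rule injI)
    fix x y assume "\<Phi> x = \<Phi> y"
    then have "k * dist x y \<le> 0" using exp[of x y] by simp
    then show "x = y" using k by (simp add: mult_le_0_iff)
  qed
  have surj: "\<exists>p. \<Phi> p = q" for q
  proof -
    have "dist (\<phi> (q - s *\<^sub>R h)) (\<phi> (q - t *\<^sub>R h)) \<le> (L * norm h) * dist s t" for s t
    proof -
      have "dist (\<phi> (q - s *\<^sub>R h)) (\<phi> (q - t *\<^sub>R h)) \<le> L * dist (q - s *\<^sub>R h) (q - t *\<^sub>R h)"
        using lip by (simp add: dist_real_def)
      also have "(q - s *\<^sub>R h) - (q - t *\<^sub>R h) = (t - s) *\<^sub>R h" by (simp add: algebra_simps)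
      then have "dist (q - s *\<^sub>R h) (q - t *\<^sub>R h) = dist s t * norm h"
        by (simp only: dist_norm norm_scaleR) (simp add: abs_minus_commute)
      finally show ?thesis by (simp add: mult_ac)
    qed
    then obtain s where "\<phi> (q - s *\<^sub>R h) = s"
      using banach_fix_type[of "L * norm h" "\<lambda>s. \<phi> (q - s *\<^sub>R h)"] L by auto
    then have "\<Phi> (q - s *\<^sub>R h) = q" by (simp add: \<Phi>_def)
    then show ?thesis by blast
  qed
  then have bij: "bij \<Phi>" using inj by (metis bijI surjI)
  have "L-lipschitz_on UNIV \<phi>" using lip L by (intro lipschitz_onI) (auto simp: dist_real_def)
  then have cont: "continuous_on UNIV \<Phi>"
    unfolding \<Phi>_def by (intro continuous_intros lipschitz_on_continuous_on)
  have "(1 / k)-lipschitz_on UNIV (inv_into UNIV \<Phi>)"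
  proof (rule lipschitz_onI)
    fix x y
    have "k * dist (inv_into UNIV \<Phi> x) (inv_into UNIV \<Phi> y) \<le> dist x y"
      using exp[of "inv_into UNIV \<Phi> x" "inv_into UNIV \<Phi> y"] bij by (simp add: bij_is_surj surj_f_inv_f)
    then show "dist (inv_into UNIV \<Phi> x) (inv_into UNIV \<Phi> y) \<le> 1 / k * dist x y" using k by (simp add: field_simps)
  qed (use k in auto)
  then have conti: "continuous_on UNIV (inv_into UNIV \<Phi>)" by (rule lipschitz_on_continuous_on)
  have "homeomorphism UNIV UNIV \<Phi> (inv_into UNIV \<Phi>)"
    unfolding homeomorphism_def using bij cont conti
    by (simp add: bij_is_surj bij_is_inj surj_f_inv_f inv_f_f bij_imp_bij_inv)
  then show ?thesis using that unfolding \<Phi>_def by blast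
qed

text \<open>Moving the vertices along one direction and interpolating on the edges is the
  restriction of a shear of space. So small shifts of this kind preserve the embedding property and,
  up to homeomorphism, the complement. By \<open>cov\<close> every vertex lies on an edge, where the
  shear is prescribed.\<close>

lemma perturbed_embedding:
  fixes f :: "'v \<Rightarrow> real^3"
  assumes gr: "simple_graph V E" and emb: "linear_embedding V E f" and cov: "\<And>v. v \<in> V \<Longrightarrow> \<exists>u. {u, v} \<in> E \<and> u \<noteq> v"
  shows "\<exists>\<epsilon>0>0. \<forall>\<epsilon>. 0 < \<epsilon> \<longrightarrow> \<epsilon> < \<epsilon>0 \<longrightarrow> (\<exists>\<Phi> \<Phi>'. homeomorphism UNIV UNIV \<Phi> \<Phi>' \<and>
     linear_embedding V E (\<lambda>v. f v + (\<epsilon> * a v) *\<^sub>R h) \<and>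
     \<Phi> ` graph_image V E f = graph_image V E (\<lambda>v. f v + (\<epsilon> * a v) *\<^sub>R h))"
proof -
  obtain L \<phi> where L: "L \<ge> 0" and lip: "\<And>x y. \<bar>\<phi> x - \<phi> y\<bar> \<le> L * dist x y"
    and aff: "\<And>u v t. {u, v} \<in> E \<Longrightarrow> u \<noteq> v \<Longrightarrow> t \<in> {0..1} \<Longrightarrow> \<phi> (f u + t *\<^sub>R (f v - f u)) = a u + t * (a v - a u)"
    using affine_on_edges_extension[OF gr emb, of a] by metis
  define \<epsilon>0 where "\<epsilon>0 = 1 / (L * norm h + 1)"
  have Lh: "L * norm h + 1 > 0" using L by (simp add: add_nonneg_pos)
  show ?thesis
  proof (intro exI[of _ \<epsilon>0] conjI allI impI)
    show "\<epsilon>0 > 0" using Lh by (simp add: \<epsilon>0_def)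
    fix \<epsilon> assume \<epsilon>: "0 < \<epsilon>" "\<epsilon> < \<epsilon>0"
    define f' where "f' v = f v + (\<epsilon> * a v) *\<^sub>R h" for v
    have "\<epsilon> * (L * norm h + 1) < 1" using \<epsilon>(2) Lh by (simp add: \<epsilon>0_def pos_less_divide_eq)
    then have Le: "(\<epsilon> * L) * norm h < 1" using \<epsilon>(1) by (simp add: algebra_simps)
    have lip': "\<bar>\<epsilon> * \<phi> x - \<epsilon> * \<phi> y\<bar> \<le> (\<epsilon> * L) * dist x y" for x y
    proof -
      have "\<bar>\<epsilon> * \<phi> x - \<epsilon> * \<phi> y\<bar> = \<epsilon> * \<bar>\<phi> x - \<phi> y\<bar>" using \<epsilon>(1) by (simp add: abs_mult flip: right_diff_distrib)
      also have "\<dots> \<le> \<epsilon> * (L * dist x y)" using lip \<epsilon>(1) by (intro mult_left_mono) auto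
      finally show ?thesis by simp
    qed
    obtain \<Phi>' where hom: "homeomorphism UNIV UNIV (\<lambda>p. p + (\<epsilon> * \<phi> p) *\<^sub>R h) \<Phi>'"
      using shear_homeomorphism[OF lip' _ Le] L \<epsilon>(1) by auto
    define \<Phi> where "\<Phi> p = p + (\<epsilon> * \<phi> p) *\<^sub>R h" for p
    have hom: "homeomorphism UNIV UNIV \<Phi> \<Phi>'" using hom by (simp add: \<Phi>_def[abs_def])
    then have inj: "inj \<Phi>" unfolding homeomorphism_def by (metis UNIV_I injI)
    have aff': "\<Phi> (f u + t *\<^sub>R (f v - f u)) = f' u + t *\<^sub>R (f' v - f' u)"
      if "{u, v} \<in> E" "u \<noteq> v" "t \<in> {0..1}" for u v t
      unfolding \<Phi>_def aff[OF that] by (simp add: f'_def algebra_simps)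
    have vert: "\<Phi> (f v) = f' v" if v: "v \<in> V" for v
    proof -
      obtain u where "{v, u} \<in> E" "v \<noteq> u" using cov[OF v] by (auto simp: insert_commute)
      then show ?thesis using aff'[of v u 0] by simp
    qed
    have eV: "e \<subseteq> V" if "e \<in> E" for e using that gr by (auto simp: simple_graph_def)
    have segs: "edge_seg f' e = \<Phi> ` edge_seg f e" if e: "e \<in> E" for e
    proof -
      obtain u v where uv: "u \<noteq> v" "e = {u, v}" using gr e by (auto simp: simple_graph_def)
      have seg: "edge_seg g e = (\<lambda>t. g u + t *\<^sub>R (g v - g u)) ` {0..1}" for g :: "'v \<Rightarrow> real^3"
        unfolding uv(2) edge_seg_def by (simp add: segment_convex_hull[symmetric] closed_segment_image_interval algebra_simps)
      show ?thesis unfolding seg image_image using aff'[of u v] uv e by (intro image_cong) auto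
    qed
    have img: "\<Phi> ` graph_image V E f = graph_image V E f'"
    proof -
      have "\<Phi> ` f ` V = f' ` V" unfolding image_image using vert by (intro image_cong) auto
      moreover have "\<Phi> ` (\<Union>e\<in>E. edge_seg f e) = (\<Union>e\<in>E. edge_seg f' e)" using segs by auto
      ultimately show ?thesis unfolding graph_image_def by (simp add: image_Un)
    qed
    have inj': "inj_on f V" and off: "\<And>ed x. ed \<in> E \<Longrightarrow> x \<in> V \<Longrightarrow> x \<notin> ed \<Longrightarrow> f x \<notin> edge_seg f ed"
      and int: "\<And>ed ed'. ed \<in> E \<Longrightarrow> ed' \<in> E \<Longrightarrow> ed \<noteq> ed' \<Longrightarrow> edge_seg f ed \<inter> edge_seg f ed' = f ` (ed \<inter> ed')"
      using emb unfolding linear_embedding_def by auto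
    have "linear_embedding V E f'"
      unfolding linear_embedding_def
    proof (intro conjI ballI impI)
      show "inj_on f' V"
      proof (rule inj_onI)
        fix x y assume xy: "x \<in> V" "y \<in> V" "f' x = f' y"
        then have "f x = f y" using vert[OF xy(1)] vert[OF xy(2)] injD[OF inj] by metis
        then show "x = y" using inj' xy by (auto simp: inj_on_def)
      qed
      show "f' x \<notin> edge_seg f' e" if "e \<in> E" "x \<in> V" "x \<notin> e" for e x
        using off[OF that] inj unfolding segs[OF that(1)] vert[OF that(2), symmetric] by (auto dest: injD)
      fix e e' assume e: "e \<in> E" "e' \<in> E" "e \<noteq> e'"
      have "edge_seg f' e \<inter> edge_seg f' e' = \<Phi> ` (edge_seg f e \<inter> edge_seg f e')"
        unfolding segs[OF e(1)] segs[OF e(2)] using inj by (rule image_Int[symmetric])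
      also have "\<dots> = f' ` (e \<inter> e')" unfolding int[OF e] image_image
        using vert eV[OF e(1)] by (intro image_cong) auto
      finally show "edge_seg f' e \<inter> edge_seg f' e' = f' ` (e \<inter> e')" .
    qed
    then show "\<exists>\<Phi> \<Phi>'. homeomorphism UNIV UNIV \<Phi> \<Phi>' \<and>
     linear_embedding V E (\<lambda>v. f v + (\<epsilon> * a v) *\<^sub>R h) \<and>
     \<Phi> ` graph_image V E f = graph_image V E (\<lambda>v. f v + (\<epsilon> * a v) *\<^sub>R h)"
      using hom img unfolding f'_def[abs_def] by blast
  qed
qed

section \<open>Graphs close to complete graphs\<close>

text \<open>\<open>\<rho>\<close> is the distance to \<open>W\<close> in the graph, and
  \<open>par x\<close> can be taken as the next vertex on a shortest path from \<open>x\<close> to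
  \<open>W\<close>.\<close>

lemma rooted_forest:
  assumes gr: "simple_graph V E" and conn: "graph_connected V E" and W: "W \<subseteq> V" "W \<noteq> {}"
  obtains \<rho> :: "'v \<Rightarrow> nat" and par where
    "\<And>x. x \<in> V - W \<Longrightarrow> par x \<in> V \<and> {par x, x} \<in> E \<and> par x \<noteq> x \<and> \<rho> (par x) < \<rho> x"
proof -
  define R where "R = {(x, y). {x, y} \<in> E}"
  define P where "P x k \<longleftrightarrow> (\<exists>w\<in>W. (x, w) \<in> R ^^ k)" for x k
  have ex: "\<exists>k. P x k" if "x \<in> V" for x
  proof -
    obtain w where w: "w \<in> W" using W by blast
    then have "(x, w) \<in> R\<^sup>*" using conn that W unfolding graph_connected_def R_def by blast
    then show ?thesis unfolding P_def using rtrancl_imp_relpow w by blast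
  qed
  define \<rho> where "\<rho> x = (LEAST k. P x k)" for x
  have "\<exists>y. y \<in> V \<and> {y, x} \<in> E \<and> y \<noteq> x \<and> \<rho> y < \<rho> x" if x: "x \<in> V - W" for x
  proof -
    have "P x (\<rho> x)" unfolding \<rho>_def using ex x by (auto intro: LeastI_ex)
    then obtain w where w: "w \<in> W" "(x, w) \<in> R ^^ \<rho> x" unfolding P_def by blast
    obtain j where j: "\<rho> x = Suc j"
    proof (cases "\<rho> x")
      case 0
      then show ?thesis using w x by simp
    qed (use that in blast)
    then obtain y where y: "(x, y) \<in> R" "(y, w) \<in> R ^^ j" using w(2) relpow_Suc_D2 by metis
    then have E: "{x, y} \<in> E" by (simp add: R_def)
    obtain u v where "u \<in> V" "v \<in> V" "u \<noteq> v" "{x, y} = {u, v}" using gr E by (auto simp: simple_graph_def)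
    then have "y \<in> V" "y \<noteq> x" by (auto simp: doubleton_eq_iff)
    moreover have "\<rho> y \<le> j" unfolding \<rho>_def using y(2) w(1) by (intro Least_le) (auto simp: P_def)
    ultimately show ?thesis using E j by (intro exI[of _ y]) (auto simp: insert_commute)
  qed
  then show ?thesis using that[of _ \<rho>] by metis
qed

text \<open>Three vectors of three-space lie in a common closed half-space: either they are linearly
  independent, or they lie in a plane. This is where the bound of three additional vertices comes from.\<close>

lemma common_halfspace:
  fixes d :: "'v \<Rightarrow> real^3"
  assumes X: "finite X" "card X \<le> 3"
  obtains h where "h \<noteq> 0" "\<And>x. x \<in> X \<Longrightarrow> 0 \<le> h \<bullet> d x"
proof (cases "dim (d ` X) < 3")
  case True
  then have "dim (d ` X) < DIM(real^3)" by simp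
  then obtain h where h: "h \<noteq> 0" "\<And>y. y \<in> span (d ` X) \<Longrightarrow> orthogonal h y"
    using orthogonal_to_subspace_exists by metis
  have "0 \<le> h \<bullet> d x" if "x \<in> X" for x
    using h(2)[OF span_base[of "d x" "d ` X"]] that by (simp add: orthogonal_def)
  then show ?thesis using that h(1) by blast
next
  case False
  have "independent (d ` X)"
  proof (rule card_le_dim_spanning[of "d ` X" "span (d ` X)"])
    show "card (d ` X) \<le> dim (span (d ` X))" using False card_image_le[OF X(1), of d] X(2) by simp
  qed (use X in \<open>auto simp: span_superset\<close>)
  then obtain g :: "real^3 \<Rightarrow> real" where g: "linear g" "\<And>y. y \<in> d ` X \<Longrightarrow> g y = 1"
    using linear_independent_extend[of "d ` X" "\<lambda>_. 1::real"] by blast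
  \<comment> \<open>The vector representing the functional \<open>g\<close>, which takes the value 1
    on each of the independent vectors.\<close>
  define h where "h = adjoint g 1"
  have hd: "h \<bullet> y = g y" for y using adjoint_works[OF g(1), of y 1] by (simp add: h_def inner_commute)
  have "X \<noteq> {}" using False by auto
  then obtain x where "x \<in> X" by blast
  then have "h \<bullet> d x = 1" using g(2) hd by simp
  then have "h \<noteq> 0" by auto
  moreover have "0 \<le> h \<bullet> d x" if "x \<in> X" for x using g(2) hd that by simp
  ultimately show ?thesis using that by blast
qed

lemma (in sweep) is_free_group_complement:
  "b \<in> - G \<Longrightarrow> is_free_group (fundamental_group (- G) b)"
  by (intro free_loops_imp_is_free_group free_loops_complement) simp

text \<open>Labels order the vertices lexicographically, by \<open>\<rho>\<close> and then by an
  enumeration of \<open>V\<close>; the factor \<open>N\<close> exceeds every index.\<close>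

lemma increasing_labels:
  fixes \<rho> :: "'v \<Rightarrow> nat"
  assumes "finite V"
  obtains a :: "'v \<Rightarrow> real" where "inj_on a V" "\<And>x y. x \<in> V \<Longrightarrow> y \<in> V \<Longrightarrow> \<rho> x < \<rho> y \<Longrightarrow> a x < a y"
proof -
  obtain N :: nat and idx where idx: "idx ` V = {i. i < N}" "inj_on idx V"
    using finite_imp_inj_to_nat_seg[OF assms] by blast
  define c where "c v = \<rho> v * N + idx v" for v
  have lt: "idx v < N" if "v \<in> V" for v using idx(1) that by blast
  have inj: "inj_on (\<lambda>v. real (c v)) V"
  proof (rule inj_onI)
    fix x y assume xy: "x \<in> V" "y \<in> V" "real (c x) = real (c y)"
    then have "c x mod N = c y mod N" by simp
    then have "idx x = idx y" using lt xy by (simp add: c_def)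
    then show "x = y" using idx(2) xy by (simp add: inj_on_def)
  qed
  have mono: "real (c x) < real (c y)" if "x \<in> V" "y \<in> V" "\<rho> x < \<rho> y" for x y
  proof -
    have "c x < (\<rho> x + 1) * N" using lt[OF that(1)] by (simp add: c_def)
    also have "\<dots> \<le> \<rho> y * N" using that(3) by (intro mult_right_mono) auto
    also have "\<dots> \<le> c y" by (simp add: c_def)
    finally show ?thesis by simp
  qed
  show ?thesis by (rule that[OF inj mono])
qed

theorem free_complement:
  fixes V :: "'v set" and f :: "'v \<Rightarrow> real^3"
  assumes gr: "simple_graph V E" and conn: "graph_connected V E" and emb: "linear_embedding V E f"
    and W: "W \<subseteq> V" "W \<noteq> {}" "\<And>u v. u \<in> W \<Longrightarrow> v \<in> W \<Longrightarrow> u \<noteq> v \<Longrightarrow> {u, v} \<in> E"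
    and few: "card (V - W) \<le> 3" and b: "b \<in> - graph_image V E f"
  shows "is_free_group (fundamental_group (- graph_image V E f) b)"
\<comment> \<open>A single vertex lies on no edge, so \<open>perturbed_embedding\<close> does not
  apply to it; any nonzero direction will do.\<close>
proof (cases "\<exists>m. V = {m}")
  case True
  then obtain m where V: "V = {m}" by blast
  have "sweep V E f (axis 1 1) m"
  proof
    show "axis 1 1 \<noteq> (0 :: real^3)" by (simp add: axis_eq_0_iff)
    show "axis 1 1 \<bullet> f u \<noteq> axis 1 1 \<bullet> f v" if "{u, v} \<in> E" "u \<noteq> v" for u v
      using simple_graph_edge_subset[OF gr that(1)] that(2) V by auto
  qed (use gr emb V in auto)
  then show ?thesis using b by (rule sweep.is_free_group_complement)
next
  case False
  have finV: "finite V" using gr by (simp add: simple_graph_def)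
  have cov: "\<exists>u. {u, v} \<in> E \<and> u \<noteq> v" if v: "v \<in> V" for v
  proof -
    obtain w where w: "w \<in> V" "w \<noteq> v" using False v by blast
    have "(v, w) \<in> {(x, y). {x, y} \<in> E}\<^sup>*" using conn v w(1) unfolding graph_connected_def by simp
    then obtain u where "{v, u} \<in> E" using w(2) by (auto elim: converse_rtranclE)
    moreover have "u \<noteq> v" using gr calculation by (force simp: simple_graph_def doubleton_eq_iff)
    ultimately show ?thesis by (auto simp: insert_commute)
  qed
  obtain \<rho> :: "'v \<Rightarrow> nat" and par where
    par: "\<And>x. x \<in> V - W \<Longrightarrow> par x \<in> V \<and> {par x, x} \<in> E \<and> par x \<noteq> x \<and> \<rho> (par x) < \<rho> x"
    using rooted_forest[OF gr conn W(1,2)] by metis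
  \<comment> \<open>A child may still be level with its parent. The labels chosen next grow with
    \<open>\<rho>\<close>, hence from parent to child, and a shift by them along \<open>h\<close>
    breaks such ties in the right sense.\<close>
  obtain h where h: "h \<noteq> 0" "\<And>x. x \<in> V - W \<Longrightarrow> 0 \<le> h \<bullet> (f x - f (par x))"
    using common_halfspace[of "V - W" "\<lambda>x. f x - f (par x)"] finV few by auto
  obtain a :: "'v \<Rightarrow> real" where a: "inj_on a V" "\<And>x y. x \<in> V \<Longrightarrow> y \<in> V \<Longrightarrow> \<rho> x < \<rho> y \<Longrightarrow> a x < a y"
    using increasing_labels[OF finV, of \<rho>] by metis
  have hh: "h \<bullet> h > 0" using h(1) by simp
  obtain \<epsilon>1 where \<epsilon>1: "\<epsilon>1 > 0" "\<And>\<epsilon>. 0 < \<epsilon> \<Longrightarrow> \<epsilon> < \<epsilon>1 \<Longrightarrow> \<exists>\<Phi> \<Phi>'. homeomorphism UNIV UNIV \<Phi> \<Phi>' \<and>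
     linear_embedding V E (\<lambda>v. f v + (\<epsilon> * a v) *\<^sub>R h) \<and>
     \<Phi> ` graph_image V E f = graph_image V E (\<lambda>v. f v + (\<epsilon> * a v) *\<^sub>R h)"
    using perturbed_embedding[OF gr emb cov, of a h] by blast
  \<comment> \<open>Strict inequalities between heights must survive the shift; only equal heights
    are decided by the labels.\<close>
  define I where "I = {i \<in> V \<times> V. h \<bullet> f (fst i) < h \<bullet> f (snd i)}"
  have finI: "finite I" unfolding I_def using finV by simp
  obtain \<epsilon>2 where \<epsilon>2: "\<epsilon>2 > 0" "\<And>\<epsilon> i. 0 < \<epsilon> \<Longrightarrow> \<epsilon> < \<epsilon>2 \<Longrightarrow> i \<in> I \<Longrightarrow>
      \<epsilon> * ((a (fst i) - a (snd i)) * (h \<bullet> h)) < h \<bullet> f (snd i) - h \<bullet> f (fst i)"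
    using eventually_small_scale[OF finI, of "\<lambda>i. h \<bullet> f (snd i) - h \<bullet> f (fst i)" "\<lambda>i. (a (fst i) - a (snd i)) * (h \<bullet> h)"]
    by (auto simp: I_def)
  define \<epsilon> where "\<epsilon> = min \<epsilon>1 \<epsilon>2 / 2"
  have \<epsilon>: "0 < \<epsilon>" "\<epsilon> < \<epsilon>1" "\<epsilon> < \<epsilon>2" using \<epsilon>1(1) \<epsilon>2(1) by (auto simp: \<epsilon>_def)
  define f' where "f' v = f v + (\<epsilon> * a v) *\<^sub>R h" for v
  obtain \<Phi> \<Phi>' where hom: "homeomorphism UNIV UNIV \<Phi> \<Phi>'" and emb': "linear_embedding V E f'"
    and img: "\<Phi> ` graph_image V E f = graph_image V E f'"
    using \<epsilon>1(2)[OF \<epsilon>(1,2)] unfolding f'_def[abs_def] by blast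
  have ht: "h \<bullet> f' v = h \<bullet> f v + \<epsilon> * a v * (h \<bullet> h)" for v by (simp add: f'_def inner_simps)
  have less1: "h \<bullet> f' u < h \<bullet> f' v" if "u \<in> V" "v \<in> V" "h \<bullet> f u < h \<bullet> f v" for u v
    using \<epsilon>2(2)[OF \<epsilon>(1,3), of "(u, v)"] that by (simp add: I_def ht algebra_simps)
  have less2: "h \<bullet> f' u < h \<bullet> f' v" if "h \<bullet> f u = h \<bullet> f v" "a u < a v" for u v
    using that \<epsilon>(1) hh by (simp add: ht)
  have distinct: "h \<bullet> f' u \<noteq> h \<bullet> f' v" if uv: "u \<in> V" "v \<in> V" "u \<noteq> v" for u v
  proof -
    have "a u \<noteq> a v" using a(1) uv by (auto simp: inj_on_def)
    then consider "h \<bullet> f u < h \<bullet> f v" | "h \<bullet> f v < h \<bullet> f u" | "h \<bullet> f u = h \<bullet> f v" "a u < a v"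
      | "h \<bullet> f u = h \<bullet> f v" "a v < a u" by linarith
    then show ?thesis using less1[of u v] less1[of v u] less2[of u v] less2[of v u] uv by cases auto
  qed
  have par_less: "h \<bullet> f' (par x) < h \<bullet> f' x" if x: "x \<in> V - W" for x
  proof -
    have p: "par x \<in> V" "a (par x) < a x" using par[OF x] a(2) x by auto
    have "h \<bullet> f (par x) \<le> h \<bullet> f x" using h(2)[OF x] by (simp add: inner_diff_right)
    then show ?thesis using less1[of "par x" x] less2[of "par x" x] p x by fastforce
  qed
  have "V \<noteq> {}" using W by blast
  define m where "m = arg_min_on (\<lambda>v. h \<bullet> f' v) V"
  have m: "m \<in> V" "\<And>v. v \<in> V \<Longrightarrow> h \<bullet> f' m \<le> h \<bullet> f' v"
    using arg_min_if_finite(1)[OF finV \<open>V \<noteq> {}\<close>] arg_min_least[OF finV \<open>V \<noteq> {}\<close>] unfolding m_def by auto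
  \<comment> \<open>A lowest vertex outside \<open>W\<close> would have a lower parent. With
    \<open>m\<close> in \<open>W\<close>, completeness makes \<open>m\<close> a lower neighbour of
    every other vertex of \<open>W\<close>.\<close>
  have mW: "m \<in> W"
  proof (rule ccontr)
    assume "m \<notin> W"
    then have "m \<in> V - W" using m(1) by simp
    then show False using par_less[of m] par[of m] m(2)[of "par m"] by force
  qed
  have "sweep V E f' h m"
  proof
    show "h \<bullet> f' u \<noteq> h \<bullet> f' v" if "{u, v} \<in> E" "u \<noteq> v" for u v
      using simple_graph_edge_subset[OF gr that(1)] that(2) by (intro distinct) auto
    show "\<exists>u\<in>V. {u, v} \<in> E \<and> h \<bullet> f' u < h \<bullet> f' v" if v: "v \<in> V" "v \<noteq> m" for v
    proof (cases "v \<in> W")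
      case True
      have "h \<bullet> f' m < h \<bullet> f' v" using m(2)[OF v(1)] distinct[OF m(1) v(1)] v(2) by force
      moreover have "{m, v} \<in> E" using W(3)[OF mW True] v(2) by simp
      ultimately show ?thesis using m(1) by blast
    next
      case False
      then show ?thesis using par_less[of v] par[of v] v(1) by blast
    qed
  qed (use gr emb' h m in auto)
  then interpret S: sweep V E f' h m .
  have inv: "\<Phi>' (\<Phi> p) = p" "\<Phi> (\<Phi>' p) = p" for p using hom by (auto simp: homeomorphism_def)
  have "inj \<Phi>" using inv(1) by (metis injI)
  moreover have "surj \<Phi>" using inv(2) by (metis surjI)
  ultimately have im: "\<Phi> ` (- graph_image V E f) = - graph_image V E f'"
    using img bij_image_Compl_eq[of \<Phi>] by (simp add: bij_def)
  then have hom2: "homeomorphism (- graph_image V E f) (- graph_image V E f') \<Phi> \<Phi>'"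
    by (intro homeomorphism_of_subsets[OF hom]) auto
  then have "\<Phi> b \<notin> graph_image V E f'" using b unfolding homeomorphism_def by blast
  then have "free_loops (- graph_image V E f') (\<Phi> b)" by (rule S.free_loops_complement)
  then have "free_loops (- graph_image V E f) b"
    using free_loops_homeomorphism[OF hom2[THEN homeomorphism_symD]] inv(1) by metis
  then show ?thesis by (rule free_loops_imp_is_free_group)
qed

theorem theorem2:
  fixes V :: "'a set" and E :: "'a set set" and n :: nat
  assumes "n \<ge> 1"
    and "simple_graph V E"
    and "graph_connected V E"
    and "contains_complete V E n"
    and "card V \<le> n + 3"
  shows "linearly_free V E"
proof -
  obtain W where W: "W \<subseteq> V" "card W = n" "\<And>u v. u \<in> W \<Longrightarrow> v \<in> W \<Longrightarrow> u \<noteq> v \<Longrightarrow> {u, v} \<in> E"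
    using assms(4) unfolding contains_complete_def by blast
  have "W \<noteq> {}" using W(2) assms(1) by auto
  moreover have "card (V - W) \<le> 3"
    using W assms(2,5) by (simp add: card_Diff_subset finite_subset simple_graph_def)
  ultimately show ?thesis
    unfolding linearly_free_def using free_complement[OF assms(2,3) _ W(1) _ W(3)] by blast
qed

end
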